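(* Let ${}_GB_G$ be an orbisphere biset, with $G$ not cyclic. Then the automorphism group of ${}_GB_G$ is trivial: the only bijection $\beta\colon B\to B$ satisfying $\beta(hbg)=h\beta(b)g$ for all $h,g\in G$, $b\in B$ is the identity.
   Context: An orbisphere group is a group $G=\langle\gamma_1,\dots,\gamma_n\mid\gamma_1^{e_1},\dots,\gamma_n^{e_n},\gamma_1\cdots\gamma_n\rangle$ with $e_i\in\{2,3,\dots,\infty\}$ ($\gamma^\infty=1$ meaning no relation), together with its peripheral conjugacy classes $\gamma_i^G$; it is the orbifold fundamental group of a sphere with $n$ marked points of orders $e_i$. An orbisphere $G$-$G$-biset is a set $B$ with commuting left and right $G$-actions such that: $B$ is left-free with finitely many ($d$) left orbits and right-transitive; the permutations of the set of left orbits induced by the right action of $\gamma_1,\dots,\gamma_n$ have trivial product, generate a transitive group, and satisfy $\sum_i\sum_{c\text{ cycle of }\sigma_i}(\mathrm{length}(c)-1)=2d-2$; and the multiset of lifts of the peripheral classes contains each peripheral class exactly once, the other lifted classes being trivial. Here the lift of $g^G$ is computed by choosing a set $S$ of representatives of the left orbits, decomposing $S$ into $g$-orbits of sizes $d_i$ with representatives $s_i$, and writing $h_is_i=s_ig^{d_i}$; the lift is the multiset $\{(d_i,h_i^G)\}$.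
   Formalization: The orders (2,2,2m) with m finite (n = 3, up to reordering) are excluded: there G is dihedral of order 4m with a central z ≠ 1, every orbisphere biset has d = 1, and b ↦ zb (e.g. on B = G) is a nontrivial automorphism, so the claim fails. *)

theory Defs
  imports
    "HOL-Algebra.Elementary_Groups"
    "HOL-Algebra.Bij"
    "HOL-Combinatorics.Orbits"
    "HOL-Library.Extended_Nat"
    "HOL-Library.Multiset"
begin

subsection \<open>Group presentations\<close>

text \<open>A word is a list of letters; \<open>(i, True)\<close> stands for the generator with index \<open>i\<close>
  and \<open>(i, False)\<close> for its inverse. The relation \<open>pres_eq I R\<close> is the congruence on words
  whose quotient is the group with generators \<open>I\<close> and relators \<open>R\<close>.\<close>

inductive pres_eq ::
  "'i set \<Rightarrow> ('i \<times> bool) list set \<Rightarrow> ('i \<times> bool) list \<Rightarrow> ('i \<times> bool) list \<Rightarrow> bool"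
  for I R where
  refl: "pres_eq I R w w"
| sym: "pres_eq I R v w \<Longrightarrow> pres_eq I R w v"
| trans: "pres_eq I R u v \<Longrightarrow> pres_eq I R v w \<Longrightarrow> pres_eq I R u w"
| cancel: "i \<in> I \<Longrightarrow> pres_eq I R (u @ [(i, s), (i, \<not> s)] @ v) (u @ v)"
| relator: "r \<in> R \<Longrightarrow> pres_eq I R (u @ r @ v) (u @ v)"

definition word_val ::
  "('a, 'c) monoid_scheme \<Rightarrow> ('i \<Rightarrow> 'a) \<Rightarrow> ('i \<times> bool) list \<Rightarrow> 'a" where
  "word_val G \<gamma> w =
     foldr (\<lambda>(i, s) x. (if s then \<gamma> i else inv\<^bsub>G\<^esub> (\<gamma> i)) \<otimes>\<^bsub>G\<^esub> x) w \<one>\<^bsub>G\<^esub>"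

text \<open>\<open>G\<close> is the group presented by generators \<open>\<gamma> i\<close> for \<open>i \<in> I\<close> and relators \<open>R\<close>:
  the map from words to \<open>G\<close> is onto, and exactly the consequences of \<open>R\<close> are killed.\<close>

definition presented_group ::
  "('a, 'c) monoid_scheme \<Rightarrow> 'i set \<Rightarrow> ('i \<times> bool) list set \<Rightarrow> ('i \<Rightarrow> 'a) \<Rightarrow> bool" where
  "presented_group G I R \<gamma> \<longleftrightarrow>
     group G \<and> \<gamma> ` I \<subseteq> carrier G \<and> generate G (\<gamma> ` I) = carrier G \<and>
     (\<forall>w. fst ` set w \<subseteq> I \<longrightarrow> (word_val G \<gamma> w = \<one>\<^bsub>G\<^esub> \<longleftrightarrow> pres_eq I R w []))"


subsection \<open>Orbisphere groups\<close>

definition orbisphere_relators :: "nat \<Rightarrow> (nat \<Rightarrow> enat) \<Rightarrow> (nat \<times> bool) list set" where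
  "orbisphere_relators n e =
     {replicate k (i, True) | i k. i \<in> {1..n} \<and> e i = enat k} \<union>
     {map (\<lambda>i. (i, True)) [1..<Suc n]}"

locale orbisphere_group = group G for G :: "('a, 'c) monoid_scheme" (structure) +
  fixes n :: nat and e :: "nat \<Rightarrow> enat" and \<gamma> :: "nat \<Rightarrow> 'a"
  assumes orders: "\<And>i. i \<in> {1..n} \<Longrightarrow> 2 \<le> e i"
    and presentation: "presented_group G {1..n} (orbisphere_relators n e) \<gamma>"

text \<open>The orders \<open>(2, 2, 2m)\<close> with \<open>m\<close> finite, up to reordering. Here \<open>G\<close> is the dihedral group
  of order \<open>4m\<close> (the Klein four-group if \<open>m = 1\<close>), which is not cyclic but has a central
  element \<open>z \<noteq> 1\<close>. The biset \<open>B = G\<close> with \<open>d = 1\<close> is an orbisphere biset, and \<open>b \<mapsto> z b\<close> is a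
  nontrivial automorphism of it; these orders must therefore be excluded for automorphism groups
  of non-cyclic orbisphere bisets to be trivial.\<close>

definition even_dihedral_orders :: "nat \<Rightarrow> (nat \<Rightarrow> enat) \<Rightarrow> bool" where
  "even_dihedral_orders n e \<longleftrightarrow>
     n = 3 \<and> (\<exists>i j k m. {i, j, k} = {1..3} \<and> e i = 2 \<and> e j = 2 \<and> e k = enat (2 * m))"


subsection \<open>Bisets\<close>

definition conj_class :: "('a, 'c) monoid_scheme \<Rightarrow> 'a \<Rightarrow> 'a set" where
  "conj_class G g = {x \<otimes>\<^bsub>G\<^esub> g \<otimes>\<^bsub>G\<^esub> inv\<^bsub>G\<^esub> x | x. x \<in> carrier G}"

locale biset = group G for G :: "('a, 'c) monoid_scheme" (structure) +
  fixes B :: "'b set"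
    and lact :: "'a \<Rightarrow> 'b \<Rightarrow> 'b" (infixr \<open>\<rhd>\<close> 75)
    and ract :: "'b \<Rightarrow> 'a \<Rightarrow> 'b" (infixl \<open>\<lhd>\<^sub>r\<close> 76)
  assumes lact_closed: "\<lbrakk>h \<in> carrier G; b \<in> B\<rbrakk> \<Longrightarrow> h \<rhd> b \<in> B"
    and ract_closed: "\<lbrakk>g \<in> carrier G; b \<in> B\<rbrakk> \<Longrightarrow> b \<lhd>\<^sub>r g \<in> B"
    and lact_one: "b \<in> B \<Longrightarrow> \<one> \<rhd> b = b"
    and ract_one: "b \<in> B \<Longrightarrow> b \<lhd>\<^sub>r \<one> = b"
    and lact_mult: "\<lbrakk>h \<in> carrier G; h' \<in> carrier G; b \<in> B\<rbrakk> \<Longrightarrow> (h \<otimes> h') \<rhd> b = h \<rhd> (h' \<rhd> b)"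
    and ract_mult: "\<lbrakk>g \<in> carrier G; g' \<in> carrier G; b \<in> B\<rbrakk> \<Longrightarrow> b \<lhd>\<^sub>r (g \<otimes> g') = (b \<lhd>\<^sub>r g) \<lhd>\<^sub>r g'"
    and act_commute: "\<lbrakk>h \<in> carrier G; g \<in> carrier G; b \<in> B\<rbrakk> \<Longrightarrow> (h \<rhd> b) \<lhd>\<^sub>r g = h \<rhd> (b \<lhd>\<^sub>r g)"
begin

definition left_orbits :: "'b set set" where
  "left_orbits = (\<lambda>b. (\<lambda>h. h \<rhd> b) ` carrier G) ` B"

text \<open>The permutation of the left orbits induced by the right action of \<open>g\<close>.\<close>

definition rperm :: "'a \<Rightarrow> 'b set \<Rightarrow> 'b set" where
  "rperm g = (\<lambda>X\<in>left_orbits. (\<lambda>b. b \<lhd>\<^sub>r g) ` X)"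

definition cycles :: "'a \<Rightarrow> 'b set set set" where
  "cycles g = orbit (rperm g) ` left_orbits"

definition left_free :: bool where
  "left_free \<longleftrightarrow> (\<forall>h\<in>carrier G. \<forall>b\<in>B. h \<rhd> b = b \<longrightarrow> h = \<one>)"

definition right_transitive :: bool where
  "right_transitive \<longleftrightarrow> B \<noteq> {} \<and> (\<forall>b\<in>B. \<forall>b'\<in>B. \<exists>g\<in>carrier G. b' = b \<lhd>\<^sub>r g)"

text \<open>For a cycle \<open>c\<close> of \<open>g\<close> with chosen representative \<open>s\<close>, the conjugacy class of the
  element \<open>h\<close> with \<open>h s = s g\<^sup>d\<close>, where \<open>d\<close> is the length of \<open>c\<close>. When the biset is left-free,
  \<open>h\<close> exists uniquely and its class does not depend on \<open>s\<close>.\<close>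

definition lift_class :: "'a \<Rightarrow> 'b set set \<Rightarrow> 'a set" where
  "lift_class g c =
     (let s = (SOME s. s \<in> \<Union>c)
      in conj_class G (THE h. h \<in> carrier G \<and> h \<rhd> s = s \<lhd>\<^sub>r (g [^] card c)))"

definition lift :: "'a \<Rightarrow> (nat \<times> 'a set) multiset" where
  "lift g = image_mset (\<lambda>c. (card c, lift_class g c)) (mset_set (cycles g))"

definition biset_automorphisms :: "('b \<Rightarrow> 'b) set" where
  "biset_automorphisms =
     {\<beta> \<in> Bij B. \<forall>h\<in>carrier G. \<forall>g\<in>carrier G. \<forall>b\<in>B. \<beta> (h \<rhd> b \<lhd>\<^sub>r g) = h \<rhd> \<beta> b \<lhd>\<^sub>r g}"

end


subsection \<open>Orbisphere bisets\<close>

text \<open>Right actions compose from left to right, so the product of the permutations applies the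
  one of \<open>\<gamma> 1\<close> first. The peripheral classes are counted with their indices: if two generators
  happen to be conjugate, their common class occurs once for each of them.\<close>

locale orbisphere_biset = orbisphere_group G n e \<gamma> + biset G B lact ract
  for G :: "('a, 'c) monoid_scheme" (structure) and n e \<gamma>
    and B :: "'b set" and lact (infixr \<open>\<rhd>\<close> 75) and ract (infixl \<open>\<lhd>\<^sub>r\<close> 76) +
  assumes left_free: "left_free"
    and finite_left_orbits: "finite left_orbits"
    and right_transitive: "right_transitive"
    and trivial_product:
      "\<And>X. X \<in> left_orbits \<Longrightarrow> foldl (\<lambda>Y i. rperm (\<gamma> i) Y) X [1..<Suc n] = X"
    and transitive_group:
      "\<And>X Y. \<lbrakk>X \<in> left_orbits; Y \<in> left_orbits\<rbrakk> \<Longrightarrow>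
         \<exists>\<tau> \<in> generate (BijGroup left_orbits) ((\<lambda>i. rperm (\<gamma> i)) ` {1..n}). \<tau> X = Y"
    and riemann_hurwitz:
      "(\<Sum>i = 1..n. \<Sum>c\<in>cycles (\<gamma> i). int (card c) - 1) = 2 * int (card left_orbits) - 2"
    and peripheral_lifts:
      "\<exists>k. (\<Sum>i = 1..n. image_mset snd (lift (\<gamma> i))) =
         image_mset (\<lambda>i. conj_class G (\<gamma> i)) (mset_set {1..n}) + replicate_mset k {\<one>}"

end

theory Submission
  imports Defs Complex_Main
begin

text \<open>
  An automorphism \<open>\<beta>\<close> of the biset permutes the left orbits and commutes there with the right action
  of \<open>G\<close>. If it fixes an orbit, it acts as a left translation by an element that right transitivity
  forces to be central, so it suffices that the centre of \<open>G\<close> is trivial. For this, \<open>G\<close> is viewed as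
  the even subgroup of the reflection group of an \<open>n\<close>-gon (\<open>\<gamma> i\<close> is the product of the reflections
  in two consecutive sides). Tits' positivity argument for the geometric representation shows that
  the representation is faithful; a central element acts diagonally on the simple roots, and the
  signs of its eigenvalues are controlled by positivity and, for \<open>n = 3\<close>, by the determinant.

  If \<open>\<beta>\<close> moves every orbit, it acts as a deck transformation. The Riemann--Hurwitz equality together
  with Ree's inequality for the quotient shows that at most two cycles of the generators are
  invariant under it. As \<open>\<beta>\<close> preserves lifted classes, some nontrivial class is lifted twice, so two
  generators are conjugate. Abelian quotients of \<open>G\<close> then leave only the orders \<open>(2, 2, odd, ...)\<close>,
  where a parity argument on the length of an invariant cycle gives a contradiction.
\<close>

subsection \<open>Components of relations and cycles of permutations\<close>

text \<open>A presentation yields equalities only; that an element of \<open>G\<close> is nontrivial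
  has to be read off from a concrete action. The geometric representation does this twice: it shows
  that \<open>\<gamma> i\<close> has order exactly \<open>e i\<close>, and that a central element
  with positive eigenvalues is 1. It treats spherical, Euclidean and hyperbolic orders alike. Signs
  alone cannot settle the orders (2, 2, k) with k finite: the half-turn of a dihedral group has
  exactly the signs (-, -, +), and it exists for even k. Odd k needs a separate computation with
  normal forms. In the other half, the Riemann-Hurwitz equality says that the cover has genus 0, and
  Ree's inequality that its quotient has genus at least 0. The bound 2 is the number of fixed points
  of a rotation of the sphere, obtained here by counting cycles. Cycles are counted as components of
  a relation, so that multiplying by a transposition can be compared with adding an edge.\<close>

definition eqcl :: "('a \<times> 'a) set \<Rightarrow> ('a \<times> 'a) set" where
  "eqcl R = (R \<union> R\<inverse>)\<^sup>*"

definition ncomp :: "'a set \<Rightarrow> ('a \<times> 'a) set \<Rightarrow> nat" where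
  "ncomp A R = card ((\<lambda>x. eqcl R `` {x}) ` A)"

definition graph_on :: "'a set \<Rightarrow> ('a \<Rightarrow> 'a) \<Rightarrow> ('a \<times> 'a) set" where
  "graph_on A f = (\<lambda>x. (x, f x)) ` A"

lemma equiv_eqcl: "equiv UNIV (eqcl R)"
  unfolding eqcl_def
  by (intro equivI) (auto simp: refl_on_def sym_Un_converse sym_rtrancl trans_rtrancl)

lemma eqcl_refl: "(x, x) \<in> eqcl R"
  by (simp add: eqcl_def)

lemma eqcl_sym: "(x, y) \<in> eqcl R \<Longrightarrow> (y, x) \<in> eqcl R"
  using equiv_eqcl[of R] by (meson equiv_def symD)

lemma eqcl_trans: "(x, y) \<in> eqcl R \<Longrightarrow> (y, z) \<in> eqcl R \<Longrightarrow> (x, z) \<in> eqcl R"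
  using equiv_eqcl[of R] by (meson equiv_def transD)

lemma eqcl_incl: "R \<subseteq> eqcl R"
  by (auto simp: eqcl_def)

lemma eqcl_least:
  assumes "R \<subseteq> E" "equiv UNIV E"
  shows "eqcl R \<subseteq> E"
proof
  fix z assume "z \<in> eqcl R"
  then obtain x y where z: "z = (x, y)" "(x, y) \<in> (R \<union> R\<inverse>)\<^sup>*"
    unfolding eqcl_def by (cases z) auto
  from z(2) have "(x, y) \<in> E"
  proof induction
    case base
    show ?case using assms(2) by (meson UNIV_I equiv_def refl_onD)
  next
    case (step y w)
    have "(y, w) \<in> E"
      using step(2) assms by (auto simp: equiv_def dest: symD)
    with step(3) show ?case
      using assms(2) by (meson equiv_def transD)
  qed
  with z(1) show "z \<in> E" by simp
qed

lemma eqcl_mono: "R \<subseteq> eqcl S \<Longrightarrow> eqcl R \<subseteq> eqcl S"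
  by (rule eqcl_least[OF _ equiv_eqcl])

lemma eqcl_class_eq_iff: "eqcl R `` {x} = eqcl R `` {y} \<longleftrightarrow> (x, y) \<in> eqcl R"
  using eq_equiv_class_iff[OF equiv_eqcl, of x y R] by simp

lemma ncomp_cong: "eqcl R = eqcl S \<Longrightarrow> ncomp A R = ncomp A S"
  by (simp add: ncomp_def)

lemma ncomp_le_card: "finite A \<Longrightarrow> ncomp A R \<le> card A"
  by (simp add: ncomp_def card_image_le)

lemma eqcl_insert_connected:
  assumes "(a, b) \<in> eqcl R"
  shows "eqcl (insert (a, b) R) = eqcl R"
  using assms by (intro equalityI eqcl_mono) (use eqcl_incl in blast)+

lemma eqcl_insert_disconnected:
  fixes a b R
  defines "M \<equiv> eqcl R `` {a} \<union> eqcl R `` {b}"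
  shows "eqcl (insert (a, b) R) = eqcl R \<union> M \<times> M"
proof
  have "equiv UNIV (eqcl R \<union> M \<times> M)"
  proof (intro equivI)
    show "sym (eqcl R \<union> M \<times> M)"
      by (auto simp: sym_def intro: eqcl_sym)
    have "y \<in> M" if "x \<in> M" "(x, y) \<in> eqcl R" for x y
      using that by (auto simp: M_def intro: eqcl_trans)
    then show "trans (eqcl R \<union> M \<times> M)"
      unfolding trans_def by (blast intro: eqcl_trans eqcl_sym)
  qed (auto simp: refl_on_def eqcl_refl)
  moreover have "insert (a, b) R \<subseteq> eqcl R \<union> M \<times> M"
    using eqcl_incl[of R] by (auto simp: M_def eqcl_refl)
  ultimately show "eqcl (insert (a, b) R) \<subseteq> eqcl R \<union> M \<times> M"
    by (rule eqcl_least[rotated])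
  have R: "eqcl R \<subseteq> eqcl (insert (a, b) R)"
    using eqcl_incl[of "insert (a, b) R"] by (intro eqcl_mono) auto
  have ab: "(a, b) \<in> eqcl (insert (a, b) R)"
    using eqcl_incl[of "insert (a, b) R"] by auto
  have "(a, x) \<in> eqcl (insert (a, b) R)" if "x \<in> M" for x
    using that R ab by (auto simp: M_def intro: eqcl_trans)
  then have "M \<times> M \<subseteq> eqcl (insert (a, b) R)"
    by (auto intro: eqcl_trans eqcl_sym)
  with R show "eqcl R \<union> M \<times> M \<subseteq> eqcl (insert (a, b) R)" by blast
qed

lemma ncomp_insert_disconnected:
  assumes "finite A" "a \<in> A" "b \<in> A" "(a, b) \<notin> eqcl R"
  shows "Suc (ncomp A (insert (a, b) R)) = ncomp A R"
proof -
  define cl where "cl = (\<lambda>x. eqcl R `` {x})"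
  define M where "M = cl a \<union> cl b"
  have E: "eqcl (insert (a, b) R) = eqcl R \<union> M \<times> M"
    unfolding M_def cl_def by (rule eqcl_insert_disconnected)
  have new: "eqcl (insert (a, b) R) `` {x} = (if x \<in> M then M else cl x)" for x
  proof (cases "x \<in> M")
    case True
    then have "cl x = cl a \<or> cl x = cl b"
      unfolding M_def cl_def by (auto simp: eqcl_class_eq_iff intro: eqcl_sym)
    then have "cl x \<subseteq> M" by (auto simp: M_def)
    with True show ?thesis by (auto simp: E cl_def)
  qed (auto simp: E cl_def)
  have inM: "x \<in> M \<longleftrightarrow> cl x = cl a \<or> cl x = cl b" for x
    unfolding M_def cl_def by (auto simp: eqcl_class_eq_iff intro: eqcl_sym)
  have "(\<lambda>x. eqcl (insert (a, b) R) `` {x}) ` A = insert M (cl ` A - {cl a, cl b})"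
    unfolding new using assms(2) inM by (auto simp: image_iff)
  moreover have "M \<notin> cl ` A - {cl a, cl b}"
  proof
    assume "M \<in> cl ` A - {cl a, cl b}"
    then obtain x where x: "M = cl x" "cl x \<noteq> cl a" "cl x \<noteq> cl b" by auto
    have "x \<in> cl x" by (simp add: cl_def eqcl_refl)
    with x inM show False by auto
  qed
  moreover have "cl a \<noteq> cl b"
    using assms(4) by (simp add: cl_def eqcl_class_eq_iff)
  ultimately show ?thesis
    using assms(1-3) card_Diff_subset[of "{cl a, cl b}" "cl ` A"] card_mono[of "cl ` A" "{cl a, cl b}"]
    by (auto simp: ncomp_def cl_def)
qed

lemma ncomp_insert_ge: "finite A \<Longrightarrow> a \<in> A \<Longrightarrow> b \<in> A \<Longrightarrow> ncomp A R \<le> Suc (ncomp A (insert (a, b) R))"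
  using ncomp_insert_disconnected[of A a b R] eqcl_insert_connected[of a b R]
  by (cases "(a, b) \<in> eqcl R") (auto simp: ncomp_def)

lemma ncomp_insert_le: "finite A \<Longrightarrow> a \<in> A \<Longrightarrow> b \<in> A \<Longrightarrow> ncomp A (insert (a, b) R) \<le> ncomp A R"
  using ncomp_insert_disconnected[of A a b R] eqcl_insert_connected[of a b R]
  by (cases "(a, b) \<in> eqcl R") (auto simp: ncomp_def)

text \<open>The transposition only redirects arrows between \<open>a\<close> and \<open>b\<close>,
  and the extra edge absorbs this. Hence both cycle counts can be compared with one common coarser
  relation.\<close>

lemma eqcl_insert_transpose:
  "eqcl (insert (a, b) (graph_on A (transpose a b \<circ> f))) = eqcl (insert (a, b) (graph_on A f))"
proof -
  have 1: "(x, transpose a b x) \<in> eqcl (insert (a, b) R)" for x R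
    using eqcl_incl[of "insert (a, b) R"] eqcl_sym[of a b "insert (a, b) R"]
    by (auto simp: transpose_def eqcl_refl)
  show ?thesis
  proof (intro equalityI eqcl_mono)
    show "insert (a, b) (graph_on A (transpose a b \<circ> f)) \<subseteq> eqcl (insert (a, b) (graph_on A f))"
      using eqcl_incl[of "insert (a, b) (graph_on A f)"]
      by (auto simp: graph_on_def intro: eqcl_trans[OF _ 1])
    show "insert (a, b) (graph_on A f) \<subseteq> eqcl (insert (a, b) (graph_on A (transpose a b \<circ> f)))"
    proof -
      have "(x, f x) \<in> eqcl (insert (a, b) (graph_on A (transpose a b \<circ> f)))" if "x \<in> A" for x
      proof -
        have "(x, transpose a b (f x)) \<in> eqcl (insert (a, b) (graph_on A (transpose a b \<circ> f)))"
          using that eqcl_incl[of "insert (a, b) (graph_on A (transpose a b \<circ> f))"]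
          by (auto simp: graph_on_def)
        from eqcl_trans[OF this 1] show ?thesis by simp
      qed
      then show ?thesis
        using eqcl_incl[of "insert (a, b) (graph_on A (transpose a b \<circ> f))"]
        by (auto simp: graph_on_def)
    qed
  qed
qed

section \<open>Multiplying a permutation by a transposition\<close>

lemma funpow_eqcl:
  assumes "f permutes A" "x \<in> A"
  shows "(x, (f ^^ k) x) \<in> eqcl (graph_on A f)"
proof (induction k)
  case (Suc k)
  have "(f ^^ k) x \<in> A"
    using assms by (metis permutes_in_funpow_image)
  then have "((f ^^ k) x, (f ^^ Suc k) x) \<in> eqcl (graph_on A f)"
    using eqcl_incl[of "graph_on A f"] by (auto simp: graph_on_def)
  with Suc show ?case by (rule eqcl_trans)
qed (simp add: eqcl_refl)

text \<open>The new orbit of \<open>a\<close> follows the old one, which never meets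
  \<open>b\<close>, until the old one would first return to \<open>a\<close>; at that moment the
  transposition sends it to \<open>b\<close>.\<close>

lemma transpose_connects:
  assumes "finite A" "f permutes A" "a \<in> A" "b \<in> A" "(a, b) \<notin> eqcl (graph_on A f)"
  shows "(a, b) \<in> eqcl (graph_on A (transpose a b \<circ> f))"
proof -
  let ?g = "transpose a b \<circ> f"
  have g: "?g permutes A"
    using assms by (intro permutes_compose permutes_swap_id) auto
  have "permutation f" using assms(1,2) by (auto simp: permutation_permutes)
  then have "\<exists>k>0. (f ^^ k) a = a" using permutation_self by metis
  define k where "k = (LEAST k. k > 0 \<and> (f ^^ k) a = a)"
  have k: "k > 0" "(f ^^ k) a = a"
    using LeastI_ex[OF \<open>\<exists>k>0. (f ^^ k) a = a\<close>] unfolding k_def by blast+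
  have least: "(f ^^ i) a \<noteq> a" if "0 < i" "i < k" for i
    using that not_less_Least unfolding k_def by blast
  have nb: "(f ^^ i) a \<noteq> b" for i
    using funpow_eqcl[OF assms(2,3), of i] assms(5) by auto
  have eq: "(?g ^^ i) a = (f ^^ i) a" if "i < k" for i
    using that
  proof (induction i)
    case (Suc i)
    then show ?case using least[of "Suc i"] nb[of "Suc i"] by (simp add: transpose_def)
  qed simp
  obtain i where i: "k = Suc i" using k(1) by (cases k) auto
  have "(?g ^^ k) a = b"
    using eq[of i] k(2) i by simp
  with funpow_eqcl[OF g assms(3), of k] show ?thesis by simp
qed

text \<open>Two cycles merge: the edge between \<open>a\<close> and \<open>b\<close> joins two
  components of the old graph but is redundant in the new one.\<close>

lemma ncomp_transpose_disconnected:
  assumes "finite A" "f permutes A" "a \<in> A" "b \<in> A" "(a, b) \<notin> eqcl (graph_on A f)"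
  shows "Suc (ncomp A (graph_on A (transpose a b \<circ> f))) = ncomp A (graph_on A f)"
  using ncomp_insert_disconnected[OF assms(1,3,4,5)]
    eqcl_insert_connected[OF transpose_connects[OF assms]] eqcl_insert_transpose[of a b A f]
  by (simp add: ncomp_def)

text \<open>With the edge added the two graphs have equally many components, and one edge lowers a
  component count by at most one.\<close>

lemma ncomp_transpose_le:
  assumes "finite A" "a \<in> A" "b \<in> A"
  shows "ncomp A (graph_on A (transpose a b \<circ> f)) \<le> Suc (ncomp A (graph_on A f))"
  using ncomp_insert_ge[OF assms, of "graph_on A (transpose a b \<circ> f)"]
    ncomp_insert_le[OF assms, of "graph_on A f"] eqcl_insert_transpose[of a b A f]
  by (simp add: ncomp_def)

lemma ncomp_id: "finite A \<Longrightarrow> ncomp A (graph_on A id) = card A"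
proof -
  have "eqcl (graph_on A id) = Id"
    using eqcl_least[of "graph_on A id" Id] eqcl_refl[of _ "graph_on A id"]
    by (auto simp: graph_on_def equiv_def refl_on_def sym_def trans_def)
  moreover have "inj_on (\<lambda>x. {x}) A" by auto
  ultimately show ?thesis by (simp add: ncomp_def card_image)
qed

text \<open>\<open>R\<close> records the transpositions used as edges of a graph, which keeps the
  connectivity that the product itself forgets; \<open>k\<close> is the number of factors.\<close>

inductive transp_prod :: "'a set \<Rightarrow> ('a \<Rightarrow> 'a) \<Rightarrow> ('a \<times> 'a) set \<Rightarrow> nat \<Rightarrow> bool" for A where
  id: "transp_prod A id {} 0"
| step: "transp_prod A f R k \<Longrightarrow> a \<in> A \<Longrightarrow> b \<in> A \<Longrightarrow> a \<noteq> b \<Longrightarrow>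
     transp_prod A (transpose a b \<circ> f) (insert (a, b) R) (Suc k)"

text \<open>Multiplying by a transposition that joins two components of \<open>R\<close> merges two cycles; otherwise
  it changes the number of cycles by at most one.\<close>

lemma transp_prod_bound:
  assumes "transp_prod A f R k" "finite A"
  shows "f permutes A \<and> graph_on A f \<subseteq> eqcl R \<and>
    card A + ncomp A (graph_on A f) \<le> k + 2 * ncomp A R"
  using assms(1)
proof induction
  case id
  have "ncomp A (graph_on A id) = ncomp A {}"
  proof -
    have "eqcl (graph_on A id) = eqcl {}"
      by (intro equalityI eqcl_mono) (auto simp: graph_on_def eqcl_refl)
    then show ?thesis by (simp add: ncomp_def)
  qed
  moreover have "graph_on A id \<subseteq> eqcl {}"
    by (auto simp: graph_on_def eqcl_refl)
  ultimately show ?case using ncomp_id[OF assms(2)] permutes_id[of A] unfolding id_def by simp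
next
  case (step f R k a b)
  let ?g = "transpose a b \<circ> f"
  have g: "?g permutes A"
    using step by (intro permutes_compose permutes_swap_id) auto
  have R: "eqcl R \<subseteq> eqcl (insert (a, b) R)"
    using eqcl_incl[of "insert (a, b) R"] by (intro eqcl_mono) auto
  have "graph_on A f \<subseteq> eqcl R" using step by blast
  then have "insert (a, b) (graph_on A f) \<subseteq> eqcl (insert (a, b) R)"
    using R eqcl_incl[of "insert (a, b) R"] by auto
  then have "eqcl (insert (a, b) (graph_on A f)) \<subseteq> eqcl (insert (a, b) R)"
    by (rule eqcl_mono)
  moreover have "graph_on A ?g \<subseteq> eqcl (insert (a, b) (graph_on A f))"
    using eqcl_incl[of "insert (a, b) (graph_on A ?g)"] eqcl_insert_transpose[of a b A f] by blast
  ultimately have gr: "graph_on A ?g \<subseteq> eqcl (insert (a, b) R)" by blast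
  show ?case
  proof (cases "(a, b) \<in> eqcl R")
    case True
    then have "ncomp A (insert (a, b) R) = ncomp A R"
      by (intro ncomp_cong eqcl_insert_connected)
    with ncomp_transpose_le[OF assms(2) step(2,3), of f] step g gr show ?thesis by (auto simp: comp_def)
  next
    \<comment> \<open>Cycles of \<open>f\<close> lie inside components of \<open>R\<close>, so
      \<open>a\<close> and \<open>b\<close> also lie in different cycles. Both counts drop by one:
      the left side falls by one, and the right side changes by 1 - 2.\<close>
    case False
    moreover have "eqcl (graph_on A f) \<subseteq> eqcl R"
      by (intro eqcl_mono) (use step in blast)
    ultimately have "(a, b) \<notin> eqcl (graph_on A f)" by blast
    with ncomp_transpose_disconnected[OF assms(2) _ step(2,3), of f]
      ncomp_insert_disconnected[OF assms(2) step(2,3) False] step g gr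
    show ?thesis by (auto simp: comp_def)
  qed
qed

text \<open>A permutation is a product of as many transpositions as the set size exceeds its number
  of cycles. Splitting off the transposition of \<open>a\<close> and \<open>g a\<close> leaves a
  factor fixing \<open>a\<close>, whence the induction on the number of moved points.\<close>

lemma transp_prod_compose:
  assumes "finite A" "g permutes A" "transp_prod A f R k"
  shows "\<exists>R'. transp_prod A (g \<circ> f) R' (k + (card A - ncomp A (graph_on A g))) \<and>
     R \<subseteq> R' \<and> graph_on A g \<subseteq> eqcl R'"
  using assms(2)
proof (induction "card {x \<in> A. g x \<noteq> x}" arbitrary: g rule: less_induct)
  case less
  show ?case
  proof (cases "g = id")
    case True
    moreover have "graph_on A id \<subseteq> eqcl R"
      by (auto simp: graph_on_def eqcl_refl)
    ultimately show ?thesis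
      using assms by (intro exI[of _ R]) (simp add: ncomp_id)
  next
    case False
    then obtain a where a: "g a \<noteq> a" by fastforce
    define b where "b = g a"
    have aA: "a \<in> A" using a less.prems by (meson permutes_not_in)
    have bA: "b \<in> A" using aA less.prems by (simp add: b_def permutes_in_image)
    have ab: "a \<noteq> b" using a by (simp add: b_def)
    define h where "h = transpose a b \<circ> g"
    have h: "h permutes A"
      unfolding h_def using less.prems aA bA by (intro permutes_compose permutes_swap_id) auto
    have g: "g = transpose a b \<circ> h" by (simp add: h_def fun_eq_iff)
    have ha: "h a = a" by (simp add: h_def b_def)
    have gb: "g b \<noteq> b"
      using ab less.prems unfolding b_def by (metis permutes_inj injD)
    have "{x \<in> A. h x \<noteq> x} \<subseteq> {x \<in> A. g x \<noteq> x}"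
    proof safe
      fix x assume "x \<in> A" "h x \<noteq> x" "g x = x"
      moreover have "x \<noteq> b" using \<open>g x = x\<close> gb by auto
      ultimately show False using a by (auto simp: h_def transpose_def split: if_splits)
    qed
    with aA a ha have "{x \<in> A. h x \<noteq> x} \<subset> {x \<in> A. g x \<noteq> x}" by blast
    then have "card {x \<in> A. h x \<noteq> x} < card {x \<in> A. g x \<noteq> x}"
      using assms(1) by (intro psubset_card_mono) auto
    from less.hyps[OF this h] obtain R' where
      R': "transp_prod A (h \<circ> f) R' (k + (card A - ncomp A (graph_on A h)))" "R \<subseteq> R'"
         "graph_on A h \<subseteq> eqcl R'" by blast
    \<comment> \<open>Since \<open>h\<close> fixes \<open>a\<close>, the point \<open>a\<close> is a
      component by itself; the split-off factor therefore changes the cycle count by exactly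
      one.\<close>
    have "(a, b) \<notin> eqcl (graph_on A h)"
    proof -
      have "equiv UNIV ({(a, a)} \<union> (- {a}) \<times> (- {a}))"
        by (auto simp: equiv_def refl_on_def sym_def trans_def)
      moreover have "graph_on A h \<subseteq> {(a, a)} \<union> (- {a}) \<times> (- {a})"
        using ha h by (auto simp: graph_on_def) (metis permutes_inj injD)
      ultimately have "eqcl (graph_on A h) \<subseteq> {(a, a)} \<union> (- {a}) \<times> (- {a})"
        by (rule eqcl_least[rotated])
      with ab show ?thesis by auto
    qed
    from ncomp_transpose_disconnected[OF assms(1) h aA bA this]
    have n: "Suc (ncomp A (graph_on A g)) = ncomp A (graph_on A h)" by (simp add: g)
    moreover have "ncomp A (graph_on A h) \<le> card A" by (rule ncomp_le_card[OF assms(1)])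
    ultimately have k: "k + (card A - ncomp A (graph_on A g)) =
        Suc (k + (card A - ncomp A (graph_on A h)))" by linarith
    have "transp_prod A (g \<circ> f) (insert (a, b) R') (k + (card A - ncomp A (graph_on A g)))"
      using transp_prod.step[OF R'(1) aA bA ab] unfolding k by (simp add: g comp_assoc)
    moreover have "graph_on A g \<subseteq> eqcl (insert (a, b) R')"
    proof -
      have R: "eqcl R' \<subseteq> eqcl (insert (a, b) R')"
        using eqcl_incl[of "insert (a, b) R'"] by (intro eqcl_mono) auto
      have "insert (a, b) (graph_on A h) \<subseteq> eqcl (insert (a, b) R')"
        using R R'(3) eqcl_incl[of "insert (a, b) R'"] by auto
      then have "eqcl (insert (a, b) (graph_on A h)) \<subseteq> eqcl (insert (a, b) R')"
        by (rule eqcl_mono)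
      moreover have "graph_on A g \<subseteq> eqcl (insert (a, b) (graph_on A h))"
        using eqcl_incl[of "insert (a, b) (graph_on A g)"] eqcl_insert_transpose[of a b A h] g
        by auto
      ultimately show ?thesis by blast
    qed
    ultimately show ?thesis using R'(2) by blast
  qed
qed

lemma transp_prod_fold:
  assumes "finite A" "\<And>i. i \<in> set is \<Longrightarrow> f i permutes A"
  shows "\<exists>R. transp_prod A (fold (\<lambda>i g. f i \<circ> g) is id) R
       (\<Sum>i\<leftarrow>is. card A - ncomp A (graph_on A (f i))) \<and>
     (\<forall>i\<in>set is. graph_on A (f i) \<subseteq> eqcl R)"
  using assms(2)
proof (induction "is" rule: rev_induct)
  case Nil
  show ?case using transp_prod.id[of A] unfolding id_def by (intro exI[of _ "{}"]) simp
next
  case (snoc i js)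
  obtain R where R: "transp_prod A (fold (\<lambda>i g. f i \<circ> g) js id) R
       (\<Sum>i\<leftarrow>js. card A - ncomp A (graph_on A (f i)))"
     "\<forall>i\<in>set js. graph_on A (f i) \<subseteq> eqcl R"
    using snoc.IH snoc.prems by (auto simp: comp_def id_def)
  obtain R' where R': "transp_prod A (f i \<circ> fold (\<lambda>i g. f i \<circ> g) js id) R'
       ((\<Sum>i\<leftarrow>js. card A - ncomp A (graph_on A (f i))) + (card A - ncomp A (graph_on A (f i))))"
     "R \<subseteq> R'" "graph_on A (f i) \<subseteq> eqcl R'"
    using transp_prod_compose[OF assms(1) _ R(1), of "f i"] snoc.prems by auto
  have "eqcl R \<subseteq> eqcl R'" using R'(2) eqcl_incl[of R'] by (intro eqcl_mono) auto
  with R(2) R'(3) have "\<forall>j\<in>set (js @ [i]). graph_on A (f j) \<subseteq> eqcl R'" by auto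
  with R'(1) show ?case by (intro exI[of _ R']) (simp add: comp_def id_def)
qed

text \<open>Factoring every \<open>f i\<close> into transpositions writes the identity, which has
  \<open>card A\<close> cycles, as a product whose edge graph is connected by transitivity. The
  transposition bound with one component is the claim.\<close>

theorem ree_inequality:
  assumes "finite A" "A \<noteq> {}" "\<And>i. i \<in> set is \<Longrightarrow> f i permutes A"
    and id: "fold (\<lambda>i g. f i \<circ> g) is id = id"
    and trans: "A \<times> A \<subseteq> eqcl (\<Union>i\<in>set is. graph_on A (f i))"
  shows "2 * card A \<le> (\<Sum>i\<leftarrow>is. card A - ncomp A (graph_on A (f i))) + 2"
proof -
  obtain R where R: "transp_prod A id R (\<Sum>i\<leftarrow>is. card A - ncomp A (graph_on A (f i)))"
     "\<forall>i\<in>set is. graph_on A (f i) \<subseteq> eqcl R"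
    using transp_prod_fold[of A "is" f] assms by auto
  have "eqcl (\<Union>i\<in>set is. graph_on A (f i)) \<subseteq> eqcl R"
    using R(2) by (intro eqcl_mono) auto
  with trans have AA: "A \<times> A \<subseteq> eqcl R" by blast
  obtain x where x: "x \<in> A" using assms(2) by auto
  have "(\<lambda>x. eqcl R `` {x}) ` A \<subseteq> {eqcl R `` {x}}"
    using AA x by (auto simp: eqcl_class_eq_iff intro: eqcl_trans)
  then have "ncomp A R \<le> 1"
    unfolding ncomp_def using card_mono[of "{eqcl R `` {x}}"] by fastforce
  with transp_prod_bound[OF R(1) assms(1)] ncomp_id[OF assms(1)] show ?thesis by auto
qed


section \<open>Quotient of a transitive system of permutations by a commuting permutation\<close>

lemma eqcl_graph_on_eq_orbit:
  assumes "finite A" "f permutes A" "x \<in> A"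
  shows "eqcl (graph_on A f) `` {x} = orbit f x"
proof
  have p: "permutation f" using assms by (auto simp: permutation_permutes)
  have "equiv UNIV {(x, y). orbit f x = orbit f y}"
    by (auto simp: equiv_def refl_on_def sym_def trans_def)
  moreover have "graph_on A f \<subseteq> {(x, y). orbit f x = orbit f y}"
    by (auto simp: graph_on_def permutation_orbit_step[OF p])
  ultimately have "eqcl (graph_on A f) \<subseteq> {(x, y). orbit f x = orbit f y}"
    by (rule eqcl_least[rotated])
  then show "eqcl (graph_on A f) `` {x} \<subseteq> orbit f x"
    using permutation_self_in_orbit[OF p] by auto
  show "orbit f x \<subseteq> eqcl (graph_on A f) `` {x}"
    using funpow_eqcl[OF assms(2,3)] by (auto simp: orbit_altdef)
qed

lemma ncomp_graph_on:
  assumes "finite A" "f permutes A"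
  shows "ncomp A (graph_on A f) = card (orbit f ` A)"
  unfolding ncomp_def using eqcl_graph_on_eq_orbit[OF assms] by (metis (no_types, lifting) image_cong)

lemma card_eq_mult_card_image:
  assumes "finite c" "\<And>x. x \<in> c \<Longrightarrow> x \<in> q x" "\<And>x. x \<in> c \<Longrightarrow> q x \<subseteq> c"
    and "\<And>x. x \<in> c \<Longrightarrow> card (q x) = p"
    and "\<And>x y. x \<in> c \<Longrightarrow> y \<in> q x \<Longrightarrow> q y = q x"
  shows "card c = p * card (q ` c)"
proof -
  have "p * card (q ` c) = card (\<Union> (q ` c))"
  proof (rule card_partition)
    show "finite (\<Union> (q ` c))" by (rule finite_subset[OF UN_least[OF assms(3)] assms(1)])
    show "a \<inter> b = {}" if "a \<in> q ` c" "b \<in> q ` c" "a \<noteq> b" for a b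
    proof (rule ccontr)
      assume "a \<inter> b \<noteq> {}"
      then obtain z x y where "x \<in> c" "y \<in> c" "a = q x" "b = q y" "z \<in> q x" "z \<in> q y"
        using \<open>a \<in> q ` c\<close> \<open>b \<in> q ` c\<close> by auto
      with assms(5)[of x z] assms(5)[of y z] \<open>a \<noteq> b\<close> show False by simp
    qed
  qed (use assms(1,4) in auto)
  moreover have "\<Union> (q ` c) = c"
    by (intro equalityI UN_least assms(3)) (use assms(2) in auto)
  ultimately show ?thesis by simp
qed

text \<open>Combinatorial form of a branched cover of the sphere: \<open>\<sigma> i\<close> is the
  monodromy around the i-th branch point, \<open>\<tau>\<close> a deck transformation, and the
  orbits \<open>q x\<close> are the points of the quotient fibre.\<close>

locale deck_permutation =
  fixes X :: "'a set" and n :: nat and \<sigma> :: "nat \<Rightarrow> 'a \<Rightarrow> 'a" and \<tau> :: "'a \<Rightarrow> 'a"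
  assumes finite_X: "finite X" and X_nonempty: "X \<noteq> {}"
    and \<sigma>_permutes: "\<And>i. i \<in> {1..n} \<Longrightarrow> \<sigma> i permutes X"
    and \<tau>_permutes: "\<tau> permutes X"
    and commute: "\<And>i x. i \<in> {1..n} \<Longrightarrow> x \<in> X \<Longrightarrow> \<tau> (\<sigma> i x) = \<sigma> i (\<tau> x)"
    and \<sigma>_product: "\<And>x. x \<in> X \<Longrightarrow> fold \<sigma> [1..<Suc n] x = x"
    and \<sigma>_transitive: "X \<times> X \<subseteq> eqcl (\<Union>i\<in>{1..n}. graph_on X (\<sigma> i))"
begin

abbreviation q :: "'a \<Rightarrow> 'a set" where "q \<equiv> orbit \<tau>"

lemma \<tau>_permutation: "permutation \<tau>"
  using \<tau>_permutes finite_X by (auto simp: permutation_permutes)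

lemma \<sigma>_permutation: "i \<in> {1..n} \<Longrightarrow> permutation (\<sigma> i)"
  using \<sigma>_permutes finite_X by (auto simp: permutation_permutes)

lemma self_in_q: "x \<in> q x"
  by (rule permutation_self_in_orbit[OF \<tau>_permutation])

lemma q_subset: "x \<in> X \<Longrightarrow> q x \<subseteq> X"
  by (rule permutes_orbit_subset[OF \<tau>_permutes])

lemma q_eq: "y \<in> q x \<Longrightarrow> q y = q x"
  using cyclic_on_orbit'[OF \<tau>_permutation] by (rule orbit_cyclic_eq3)

lemma \<sigma>_orbit_eq: "i \<in> {1..n} \<Longrightarrow> y \<in> orbit (\<sigma> i) x \<Longrightarrow> orbit (\<sigma> i) y = orbit (\<sigma> i) x"
  using cyclic_on_orbit'[OF \<sigma>_permutation] by (rule orbit_cyclic_eq3)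

lemma self_in_\<sigma>_orbit: "i \<in> {1..n} \<Longrightarrow> x \<in> orbit (\<sigma> i) x"
  by (rule permutation_self_in_orbit[OF \<sigma>_permutation])

lemma \<sigma>_orbit_subset: "i \<in> {1..n} \<Longrightarrow> x \<in> X \<Longrightarrow> orbit (\<sigma> i) x \<subseteq> X"
  by (rule permutes_orbit_subset[OF \<sigma>_permutes])

lemma \<sigma>_in_X: "i \<in> {1..n} \<Longrightarrow> x \<in> X \<Longrightarrow> \<sigma> i x \<in> X"
  using \<sigma>_permutes permutes_in_image by metis

lemma image_\<sigma>_q: "i \<in> {1..n} \<Longrightarrow> x \<in> X \<Longrightarrow> \<sigma> i ` q x = q (\<sigma> i x)"
  using q_subset[of x] by (intro orbit_inverse self_in_q) (metis commute subsetD)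

lemma image_\<tau>_\<sigma>_orbit: "i \<in> {1..n} \<Longrightarrow> x \<in> X \<Longrightarrow> \<tau> ` orbit (\<sigma> i) x = orbit (\<sigma> i) (\<tau> x)"
  using \<sigma>_orbit_subset[of i x] by (intro orbit_inverse self_in_\<sigma>_orbit) (metis commute subsetD)+

text \<open>By commutation each \<open>\<sigma> i\<close> carries \<tau>-orbits bijectively to
  \<tau>-orbits, and the \<sigma> i act transitively. In particular, a deck permutation that moves
  one point moves all of them.\<close>

lemma card_q_eq:
  assumes "x \<in> X" "y \<in> X"
  shows "card (q x) = card (q y)"
proof -
  have "equiv UNIV {(x, y). card (q x) = card (q y)}"
    by (auto simp: equiv_def refl_on_def sym_def trans_def)
  moreover have "(\<Union>i\<in>{1..n}. graph_on X (\<sigma> i)) \<subseteq> {(x, y). card (q x) = card (q y)}"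
  proof -
    have "card (q (\<sigma> i x)) = card (q x)" if "i \<in> {1..n}" "x \<in> X" for i x
      unfolding image_\<sigma>_q[OF that, symmetric]
      using permutes_inj[OF \<sigma>_permutes[OF that(1)]] by (intro card_image) (auto intro: inj_on_subset)
    then show ?thesis by (auto simp: graph_on_def)
  qed
  ultimately have "eqcl (\<Union>i\<in>{1..n}. graph_on X (\<sigma> i)) \<subseteq> {(x, y). card (q x) = card (q y)}"
    by (rule eqcl_least[rotated])
  with \<sigma>_transitive assms show ?thesis by blast
qed

text \<open>Extended by the identity so that it is a permutation in the sense of
  \<open>permutes\<close>.\<close>

definition \<sigma>_quot :: "nat \<Rightarrow> 'a set \<Rightarrow> 'a set" where
  "\<sigma>_quot i M = (if M \<in> q ` X then \<sigma> i ` M else M)"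

lemma \<sigma>_quot_q: "i \<in> {1..n} \<Longrightarrow> x \<in> X \<Longrightarrow> \<sigma>_quot i (q x) = q (\<sigma> i x)"
  by (simp add: \<sigma>_quot_def image_\<sigma>_q)

lemma \<sigma>_quot_permutes:
  assumes "i \<in> {1..n}"
  shows "\<sigma>_quot i permutes q ` X"
proof (rule bij_imp_permutes)
  have "inj_on (\<sigma>_quot i) (q ` X)"
    unfolding \<sigma>_quot_def using permutes_inj[OF \<sigma>_permutes[OF assms]]
    by (auto simp: inj_on_def inj_image_eq_iff)
  moreover have "\<sigma>_quot i ` q ` X \<subseteq> q ` X"
    using \<sigma>_quot_q[OF assms] \<sigma>_in_X[OF assms] by auto
  ultimately show "bij_betw (\<sigma>_quot i) (q ` X) (q ` X)"
    using finite_X by (simp add: bij_betw_def endo_inj_surj)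
qed (simp add: \<sigma>_quot_def)

lemma \<sigma>_quot_product: "fold (\<lambda>i g. \<sigma>_quot i \<circ> g) [1..<Suc n] id = id"
proof
  fix M
  show "fold (\<lambda>i g. \<sigma>_quot i \<circ> g) [1..<Suc n] id M = id M"
  proof (cases "M \<in> q ` X")
    case True
    then obtain x where x: "x \<in> X" "M = q x" by auto
    have "set js \<subseteq> {1..n} \<Longrightarrow> fold (\<lambda>i g. \<sigma>_quot i \<circ> g) js id (q x) = q (fold \<sigma> js x) \<and>
       fold \<sigma> js x \<in> X" for js
      by (induction js rule: rev_induct) (use x \<sigma>_quot_q \<sigma>_in_X in auto)
    from this[of "[1..<Suc n]"] show ?thesis
      using x(2) \<sigma>_product[OF x(1)]
      by (simp only: set_upt atLeastLessThanSuc_atLeastAtMost order_refl id_apply simp_thms)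
  next
    case False
    have "fold (\<lambda>i g. \<sigma>_quot i \<circ> g) js id M = M" for js
      by (induction js rule: rev_induct) (use False in \<open>auto simp: \<sigma>_quot_def\<close>)
    then show ?thesis by simp
  qed
qed

lemma \<sigma>_quot_transitive:
  "q ` X \<times> q ` X \<subseteq> eqcl (\<Union>i\<in>{1..n}. graph_on (q ` X) (\<sigma>_quot i))" (is "_ \<subseteq> eqcl ?R")
proof -
  have "equiv UNIV {(x, y). (q x, q y) \<in> eqcl ?R}"
    using eqcl_refl eqcl_sym eqcl_trans unfolding equiv_def refl_on_def sym_def trans_def by fast
  moreover have "(\<Union>i\<in>{1..n}. graph_on X (\<sigma> i)) \<subseteq> {(x, y). (q x, q y) \<in> eqcl ?R}"
  proof -
    have "(q x, q (\<sigma> i x)) \<in> ?R" if "i \<in> {1..n}" "x \<in> X" for i x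
      using that \<sigma>_quot_q[OF that] by (auto simp: graph_on_def intro!: bexI[of _ i] image_eqI)
    then show ?thesis using eqcl_incl[of ?R] by (auto simp: graph_on_def)
  qed
  ultimately have "eqcl (\<Union>i\<in>{1..n}. graph_on X (\<sigma> i)) \<subseteq> {(x, y). (q x, q y) \<in> eqcl ?R}"
    by (rule eqcl_least[rotated])
  with \<sigma>_transitive show ?thesis by blast
qed

lemma image_q_\<sigma>_orbit:
  assumes "i \<in> {1..n}" "x \<in> X"
  shows "q ` orbit (\<sigma> i) x = orbit (\<sigma>_quot i) (q x)"
  using assms \<sigma>_orbit_subset[OF assms] by (intro orbit_inverse self_in_\<sigma>_orbit) (auto simp: \<sigma>_quot_q)

definition fixed_cycles :: "nat \<Rightarrow> 'a set set" where
  "fixed_cycles i = {c \<in> orbit (\<sigma> i) ` X. \<tau> ` c = c}"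

lemma fixed_cycle_q_subset:
  assumes "\<tau> ` c = c" "x \<in> c"
  shows "q x \<subseteq> c"
proof
  fix y assume "y \<in> q x"
  then show "y \<in> c" by induction (use assms in auto)
qed

text \<open>A cycle with the same image as \<open>c\<close> in the quotient must meet the
  \<tau>-orbit of any chosen point of \<open>c\<close>; this bounds the number of such cycles by the
  size of that orbit.\<close>

lemma cycle_fibre:
  assumes "i \<in> {1..n}" "c \<in> orbit (\<sigma> i) ` X" "x \<in> c"
  shows "{c' \<in> orbit (\<sigma> i) ` X. q ` c' = q ` c} \<subseteq> orbit (\<sigma> i) ` q x"
proof safe
  fix y assume y: "y \<in> X" "q ` orbit (\<sigma> i) y = q ` c"
  have "q x \<in> q ` orbit (\<sigma> i) y" using assms(3) y(2) by auto
  then obtain z where z: "z \<in> orbit (\<sigma> i) y" "q x = q z" by auto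
  with self_in_q[of z] \<sigma>_orbit_eq[OF assms(1) z(1)] show "orbit (\<sigma> i) y \<in> orbit (\<sigma> i) ` q x" by auto
qed

text \<open>At most \<open>p\<close> cycles lie over a cycle of the quotient, and only one if some
  cycle above is \<tau>-invariant, for it then contains the full \<tau>-orbits of its points. With
  \<open>F\<close> invariant cycles and \<open>K\<close> quotient cycles the total is at most F + (K
  - F) p.\<close>

lemma card_cycles_le:
  assumes i: "i \<in> {1..n}" and p: "\<And>x. x \<in> X \<Longrightarrow> card (q x) = p" "p \<ge> 1"
  shows "card (orbit (\<sigma> i) ` X) + (p - 1) * card (fixed_cycles i)
     \<le> p * card (orbit (\<sigma>_quot i) ` q ` X)"
proof -
  define C where "C = orbit (\<sigma> i) ` X"
  define F where "F = fixed_cycles i"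
  let ?\<Psi> = "\<lambda>c. q ` c"
  have finC: "finite C" and FC: "F \<subseteq> C"
    using finite_X by (auto simp: C_def F_def fixed_cycles_def)
  have finF: "finite F" using finC FC by (rule finite_subset[rotated])
  have img: "?\<Psi> ` C = orbit (\<sigma>_quot i) ` q ` X"
    unfolding C_def image_image using image_q_\<sigma>_orbit[OF i] by (intro image_cong) auto
  have cX: "c \<subseteq> X" "c \<noteq> {}" if "c \<in> C" for c
    using that \<sigma>_orbit_subset[OF i] by (auto simp: C_def orbit_nonempty)
  have fib_le: "card {c' \<in> C. ?\<Psi> c' = ?\<Psi> c} \<le> p" if c: "c \<in> C" for c
  proof -
    obtain x where x: "x \<in> c" using cX[OF c] by auto
    have "finite (q x)" using finite_orbit self_in_q by metis
    then have "card {c' \<in> C. ?\<Psi> c' = ?\<Psi> c} \<le> card (orbit (\<sigma> i) ` q x)"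
      using cycle_fibre[OF i _ x] c by (intro card_mono) (auto simp: C_def)
    also have "\<dots> \<le> card (q x)" using \<open>finite (q x)\<close> by (rule card_image_le)
    also have "\<dots> = p" using p(1) x cX[OF c] by auto
    finally show ?thesis .
  qed
  have fib_F: "{c' \<in> C. ?\<Psi> c' = ?\<Psi> c} = {c}" if c: "c \<in> F" for c
  proof -
    have cC: "c \<in> C" using c FC by auto
    obtain x where x: "x \<in> c" using cX[OF cC] by auto
    have "orbit (\<sigma> i) y = c" if "y \<in> q x" for y
    proof -
      have "y \<in> c" using fixed_cycle_q_subset[of c x] c x that by (auto simp: F_def fixed_cycles_def)
      then show ?thesis using cC \<sigma>_orbit_eq[OF i] by (auto simp: C_def)
    qed
    then show ?thesis using cycle_fibre[OF i _ x] cC by (auto simp: C_def)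
  qed
  have inj: "inj_on ?\<Psi> F"
  proof (rule inj_onI)
    fix c c' assume c: "c \<in> F" "c' \<in> F" "?\<Psi> c = ?\<Psi> c'"
    then have "c \<in> {d \<in> C. ?\<Psi> d = ?\<Psi> c'}" using FC by auto
    then show "c = c'" unfolding fib_F[OF c(2)] by simp
  qed
  have "card C = (\<Sum>y\<in>?\<Psi> ` C. card {c' \<in> C. ?\<Psi> c' = y})"
    using sum.image_gen[OF finC, of "\<lambda>_. 1::nat" ?\<Psi>] by simp
  also have "\<dots> = (\<Sum>y\<in>?\<Psi> ` F. card {c' \<in> C. ?\<Psi> c' = y}) +
      (\<Sum>y\<in>?\<Psi> ` C - ?\<Psi> ` F. card {c' \<in> C. ?\<Psi> c' = y})"
    using finC FC by (subst sum.subset_diff[of "?\<Psi> ` F"]) (auto simp: add.commute)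
  also have "(\<Sum>y\<in>?\<Psi> ` F. card {c' \<in> C. ?\<Psi> c' = y}) = card F"
    using fib_F by (subst sum.reindex[OF inj]) simp
  also have "(\<Sum>y\<in>?\<Psi> ` C - ?\<Psi> ` F. card {c' \<in> C. ?\<Psi> c' = y}) \<le> card (?\<Psi> ` C - ?\<Psi> ` F) * p"
    by (rule sum_bounded_above[of _ _ p, simplified]) (use fib_le in auto)
  also have "card (?\<Psi> ` C - ?\<Psi> ` F) = card (?\<Psi> ` C) - card F"
    using finF FC by (subst card_Diff_subset) (auto simp: card_image[OF inj])
  finally have le: "card C \<le> card F + (card (?\<Psi> ` C) - card F) * p" by simp
  have "card F \<le> card (?\<Psi> ` C)"
    using card_image[OF inj] card_mono[of "?\<Psi> ` C" "?\<Psi> ` F"] finC FC by (metis finite_imageI image_mono)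
  then obtain r where r: "card (?\<Psi> ` C) = card F + r" using le_Suc_ex by blast
  obtain s where s: "p = Suc s" using p(2) by (cases p) auto
  show ?thesis
    using le unfolding img[symmetric] C_def[symmetric] F_def[symmetric] r s
    by (simp add: algebra_simps)
qed

text \<open>Put d = \<open>card X\<close> and let r be the number of invariant cycles.
  Riemann-Hurwitz gives (n - 2) d + 2 cycles upstairs, and Ree gives at most (n - 2) d / p + 2 in
  the quotient. Summing \<open>card_cycles_le\<close> leaves (p - 1) r \<le> 2 (p - 1), where p
  \<ge> 2 because \<tau> moves a point.\<close>

theorem card_fixed_cycles_le_2:
  assumes RH: "(\<Sum>i = 1..n. int (card X) - int (card (orbit (\<sigma> i) ` X))) = 2 * int (card X) - 2"
    and moved: "x\<^sub>0 \<in> X" "\<tau> x\<^sub>0 \<noteq> x\<^sub>0"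
  shows "(\<Sum>i = 1..n. card (fixed_cycles i)) \<le> 2"
proof -
  define p where "p = card (q x\<^sub>0)"
  have p: "card (q x) = p" if "x \<in> X" for x
    unfolding p_def using that moved(1) by (rule card_q_eq)
  have "{x\<^sub>0, \<tau> x\<^sub>0} \<subseteq> q x\<^sub>0" using self_in_q by (auto intro: orbit.base)
  moreover have "finite (q x\<^sub>0)" using finite_orbit self_in_q by metis
  ultimately have p2: "p \<ge> 2"
    unfolding p_def using card_mono[of "q x\<^sub>0" "{x\<^sub>0, \<tau> x\<^sub>0}"] moved(2) by auto
  define Y where "Y = q ` X"
  define k where "k = (\<lambda>i. card (orbit (\<sigma>_quot i) ` Y))"
  have finY: "finite Y" using finite_X by (simp add: Y_def)
  have dX: "card X = p * card Y"
    unfolding Y_def by (rule card_eq_mult_card_image[OF finite_X]) (simp_all add: self_in_q q_subset p q_eq)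
  have k_le: "k i \<le> card Y" for i
    unfolding k_def by (rule card_image_le[OF finY])
  have "2 * card Y \<le> (\<Sum>i\<leftarrow>[1..<Suc n]. card Y - ncomp Y (graph_on Y (\<sigma>_quot i))) + 2"
    unfolding Y_def
  proof (rule ree_inequality)
    show "\<sigma>_quot i permutes q ` X" if "i \<in> set [1..<Suc n]" for i
      using that \<sigma>_quot_permutes[of i] by auto
    have "set [1..<Suc n] = {1..n}" by auto
    then show "q ` X \<times> q ` X \<subseteq> eqcl (\<Union>i\<in>set [1..<Suc n]. graph_on (q ` X) (\<sigma>_quot i))"
      using \<sigma>_quot_transitive by simp
  qed (use finite_X X_nonempty \<sigma>_quot_product in auto)
  also have "(\<Sum>i\<leftarrow>[1..<Suc n]. card Y - ncomp Y (graph_on Y (\<sigma>_quot i))) = (\<Sum>i\<in>{1..n}. card Y - k i)"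
  proof -
    have "(\<Sum>i\<leftarrow>[1..<Suc n]. card Y - ncomp Y (graph_on Y (\<sigma>_quot i))) =
        (\<Sum>i\<in>{1..n}. card Y - ncomp Y (graph_on Y (\<sigma>_quot i)))"
      by (subst sum_list_distinct_conv_sum_set) (auto intro: sum.cong)
    also have "\<dots> = (\<Sum>i\<in>{1..n}. card Y - k i)"
      unfolding k_def using ncomp_graph_on[OF finY] \<sigma>_quot_permutes
      by (intro sum.cong) (auto simp: Y_def)
    finally show ?thesis .
  qed
  finally have "2 * card Y \<le> (\<Sum>i\<in>{1..n}. card Y - k i) + 2" .
  then have "int (2 * card Y) \<le> int ((\<Sum>i\<in>{1..n}. card Y - k i) + 2)"
    by (simp only: of_nat_le_iff)
  then have ree: "2 * int (card Y) \<le> (\<Sum>i\<in>{1..n}. int (card Y) - int (k i)) + 2"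
    using k_le by (simp add: of_nat_diff)
  let ?r = "\<Sum>i = 1..n. card (fixed_cycles i)"
  have "int (card (orbit (\<sigma> i) ` X)) + (int p - 1) * int (card (fixed_cycles i)) \<le> int p * int (k i)"
    if "i \<in> {1..n}" for i
  proof -
    have "card (orbit (\<sigma> i) ` X) + (p - 1) * card (fixed_cycles i) \<le> p * k i"
      unfolding k_def Y_def using card_cycles_le[OF that p] p2 by simp
    then have "int (card (orbit (\<sigma> i) ` X) + (p - 1) * card (fixed_cycles i)) \<le> int (p * k i)"
      by (simp only: of_nat_le_iff)
    then show ?thesis using p2 by (simp add: of_nat_diff)
  qed
  then have "(\<Sum>i = 1..n. int (card (orbit (\<sigma> i) ` X)) + (int p - 1) * int (card (fixed_cycles i)))
      \<le> (\<Sum>i = 1..n. int p * int (k i))" by (intro sum_mono) auto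
  then have 1: "(\<Sum>i = 1..n. int (card (orbit (\<sigma> i) ` X))) + (int p - 1) * int ?r
      \<le> int p * (\<Sum>i = 1..n. int (k i))"
    by (simp add: sum.distrib flip: sum_distrib_left)
  have 2: "(\<Sum>i = 1..n. int (card (orbit (\<sigma> i) ` X))) = int n * int (card X) - 2 * int (card X) + 2"
    using RH by (simp add: sum_subtractf)
  have "(\<Sum>i = 1..n. int (k i)) \<le> int n * int (card Y) - 2 * int (card Y) + 2"
    using ree by (simp add: sum_subtractf)
  then have "int p * (\<Sum>i = 1..n. int (k i)) \<le> int p * (int n * int (card Y) - 2 * int (card Y) + 2)"
    by (rule mult_left_mono) simp
  with 1 2 have "(int p - 1) * int ?r \<le> (int p - 1) * 2"
    unfolding dX by (simp add: algebra_simps)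
  then have "int ?r \<le> 2" using p2 by (subst (asm) mult_le_cancel_left_pos) auto
  then show ?thesis by linarith
qed

lemma fixed_cycle_even:
  assumes "i \<in> {1..n}" "c \<in> orbit (\<sigma> i) ` X" "\<tau> ` c \<noteq> c" "\<tau> ` \<tau> ` c = c"
    and "c' \<subseteq> X" "\<tau> ` c' = c'"
  shows "even (card c')"
proof -
  obtain x where x: "x \<in> X" "c = orbit (\<sigma> i) x" using assms(2) by auto
  have xc: "x \<in> c" using x self_in_\<sigma>_orbit[OF assms(1)] by simp
  have disj: "c \<inter> \<tau> ` c = {}"
  proof (rule ccontr)
    assume "c \<inter> \<tau> ` c \<noteq> {}"
    then obtain y where y: "y \<in> c" "y \<in> orbit (\<sigma> i) (\<tau> x)"
      using x image_\<tau>_\<sigma>_orbit[OF assms(1)] by auto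
    then have "c = orbit (\<sigma> i) (\<tau> x)"
      using \<sigma>_orbit_eq[OF assms(1)] x by metis
    then show False using assms(3) x image_\<tau>_\<sigma>_orbit[OF assms(1) x(1)] by metis
  qed
  have q_sub: "q x \<subseteq> c \<union> \<tau> ` c"
    by (rule fixed_cycle_q_subset) (use assms(4) xc in \<open>auto simp: image_Un\<close>)
  have fin: "finite (q x)" using finite_orbit self_in_q by metis
  have inj: "inj \<tau>" by (rule permutes_inj[OF \<tau>_permutes])
  have im: "\<tau> ` (q x \<inter> c) = q x \<inter> \<tau> ` c"
  proof -
    have "\<tau> ` q x = q x"
      using orbit_inverse[of x \<tau> \<tau> \<tau>, OF self_in_q] permutation_orbit_step[OF \<tau>_permutation] by simp
    then show ?thesis by (simp add: image_Int[OF inj])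
  qed
  have "card (q x) = card (q x \<inter> c) + card (q x \<inter> \<tau> ` c)"
    using q_sub disj fin by (subst card_Un_disjoint[symmetric]) (auto intro: arg_cong[where f = card])
  also have "card (q x \<inter> \<tau> ` c) = card (q x \<inter> c)"
    unfolding im[symmetric] using inj by (intro card_image) (auto intro: inj_on_subset)
  finally have "even (card (q x))" by simp
  moreover have "card c' = card (q x) * card (q ` c')"
  proof (rule card_eq_mult_card_image)
    show "finite c'" using assms(5) finite_X by (rule finite_subset)
    show "card (q y) = card (q x)" if "y \<in> c'" for y
      using that assms(5) x(1) by (intro card_q_eq) auto
    show "q y \<subseteq> c'" if "y \<in> c'" for y
      by (rule fixed_cycle_q_subset[OF assms(6) that])
  qed (simp_all add: self_in_q q_eq)
  ultimately show ?thesis by simp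
qed

end

subsection \<open>Reflection groups and Tits' positivity theorem\<close>

fun cheb :: "real \<Rightarrow> nat \<Rightarrow> real" where
  "cheb c 0 = 0"
| "cheb c (Suc 0) = 1"
| "cheb c (Suc (Suc k)) = 2 * c * cheb c (Suc k) - cheb c k"

text \<open>This identifies \<open>cheb c k\<close> as the Chebyshev polynomial of the second kind U
  with index k - 1, evaluated at \<open>c\<close>.\<close>

lemma cheb_cos: "cheb (cos t) k * sin t = sin (real k * t)"
proof (induction "cos t" k rule: cheb.induct)
  case (3 k)
  have "sin (real (Suc (Suc k)) * t) = 2 * cos t * sin (real (Suc k) * t) - sin (real k * t)"
  proof -
    have 1: "real (Suc (Suc k)) * t = real (Suc k) * t + t" and 2: "real k * t = real (Suc k) * t - t"
      by (simp_all add: algebra_simps)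
    show ?thesis unfolding 1 2 sin_add sin_diff by simp
  qed
  with 3 show ?case by (simp add: left_diff_distrib)
qed auto

lemma cheb_2: "0 \<le> cheb 2 k \<and> cheb 2 k + 1 \<le> cheb 2 (Suc k)"
  by (induction k) auto

lemma cheb_2_pos: "0 < k \<Longrightarrow> 0 < cheb 2 k"
  using cheb_2[of "k - 1"] by (cases k) auto

text \<open>For \<open>m = \<infinity>\<close> any weight \<open>\<ge> 1\<close> gives a representation with the positivity property; a weight
  \<open>> 1\<close> makes the form nondegenerate on the span of the two roots, as it is for finite \<open>m\<close>.\<close>

definition edge_weight :: "enat \<Rightarrow> real" where
  "edge_weight m = (case m of enat k \<Rightarrow> cos (pi / real k) | \<infinity> \<Rightarrow> 2)"

lemma sin_pi_div_pos: "2 \<le> k \<Longrightarrow> 0 < sin (pi / real k)"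
  by (rule sin_gt_zero) (auto simp: field_simps)

text \<open>For finite \<open>m\<close> the value is sin (k \<pi> / m) / sin (\<pi> / m) with k
  \<pi> / m \<le> \<pi>; for infinite \<open>m\<close> the values at 2 increase from 0.\<close>

lemma cheb_edge_weight_nonneg:
  assumes "2 \<le> m" "enat k \<le> m"
  shows "0 \<le> cheb (edge_weight m) k"
proof (cases m)
  case (enat l)
  have l: "2 \<le> l" using assms(1) enat by (simp add: numeral_eq_enat)
  have "real k * (pi / real l) \<le> pi"
    using assms(2) enat l by (simp add: field_simps)
  then have "0 \<le> sin (real k * (pi / real l))"
    by (intro sin_ge_zero) auto
  then have "0 \<le> cheb (cos (pi / real l)) k * sin (pi / real l)" by (simp add: cheb_cos)
  then show ?thesis
    using sin_pi_div_pos[OF l] enat by (simp add: edge_weight_def zero_le_mult_iff)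
next
  case infinity
  then show ?thesis using cheb_2 by (simp add: edge_weight_def)
qed

text \<open>The Gram determinant of two roots is 1 minus the squared weight, so this is
  nondegeneracy on the plane that they span.\<close>

lemma edge_weight_sq_neq_1: "2 \<le> m \<Longrightarrow> (edge_weight m)\<^sup>2 \<noteq> 1"
proof (cases m)
  case (enat l)
  assume "2 \<le> m"
  then have "2 \<le> l" using enat by (simp add: numeral_eq_enat)
  from sin_pi_div_pos[OF this] have "(sin (pi / real l))\<^sup>2 > 0" by simp
  then have "(cos (pi / real l))\<^sup>2 \<noteq> 1" using sin_cos_squared_add[of "pi / real l"] by linarith
  then show ?thesis using enat by (simp add: edge_weight_def)
qed (simp add: edge_weight_def)

lemma edge_weight_eq_0:
  assumes "2 \<le> m" "edge_weight m = 0"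
  shows "m = 2"
proof (cases m)
  case (enat l)
  have l: "2 \<le> l" using assms(1) enat by (simp add: numeral_eq_enat)
  have "l = 2"
  proof (rule ccontr)
    assume "l \<noteq> 2"
    with l have "pi / real l < pi / 2" by (intro divide_strict_left_mono) auto
    then have "0 < cos (pi / real l)" by (intro cos_gt_zero) (use l in auto)
    with assms(2) enat show False by (simp add: edge_weight_def)
  qed
  with enat show ?thesis by (simp add: numeral_eq_enat)
qed (use assms in \<open>simp add: edge_weight_def\<close>)

section \<open>The geometric representation of a Coxeter matrix\<close>

definition lin :: "((nat \<Rightarrow> real) \<Rightarrow> nat \<Rightarrow> real) \<Rightarrow> bool" where
  "lin A \<longleftrightarrow> (\<forall>a b u v. A (\<lambda>k. a * u k + b * v k) = (\<lambda>k. a * A u k + b * A v k))"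

lemma linD: "lin A \<Longrightarrow> A (\<lambda>k. a * u k + b * v k) = (\<lambda>k. a * A u k + b * A v k)"
  by (simp add: lin_def)

lemma lin_id: "lin id"
  by (simp add: lin_def)

lemma lin_comp: "lin A \<Longrightarrow> lin B \<Longrightarrow> lin (A \<circ> B)"
  by (simp add: lin_def)

lemma lin_scale: "lin A \<Longrightarrow> A (\<lambda>k. a * u k) = (\<lambda>k. a * A u k)"
  using linD[of A a u 0 u] by simp

definition axis :: "nat \<Rightarrow> nat \<Rightarrow> real" where
  "axis i = (\<lambda>k. if k = i then 1 else 0)"

locale coxeter_matrix =
  fixes n :: nat and m :: "nat \<Rightarrow> nat \<Rightarrow> enat"
  assumes m_sym: "m i j = m j i" and m_ge_2: "i \<in> {1..n} \<Longrightarrow> j \<in> {1..n} \<Longrightarrow> i \<noteq> j \<Longrightarrow> 2 \<le> m i j"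
begin

abbreviation c :: "nat \<Rightarrow> nat \<Rightarrow> real" where "c i j \<equiv> edge_weight (m i j)"

text \<open>The pairing of \<open>v\<close> with the i-th simple root \<open>axis i\<close>, for the
  symmetric form with value 1 on each root and minus the edge weight on two different ones.\<close>

definition coform :: "nat \<Rightarrow> (nat \<Rightarrow> real) \<Rightarrow> real" where
  "coform i v = v i - (\<Sum>j\<in>{1..n} - {i}. c i j * v j)"

definition reflection :: "nat \<Rightarrow> (nat \<Rightarrow> real) \<Rightarrow> nat \<Rightarrow> real" where
  "reflection i v = (\<lambda>k. v k - 2 * coform i v * axis i k)"

lemma coform_add: "coform i (\<lambda>k. a * u k + b * v k) = a * coform i u + b * coform i v"
  by (simp add: coform_def algebra_simps sum.distrib sum_distrib_left)

lemma coform_axis_self: "coform i (axis i) = 1"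
  by (simp add: coform_def axis_def)

lemma coform_axis: "i \<noteq> j \<Longrightarrow> j \<in> {1..n} \<Longrightarrow> coform i (axis j) = - c i j"
  by (simp add: coform_def axis_def if_distrib[where f = "\<lambda>x. _ * x"] cong: if_cong)

lemma lin_reflection: "lin (reflection i)"
  by (auto simp: lin_def reflection_def coform_add algebra_simps)

lemma coform_reflection_self: "coform i (reflection i v) = - coform i v"
  using coform_add[of i 1 v "- 2 * coform i v" "axis i"]
  by (simp add: reflection_def coform_axis_self)

lemma reflection_reflection [simp]: "reflection i (reflection i v) = v"
  unfolding reflection_def[of i "reflection i v"] coform_reflection_self
  by (simp add: reflection_def)

lemma reflection_comp_self [simp]: "reflection i \<circ> reflection i = id"
  by (simp add: fun_eq_iff)

lemma reflection_axis_self: "reflection i (axis i) = (\<lambda>k. - axis i k)"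
  by (simp add: reflection_def coform_axis_self)

lemma reflection_axis:
  "i \<noteq> j \<Longrightarrow> j \<in> {1..n} \<Longrightarrow> reflection i (axis j) = (\<lambda>k. axis j k + 2 * c i j * axis i k)"
  by (simp add: reflection_def coform_axis)

text \<open>One step of the recursion of \<open>cheb\<close>, acting on coordinates in the plane of
  two roots. The outer map \<open>A\<close> is there so that the same step can be taken at an
  arbitrary chamber.\<close>

lemma reflection_comp_axis:
  assumes A: "lin A" and ij: "i \<noteq> j" "i \<in> {1..n}" "j \<in> {1..n}"
  shows "A (reflection i (\<lambda>k. a * axis j k + b * axis i k)) =
    (\<lambda>k. (2 * c i j * a - b) * A (axis i) k + a * A (axis j) k)"
proof -
  have "reflection i (\<lambda>k. a * axis j k + b * axis i k) =
      (\<lambda>k. (2 * c i j * a - b) * axis i k + a * axis j k)"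
    by (auto simp: linD[OF lin_reflection] reflection_axis_self reflection_axis[OF ij(1,3)] algebra_simps)
  then show ?thesis by (simp add: linD[OF A])
qed

text \<open>Each reflection advances the Chebyshev index by one, hence each rotation by two.\<close>

lemma rotation_axis:
  assumes ij: "i \<noteq> j" "i \<in> {1..n}" "j \<in> {1..n}"
  shows "((reflection i \<circ> reflection j) ^^ k) (axis i) =
    (\<lambda>t. cheb (c i j) (Suc (2 * k)) * axis i t + cheb (c i j) (2 * k) * axis j t)"
proof (induction k)
  case (Suc k)
  have "((reflection i \<circ> reflection j) ^^ Suc k) (axis i) = reflection i (id (reflection j
      (\<lambda>t. cheb (c i j) (Suc (2 * k)) * axis i t + cheb (c i j) (2 * k) * axis j t)))"
    by (simp add: Suc)
  also have "\<dots> = id (reflection i (\<lambda>t. cheb (c i j) (Suc (Suc (2 * k))) * axis j t +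
        cheb (c i j) (Suc (2 * k)) * axis i t))"
    by (subst reflection_comp_axis[OF lin_id]) (use ij in \<open>auto simp: m_sym[of j i]\<close>)
  also have "\<dots> = (\<lambda>t. cheb (c i j) (Suc (Suc (Suc (2 * k)))) * axis i t +
        cheb (c i j) (Suc (Suc (2 * k))) * axis j t)"
    by (subst reflection_comp_axis[OF lin_id]) (use ij in auto)
  finally show ?case by (simp add: comp_def)
qed (simp add: axis_def)

lemma rotation_fixes_axis:
  assumes ij: "i \<noteq> j" "i \<in> {1..n}" "j \<in> {1..n}" and m: "m i j = enat k"
  shows "((reflection i \<circ> reflection j) ^^ k) (axis i) = axis i"
proof -
  have k: "2 \<le> k" using m_ge_2[of i j] ij m by (simp add: numeral_eq_enat)
  let ?t = "pi / real k"
  have s: "sin ?t > 0" by (rule sin_pi_div_pos[OF k])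
  have "cheb (cos ?t) (2 * k) * sin ?t = sin (2 * pi)"
    using k by (simp add: cheb_cos)
  then have 1: "cheb (cos ?t) (2 * k) = 0" using s by simp
  have "real (Suc (2 * k)) * ?t = 2 * pi + ?t" using k by (simp add: field_simps)
  then have "cheb (cos ?t) (Suc (2 * k)) * sin ?t = sin ?t"
    by (simp only: cheb_cos sin_add) simp
  then have 2: "cheb (cos ?t) (Suc (2 * k)) = 1" using s by simp
  show ?thesis
    unfolding rotation_axis[OF ij] m using 1 2 by (simp add: edge_weight_def)
qed

text \<open>The coefficients say that sine and cosine of 2 k \<pi> / m are 0 and 1, so k / m is an
  integer. For infinite weight, \<open>cheb 2\<close> has no zero at a positive index.\<close>

lemma rotation_fixes_axis_imp_dvd:
  assumes ij: "i \<noteq> j" "i \<in> {1..n}" "j \<in> {1..n}"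
    and fixed: "((reflection i \<circ> reflection j) ^^ k) (axis i) = axis i"
  shows "if m i j = \<infinity> then k = 0 else the_enat (m i j) dvd k"
proof -
  have eq: "cheb (c i j) (Suc (2 * k)) * axis i t + cheb (c i j) (2 * k) * axis j t = axis i t" for t
    using fixed rotation_axis[OF ij, of k] by metis
  from eq[of i] eq[of j] ij(1)
  have 1: "cheb (c i j) (Suc (2 * k)) = 1" and 2: "cheb (c i j) (2 * k) = 0"
    by (auto simp: axis_def)
  show ?thesis
  proof (cases "m i j")
    case (enat l)
    have l: "2 \<le> l" using m_ge_2[of i j] ij enat by (simp add: numeral_eq_enat)
    let ?t = "pi / real l"
    have s: "sin ?t > 0" by (rule sin_pi_div_pos[OF l])
    have "sin (real (2 * k) * ?t) = 0" 
      using 2 enat cheb_cos[of ?t "2 * k"] by (simp add: edge_weight_def)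
    moreover have "sin (real (Suc (2 * k)) * ?t) = sin ?t"
      using 1 enat cheb_cos[of ?t "Suc (2 * k)"] by (simp add: edge_weight_def)
    moreover have "real (Suc (2 * k)) * ?t = real (2 * k) * ?t + ?t" by (simp add: algebra_simps)
    ultimately have "cos (real (2 * k) * ?t) * sin ?t = sin ?t"
      by (simp only: sin_add)
    then have "cos (real (2 * k) * ?t) = 1" using s by simp
    then obtain x :: int where "real (2 * k) * ?t = real_of_int x * 2 * pi"
      using cos_one_2pi_int by blast
    then have "real k = real_of_int x * real l" using l by (simp add: field_simps)
    then have "int k = x * int l" by (metis of_int_eq_iff of_int_mult of_int_of_nat_eq)
    then have "int l dvd int k" by simp
    then show ?thesis using enat by simp
  next
    case infinity
    then have "cheb 2 (2 * k) = 0" using 2 by (simp add: edge_weight_def)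
    then show ?thesis using cheb_2_pos[of "2 * k"] infinity by (cases k) auto
  qed
qed

lemma lin_funpow: "lin A \<Longrightarrow> lin (A ^^ k)"
  by (induction k) (auto simp: lin_id lin_comp)

lemma funpow_reflections_inverse: "((reflection i \<circ> reflection j) ^^ k) (((reflection j \<circ> reflection i) ^^ k) v) = v"
proof (induction k arbitrary: v)
  case (Suc k)
  have "((reflection i \<circ> reflection j) ^^ Suc k) (((reflection j \<circ> reflection i) ^^ Suc k) v) =
     ((reflection i \<circ> reflection j) ^^ k) ((reflection i \<circ> reflection j) ((reflection j \<circ> reflection i)
        (((reflection j \<circ> reflection i) ^^ k) v)))"
    by (simp add: funpow_swap1)
  then show ?case using Suc by (simp add: comp_def)
qed simp

text \<open>Inverting the 2 by 2 Gram matrix, of determinant 1 - c^2, gives a vector of the plane of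
  the two roots that is dual to the first of them.\<close>

lemma coform_dual_vector:
  assumes ij: "i \<noteq> j" "i \<in> {1..n}" "j \<in> {1..n}"
  obtains v where "coform i v = 1" "coform j v = 0"
    "v = (\<lambda>k. (1 / (1 - (c i j)\<^sup>2)) * axis i k + (c i j / (1 - (c i j)\<^sup>2)) * axis j k)"
proof
  let ?d = "1 - (c i j)\<^sup>2"
  let ?v = "\<lambda>k. (1 / ?d) * axis i k + (c i j / ?d) * axis j k"
  have d: "?d \<noteq> 0" using edge_weight_sq_neq_1[OF m_ge_2[OF ij(2,3,1)]] by simp
  show "coform i ?v = 1"
    unfolding coform_add coform_axis_self coform_axis[OF ij(1,3)] using d
    by (simp add: field_simps power2_eq_square)
  show "coform j ?v = 0"
    unfolding coform_add coform_axis_self coform_axis[OF ij(1)[symmetric] ij(2)] using d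
    by (simp add: m_sym[of j i])
qed auto

text \<open>Every vector splits into a combination \<open>?p\<close> of the two dual vectors and a
  rest \<open>?u\<close> killed by both coforms. The rest is fixed by both reflections, and on the
  plane it is enough that both roots are fixed.\<close>

lemma rotation_order:
  assumes ij: "i \<noteq> j" "i \<in> {1..n}" "j \<in> {1..n}" and m: "m i j = enat k"
  shows "(reflection i \<circ> reflection j) ^^ k = id"
proof
  fix v
  let ?T = "(reflection i \<circ> reflection j) ^^ k"
  have T: "lin ?T" by (intro lin_funpow lin_comp lin_reflection)
  obtain v1 where v1: "coform i v1 = 1" "coform j v1 = 0"
     "v1 = (\<lambda>k. (1 / (1 - (c i j)\<^sup>2)) * axis i k + (c i j / (1 - (c i j)\<^sup>2)) * axis j k)"
    by (rule coform_dual_vector[OF ij])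
  obtain v2 where v2: "coform j v2 = 1" "coform i v2 = 0"
     "v2 = (\<lambda>k. (1 / (1 - (c j i)\<^sup>2)) * axis j k + (c j i / (1 - (c j i)\<^sup>2)) * axis i k)"
    by (rule coform_dual_vector[OF ij(1)[symmetric] ij(3,2)])
  have Ti: "?T (axis i) = axis i" by (rule rotation_fixes_axis[OF ij m])
  \<comment> \<open>\<open>rotation_fixes_axis\<close> concerns the root of the outer reflection, so
    for \<open>axis j\<close> it is applied to the inverse rotation.\<close>
  have "((reflection j \<circ> reflection i) ^^ k) (axis j) = axis j"
    by (rule rotation_fixes_axis) (use ij m m_sym in auto)
  then have Tj: "?T (axis j) = axis j"
    using funpow_reflections_inverse[of k i j "axis j"] by simp
  have T1: "?T v1 = v1" unfolding v1(3) linD[OF T] Ti Tj ..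
  have T2: "?T v2 = v2" unfolding v2(3) linD[OF T] Ti Tj ..
  let ?p = "\<lambda>k. coform i v * v1 k + coform j v * v2 k"
  let ?u = "\<lambda>k. 1 * v k + (-1) * ?p k"
  have "coform i ?u = 0" "coform j ?u = 0"
    unfolding coform_add v1(1,2) v2(1,2) by simp_all
  then have "(reflection i \<circ> reflection j) ?u = ?u" by (simp add: reflection_def)
  then have Tu: "?T ?u = ?u" by (induction k) (auto simp: funpow_swap1)
  have Tp: "?T ?p = ?p" unfolding linD[OF T] T1 T2 ..
  have "?T v = ?T (\<lambda>k. 1 * ?u k + 1 * ?p k)" by simp
  also have "\<dots> = (\<lambda>k. 1 * ?u k + 1 * ?p k)" unfolding linD[OF T, of 1 ?u 1 ?p] Tu Tp ..
  finally show "?T v = id v" by simp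
qed

end

text \<open>Stands for a Coxeter group seen through right multiplication by its generators:
  \<open>act x i\<close> crosses the wall \<open>i\<close> of the chamber \<open>x\<close>,
  \<open>P x\<close> is the linear map of \<open>x\<close>, and \<open>P x (axis i)\<close> is the
  root of that wall. \<open>par\<close> is the sign character.\<close>

locale chamber_system = coxeter_matrix n m
  for n :: nat and m :: "nat \<Rightarrow> nat \<Rightarrow> enat" +
  fixes C :: "'x set" and x\<^sub>0 :: 'x and act :: "'x \<Rightarrow> nat \<Rightarrow> 'x" and par :: "'x \<Rightarrow> bool"
    and P :: "'x \<Rightarrow> (nat \<Rightarrow> real) \<Rightarrow> nat \<Rightarrow> real"
  assumes act_closed: "x \<in> C \<Longrightarrow> i \<in> {1..n} \<Longrightarrow> act x i \<in> C"
    and act_act: "x \<in> C \<Longrightarrow> i \<in> {1..n} \<Longrightarrow> act (act x i) i = x"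
    and connected: "x \<in> C \<Longrightarrow> \<exists>w. set w \<subseteq> {1..n} \<and> foldl act x\<^sub>0 w = x"
    and par_act: "x \<in> C \<Longrightarrow> i \<in> {1..n} \<Longrightarrow> par (act x i) = (\<not> par x)"
    and base_in: "x\<^sub>0 \<in> C"
    and dihedral: "x \<in> C \<Longrightarrow> i \<in> {1..n} \<Longrightarrow> j \<in> {1..n} \<Longrightarrow> i \<noteq> j \<Longrightarrow> m i j = enat k \<Longrightarrow>
      ((\<lambda>y. act (act y i) j) ^^ k) x = x"
    and lin_P: "x \<in> C \<Longrightarrow> lin (P x)"
    and P_act: "x \<in> C \<Longrightarrow> i \<in> {1..n} \<Longrightarrow> P (act x i) = P x \<circ> reflection i"
    and P_base: "P x\<^sub>0 = id"
begin

section \<open>Length of a chamber and positivity of roots\<close>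

definition len :: "'x \<Rightarrow> nat" where
  "len x = (LEAST k. \<exists>w. set w \<subseteq> {1..n} \<and> length w = k \<and> foldl act x\<^sub>0 w = x)"

lemma len_word:
  assumes "x \<in> C"
  obtains w where "set w \<subseteq> {1..n}" "length w = len x" "foldl act x\<^sub>0 w = x"
proof -
  have "\<exists>k w. set w \<subseteq> {1..n} \<and> length w = k \<and> foldl act x\<^sub>0 w = x"
    using connected[OF assms] by blast
  from LeastI_ex[OF this] show ?thesis using that unfolding len_def by blast
qed

lemma len_le: "set w \<subseteq> {1..n} \<Longrightarrow> foldl act x\<^sub>0 w = x \<Longrightarrow> len x \<le> length w"
  unfolding len_def by (rule Least_le) blast

lemma foldl_act_in: "set w \<subseteq> {1..n} \<Longrightarrow> foldl act x\<^sub>0 w \<in> C"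
  by (induction w rule: rev_induct) (auto simp: base_in act_closed)

lemma par_word: "set w \<subseteq> {1..n} \<Longrightarrow> par (foldl act x\<^sub>0 w) = (if even (length w) then par x\<^sub>0 else \<not> par x\<^sub>0)"
  by (induction w rule: rev_induct) (auto simp: par_act foldl_act_in)

lemma par_len: "x \<in> C \<Longrightarrow> par x = (if even (len x) then par x\<^sub>0 else \<not> par x\<^sub>0)"
  by (metis len_word par_word)

lemma len_act_le: 
  assumes "x \<in> C" "i \<in> {1..n}" shows "len (act x i) \<le> Suc (len x)"
proof -
  obtain w where "set w \<subseteq> {1..n}" "length w = len x" "foldl act x\<^sub>0 w = x"
    by (rule len_word[OF assms(1)])
  with len_le[of "w @ [i]" "act x i"] assms(2) show ?thesis by auto
qed

lemma len_act_ge: "x \<in> C \<Longrightarrow> i \<in> {1..n} \<Longrightarrow> len x \<le> Suc (len (act x i))"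
  using len_act_le[of "act x i" i] act_closed act_act by simp

text \<open>Length has the parity of \<open>par\<close> relative to the base chamber, and
  \<open>par\<close> flips. So every crossing is either an ascent or a descent.\<close>

lemma len_act_neq: "x \<in> C \<Longrightarrow> i \<in> {1..n} \<Longrightarrow> len (act x i) \<noteq> len x"
  using par_len[of x] par_len[of "act x i"] par_act[of x i] act_closed[of x i] by auto

lemma len_descent:
  assumes "x \<in> C" "x \<noteq> x\<^sub>0"
  obtains j where "j \<in> {1..n}" "len (act x j) < len x"
proof -
  obtain w where w: "set w \<subseteq> {1..n}" "length w = len x" "foldl act x\<^sub>0 w = x"
    by (rule len_word[OF assms(1)])
  with assms(2) obtain w' j where w': "w = w' @ [j]" by (cases w rule: rev_cases) auto
  then have "act x j = foldl act x\<^sub>0 w'"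
    using w act_act[of "foldl act x\<^sub>0 w'" j] foldl_act_in[of w'] by auto
  with len_le[of w' "act x j"] w w' show ?thesis by (intro that[of j]) auto
qed

text \<open>The alternating path inside a dihedral residue; step counting starts at 0, so the first
  wall crossed is \<open>i\<close>.\<close>

fun walk :: "'x \<Rightarrow> nat \<Rightarrow> nat \<Rightarrow> nat \<Rightarrow> 'x" where
  "walk x i j 0 = x"
| "walk x i j (Suc k) = act (walk x i j k) (if even k then i else j)"

lemma walk_Suc: "walk x i j (Suc k) = walk (act x i) j i k"
  by (induction k) auto

lemma walk_in: "x \<in> C \<Longrightarrow> i \<in> {1..n} \<Longrightarrow> j \<in> {1..n} \<Longrightarrow> walk x i j k \<in> C"
  by (induction k) (simp_all add: act_closed)

lemma len_walk_le: "x \<in> C \<Longrightarrow> i \<in> {1..n} \<Longrightarrow> j \<in> {1..n} \<Longrightarrow>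
   len (walk x i j (k + d)) \<le> len (walk x i j k) + d"
proof (induction d)
  case (Suc d)
  have "len (walk x i j (k + Suc d)) \<le> Suc (len (walk x i j (k + d)))"
    using Suc.prems by (simp add: len_act_le walk_in)
  with Suc show ?case by simp
qed simp

lemma walk_twice: "walk x i j (2 * k) = ((\<lambda>y. act (act y i) j) ^^ k) x"
  by (induction k) auto

text \<open>Passing from \<open>y k\<close> to the next chamber across the wall \<open>q\<close>
  inserts \<open>reflection q\<close>, which shifts the two Chebyshev coefficients by one index and
  exchanges the roles of the two roots.\<close>

lemma axis_expansion_along_walk:
  assumes x: "x \<in> C" and ij: "i \<in> {1..n}" "j \<in> {1..n}" "i \<noteq> j"
  defines "y \<equiv> walk x j i"
  shows "P x (axis i) = (\<lambda>t. cheb (c i j) (Suc k) * P (y k) (axis (if even k then i else j)) t +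
            cheb (c i j) k * P (y k) (axis (if even k then j else i)) t)"
proof (induction k)
  case 0
  show ?case by (simp add: y_def)
next
  case (Suc k)
  define p q where "p = (if even k then i else j)" and "q = (if even k then j else i)"
  have pq: "p \<noteq> q" "p \<in> {1..n}" "q \<in> {1..n}" using ij by (auto simp: p_def q_def)
  have ck: "c q p = c i j" by (simp add: p_def q_def m_sym[of j i])
  have yk: "y k \<in> C" unfolding y_def by (rule walk_in) (use x ij in auto)
  have ys: "y (Suc k) = act (y k) q" by (simp add: y_def q_def)
  have yS: "y (Suc k) \<in> C" unfolding ys by (rule act_closed[OF yk pq(3)])
  have "act (y (Suc k)) q = y k" unfolding ys by (rule act_act[OF yk pq(3)])
  then have Pk: "P (y k) = P (y (Suc k)) \<circ> reflection q"
    using P_act[OF yS pq(3)] by simp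
  have "P x (axis i) = (\<lambda>t. cheb (c i j) (Suc k) * P (y k) (axis p) t + cheb (c i j) k * P (y k) (axis q) t)"
    unfolding p_def q_def by (rule Suc)
  also have "\<dots> = P (y k) (\<lambda>t. cheb (c i j) (Suc k) * axis p t + cheb (c i j) k * axis q t)"
    by (rule linD[OF lin_P[OF yk], symmetric])
  also have "\<dots> = P (y (Suc k)) (reflection q (\<lambda>t. cheb (c i j) (Suc k) * axis p t + cheb (c i j) k * axis q t))"
    unfolding Pk by simp
  also have "\<dots> = (\<lambda>t. (2 * c q p * cheb (c i j) (Suc k) - cheb (c i j) k) * P (y (Suc k)) (axis q) t
       + cheb (c i j) (Suc k) * P (y (Suc k)) (axis p) t)"
    by (rule reflection_comp_axis[OF lin_P[OF yS] pq(1)[symmetric] pq(3,2)])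
  also have "\<dots> = (\<lambda>t. cheb (c i j) (Suc (Suc k)) * P (y (Suc k)) (axis (if even (Suc k) then i else j)) t
       + cheb (c i j) (Suc k) * P (y (Suc k)) (axis (if even (Suc k) then j else i)) t)"
    unfolding ck by (simp add: p_def q_def)
  finally show ?case .
qed

text \<open>Walk down from \<open>x\<close> alternately along \<open>j\<close> and \<open>i\<close> until both directions go up. The root at \<open>x\<close>
  is then a combination of the two roots at the bottom, with Chebyshev coefficients; these are
  nonnegative because the dihedral relation bounds the length of the walk by \<open>m i j - 1\<close>.\<close>

lemma descent_step:
  assumes x: "x \<in> C" and ij: "i \<in> {1..n}" "j \<in> {1..n}" "i \<noteq> j"
    and desc: "len (act x j) < len x"
    and asc: "m i j = \<infinity> \<or> len x < len (act x i)"
    and IH: "\<And>y l. y \<in> C \<Longrightarrow> len y < len x \<Longrightarrow> l \<in> {1..n} \<Longrightarrow> len y < len (act y l) \<Longrightarrow> 0 \<le> P y (axis l) t"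
  shows "0 \<le> P x (axis i) t"
proof -
  \<comment> \<open>A step lowers the length by at most one, so \<open>Q k\<close> says that the
    first \<open>k\<close> steps all descend; the \<open>k\<close> chosen below is where the descent
    stops.\<close>
  define Q where "Q k \<longleftrightarrow> len (walk x j i k) + k = len x" for k
  have "\<exists>k. \<not> Q (Suc k)"
    by (rule exI[of _ "len x"]) (simp add: Q_def)
  define k where "k = (LEAST k. \<not> Q (Suc k))"
  have nQ: "\<not> Q (Suc k)" unfolding k_def by (rule LeastI_ex) fact
  have Q: "Q l" if "l \<le> k" for l
  proof (cases l)
    case (Suc l')
    then show ?thesis using that not_less_Least[of l' "\<lambda>k. \<not> Q (Suc k)"] unfolding k_def by auto
  qed (simp add: Q_def)
  have Q1: "Q (Suc 0)"
    using desc len_act_ge[OF x ij(2)] by (simp add: Q_def)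
  then have k0: "k \<noteq> 0" using nQ by metis
  define y where "y = walk x j i k"
  define p q where "p = (if even k then i else j)" and "q = (if even k then j else i)"
  have pq: "p \<in> {1..n}" "q \<in> {1..n}" using ij by (auto simp: p_def q_def)
  have y: "y \<in> C" unfolding y_def by (rule walk_in) (use x ij in auto)
  have leny: "len y + k = len x" using Q[of k] by (simp add: Q_def y_def)
  have up_q: "len y < len (act y q)"
  proof -
    have "act y q = walk x j i (Suc k)" by (simp add: y_def q_def)
    then have "len (act y q) + Suc k \<noteq> len x" using nQ by (simp add: Q_def)
    with leny len_act_neq[OF y pq(2)] len_act_ge[OF y pq(2)] show ?thesis by linarith
  qed
  have up_p: "len y < len (act y p)"
  proof -
    obtain k' where k': "k = Suc k'" using k0 by (cases k) auto
    have "y = act (walk x j i k') p" by (simp add: y_def p_def k')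
    then have "act y p = walk x j i k'"
      using act_act[OF walk_in pq(1)] x ij by simp
    with Q[of k'] leny show ?thesis by (simp add: Q_def k')
  qed
  have pos: "0 \<le> P y (axis p) t" "0 \<le> P y (axis q) t"
    using IH[OF y _ pq(1) up_p] IH[OF y _ pq(2) up_q] leny k0 by auto
  have "enat (Suc k) \<le> m i j"
  proof (cases "m i j")
    case (enat M)
    have M: "2 \<le> M" using m_ge_2[OF ij] enat by (simp add: numeral_eq_enat)
    have asc': "len x < len (act x i)" using asc enat by simp
    have "Suc k \<le> M"
    proof (rule ccontr)
      assume "\<not> Suc k \<le> M"
      then have "Q M" using Q by simp
      \<comment> \<open>Start one step earlier, above \<open>x\<close>. After M + 1 steps around the
        closed 2M-gon the length is \<open>len x - M\<close>, and the remaining M - 1 steps back to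
        \<open>z\<close> cannot climb above \<open>len x\<close>.\<close>
      define z where "z = act x i"
      have z: "z \<in> C" unfolding z_def by (rule act_closed[OF x ij(1)])
      have "walk z i j (Suc M) = walk x j i M"
        unfolding walk_Suc using act_act[OF x ij(1)] by (simp add: z_def)
      then have "len (walk z i j (Suc M)) + M = len x" using \<open>Q M\<close> by (simp add: Q_def)
      moreover have "walk z i j (2 * M) = z"
        unfolding walk_twice by (rule dihedral[OF z ij enat])
      moreover have "2 * M = Suc M + (M - 1)" using M by simp
      moreover have "len (walk z i j (Suc M + (M - 1))) \<le> len (walk z i j (Suc M)) + (M - 1)"
        by (rule len_walk_le[OF z ij(1,2)])
      ultimately have "len z + M \<le> len x + (M - 1)" by simp
      then show False using asc' M by (simp add: z_def)
    qed
    with enat show ?thesis by simp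
  qed simp
  then have "0 \<le> cheb (c i j) (Suc k)" "0 \<le> cheb (c i j) k"
    using m_ge_2[OF ij] order_trans[of "enat k" "enat (Suc k)" "m i j"]
    by (auto intro: cheb_edge_weight_nonneg)
  with pos axis_expansion_along_walk[OF x ij, of k] show ?thesis
    by (simp add: p_def q_def y_def)
qed

text \<open>A chamber other than the base has some descent \<open>j\<close>, necessarily different
  from the ascent \<open>i\<close>; the pair \<open>i\<close>, \<open>j\<close> reduces the claim to
  shorter chambers.\<close>

theorem ascent_nonneg:
  assumes "x \<in> C" "i \<in> {1..n}" "len x < len (act x i)"
  shows "0 \<le> P x (axis i) t"
  using assms
proof (induction "len x" arbitrary: x i rule: less_induct)
  case less
  show ?case
  proof (cases "x = x\<^sub>0")
    case True
    then show ?thesis by (simp add: P_base axis_def)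
  next
    case False
    obtain j where j: "j \<in> {1..n}" "len (act x j) < len x"
      by (rule len_descent[OF less.prems(1) False])
    then have "i \<noteq> j" using less.prems(3) by auto
    then show ?thesis
      using descent_step[OF less.prems(1,2) j(1)] j less by blast
  qed
qed

text \<open>In an infinite dihedral residue every length of walk is admissible, so a descent along
  \<open>j\<close> alone controls the sign of the root for \<open>i\<close>. This is what rules out
  negative eigenvalues at walls that do not meet.\<close>

lemma ascent_nonneg_infinite:
  assumes "x \<in> C" "i \<in> {1..n}" "j \<in> {1..n}" "i \<noteq> j" "m i j = \<infinity>" "len (act x j) < len x"
  shows "0 \<le> P x (axis i) t"
  by (rule descent_step[OF assms(1-4,6)]) (use assms(5) ascent_nonneg in auto)

lemma descent_nonpos:
  assumes "x \<in> C" "i \<in> {1..n}" "len (act x i) < len x"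
  shows "P x (axis i) t \<le> 0"
proof -
  have y: "act x i \<in> C" by (rule act_closed[OF assms(1,2)])
  have "P x = P (act x i) \<circ> reflection i"
    using P_act[OF y assms(2)] act_act[OF assms(1,2)] by simp
  then have "P x (axis i) = (\<lambda>k. - P (act x i) (axis i) k)"
    using lin_scale[OF lin_P[OF y], of "-1" "axis i"] by (simp add: reflection_axis_self)
  moreover have "0 \<le> P (act x i) (axis i) t"
    by (rule ascent_nonneg[OF y assms(2)]) (use assms act_act in simp)
  ultimately show ?thesis by simp
qed

text \<open>The form in which faithfulness is used: any other chamber has a descent, whose root has
  no positive coordinate.\<close>

theorem eq_base_if_positive:
  assumes "x \<in> C" "\<And>i. i \<in> {1..n} \<Longrightarrow> \<exists>t. 0 < P x (axis i) t"
  shows "x = x\<^sub>0"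
proof (rule ccontr)
  assume "x \<noteq> x\<^sub>0"
  then obtain j where "j \<in> {1..n}" "len (act x j) < len x"
    by (rule len_descent[OF assms(1)])
  with descent_nonpos[OF assms(1)] assms(2) show False by (meson not_le)
qed

end

subsection \<open>Groups given by presentations\<close>

lemma word_val_Nil [simp]: "word_val G f [] = \<one>\<^bsub>G\<^esub>"
  by (simp add: word_val_def)

lemma word_val_Cons [simp]: "word_val G f ((i, s) # w) =
   (if s then f i else inv\<^bsub>G\<^esub> (f i)) \<otimes>\<^bsub>G\<^esub> word_val G f w"
  by (simp add: word_val_def)

context group
begin

lemma word_val_closed: "(\<And>i. i \<in> fst ` set w \<Longrightarrow> f i \<in> carrier G) \<Longrightarrow> word_val G f w \<in> carrier G"
proof (induction w)
  case (Cons l w)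
  then show ?case by (cases l) auto
qed simp

lemma word_val_append:
  assumes "\<And>i. i \<in> fst ` set (u @ v) \<Longrightarrow> f i \<in> carrier G"
  shows "word_val G f (u @ v) = word_val G f u \<otimes> word_val G f v"
  using assms
proof (induction u)
  case Nil
  then show ?case using word_val_closed[of v f] by auto
next
  case (Cons l u)
  have "word_val G f u \<in> carrier G" "word_val G f v \<in> carrier G"
    using Cons.prems by (auto intro!: word_val_closed)
  with Cons show ?case by (cases l) (auto simp: m_assoc)
qed

lemma word_val_inverse:
  assumes "\<And>i. i \<in> fst ` set w \<Longrightarrow> f i \<in> carrier G"
  shows "word_val G f (rev (map (\<lambda>(i, s). (i, \<not> s)) w)) = inv (word_val G f w)"
  using assms
proof (induction w)
  case (Cons l w)
  obtain i s where l: "l = (i, s)" by (cases l)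
  have fi: "f i \<in> carrier G" and w: "word_val G f w \<in> carrier G"
    using Cons.prems by (auto simp: l intro!: word_val_closed)
  have "word_val G f (rev (map (\<lambda>(i, s). (i, \<not> s)) (l # w))) =
      word_val G f (rev (map (\<lambda>(i, s). (i, \<not> s)) w)) \<otimes> word_val G f [(i, \<not> s)]"
  proof -
    have "fst ` set (rev (map (\<lambda>(i, s). (i, \<not> s)) w) @ [(i, \<not> s)]) = fst ` set (l # w)"
      by (auto simp: l image_iff split_beta Bex_def)
    then have "word_val G f (rev (map (\<lambda>(i, s). (i, \<not> s)) w) @ [(i, \<not> s)]) =
        word_val G f (rev (map (\<lambda>(i, s). (i, \<not> s)) w)) \<otimes> word_val G f [(i, \<not> s)]"
      using Cons.prems by (intro word_val_append) metis
    then show ?thesis by (simp only: l list.map rev.simps split_conv)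
  qed
  also have "\<dots> = inv (word_val G f w) \<otimes> word_val G f [(i, \<not> s)]"
    using Cons by auto
  also have "\<dots> = inv (word_val G f (l # w))"
    using fi w by (auto simp: l inv_mult_group)
  finally show ?case .
qed simp

lemma word_val_replicate:
  assumes "f i \<in> carrier G"
  shows "word_val G f (replicate k (i, True)) = f i [^] k"
proof (induction k)
  case (Suc k)
  then show ?case using assms nat_pow_Suc2[of "f i" k] by simp
qed simp

lemma word_val_pres_eq:
  assumes "pres_eq I R u v" "\<And>i. f i \<in> carrier G" "\<And>r. r \<in> R \<Longrightarrow> word_val G f r = \<one>"
  shows "word_val G f u = word_val G f v"
  using assms(1)
proof induction
  case (cancel i u s v)
  have "word_val G f [(i, s), (i, \<not> s)] = \<one>" using assms(2)[of i] by auto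
  then show ?case using assms(2) word_val_closed[of _ f]
    by (simp only: word_val_append) simp
next
  case (relator r u v)
  then show ?case using assms(2,3) word_val_closed[of _ f]
    by (simp add: word_val_append)
qed auto

lemma generate_imp_word:
  assumes "\<gamma> ` I \<subseteq> carrier G" "g \<in> generate G (\<gamma> ` I)"
  shows "\<exists>w. fst ` set w \<subseteq> I \<and> word_val G \<gamma> w = g"
  using assms(2)
proof induction
  case one
  show ?case by (intro exI[of _ "[]"]) simp
next
  case (incl h)
  then obtain i where "i \<in> I" "h = \<gamma> i" by auto
  then show ?case using assms(1) by (intro exI[of _ "[(i, True)]"]) auto
next
  case (inv h)
  then obtain i where "i \<in> I" "h = \<gamma> i" by auto
  then show ?case using assms(1) by (intro exI[of _ "[(i, False)]"]) auto
next
  case (eng h1 h2)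
  then obtain u v where "fst ` set u \<subseteq> I" "word_val G \<gamma> u = h1" "fst ` set v \<subseteq> I" "word_val G \<gamma> v = h2"
    by blast
  moreover from this have "word_val G \<gamma> (u @ v) = word_val G \<gamma> u \<otimes> word_val G \<gamma> v"
    using assms(1) by (intro word_val_append) (simp only: set_append image_Un, blast)
  ultimately show ?case by (intro exI[of _ "u @ v"]) (auto simp: image_Un)
qed

end

lemma presented_group_relator:
  assumes "presented_group G I R \<gamma>" "r \<in> R" "fst ` set r \<subseteq> I"
  shows "word_val G \<gamma> r = \<one>\<^bsub>G\<^esub>"
  using assms pres_eq.relator[of r R I "[]" "[]"] by (auto simp: presented_group_def)

text \<open>Von Dyck's theorem. Two words for the same element differ by a word equivalent to the
  empty one, so evaluating any chosen word in \<open>H\<close> is well defined.\<close>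

theorem presented_group_universal:
  assumes pres: "presented_group G I R \<gamma>" and H: "group H"
    and f: "\<And>i. i \<in> I \<Longrightarrow> f i \<in> carrier H"
    and R: "\<And>r. r \<in> R \<Longrightarrow> fst ` set r \<subseteq> I" "\<And>r. r \<in> R \<Longrightarrow> word_val H f r = \<one>\<^bsub>H\<^esub>"
  shows "\<exists>\<phi> \<in> hom G H. \<forall>i\<in>I. \<phi> (\<gamma> i) = f i"
proof -
  interpret G: group G using pres by (simp add: presented_group_def)
  interpret H: group H by fact
  have gen: "\<gamma> ` I \<subseteq> carrier G" "generate G (\<gamma> ` I) = carrier G"
    and eq1: "\<And>w. fst ` set w \<subseteq> I \<Longrightarrow> word_val G \<gamma> w = \<one>\<^bsub>G\<^esub> \<longleftrightarrow> pres_eq I R w []"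
    using pres by (auto simp: presented_group_def)
  \<comment> \<open>\<open>word_val_pres_eq\<close> inducts over words with arbitrary letters, so
    the images are made total.\<close>
  define f' where "f' i = (if i \<in> I then f i else \<one>\<^bsub>H\<^esub>)" for i
  have f'_in: "f' i \<in> carrier H" for i using f by (simp add: f'_def)
  have f'_eq: "word_val H f' w = word_val H f w" if "fst ` set w \<subseteq> I" for w
    using that by (induction w) (auto simp: f'_def)
  have ext: "word_val H f' u = word_val H f' v"
    if uv: "fst ` set u \<subseteq> I" "fst ` set v \<subseteq> I" "word_val G \<gamma> u = word_val G \<gamma> v" for u v
  proof -
    let ?v = "rev (map (\<lambda>(i, s). (i, \<not> s)) v)"
    have in_I: "fst ` set (u @ ?v) \<subseteq> I" using uv by (auto simp: image_Un split_beta image_subset_iff)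
    have \<gamma>_in: "\<gamma> i \<in> carrier G" if "i \<in> fst ` set v" for i
      using that uv(2) gen(1) by blast
    then have c: "word_val G \<gamma> v \<in> carrier G" by (rule G.word_val_closed)
    have "word_val G \<gamma> (u @ ?v) = word_val G \<gamma> u \<otimes>\<^bsub>G\<^esub> word_val G \<gamma> ?v"
      using in_I gen(1) by (intro G.word_val_append) blast
    also have "word_val G \<gamma> ?v = inv\<^bsub>G\<^esub> (word_val G \<gamma> v)"
      by (rule G.word_val_inverse[OF \<gamma>_in])
    finally have "word_val G \<gamma> (u @ ?v) = \<one>\<^bsub>G\<^esub>" using uv c by simp
    then have "pres_eq I R (u @ ?v) []" using eq1[OF in_I] by simp
    then have "word_val H f' (u @ ?v) = word_val H f' []"
      by (rule H.word_val_pres_eq) (use f'_in R f'_eq in auto)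
    then have "word_val H f' u \<otimes>\<^bsub>H\<^esub> inv\<^bsub>H\<^esub> (word_val H f' v) = \<one>\<^bsub>H\<^esub>"
      using f'_in by (simp add: H.word_val_append H.word_val_inverse)
    then show ?thesis
      using H.word_val_closed[of _ f'] f'_in by (metis H.inv_closed H.inv_equality H.inv_inv)
  qed
  define W where "W g = (SOME w. fst ` set w \<subseteq> I \<and> word_val G \<gamma> w = g)" for g
  have W: "fst ` set (W g) \<subseteq> I" "word_val G \<gamma> (W g) = g" if "g \<in> carrier G" for g
    using someI_ex[OF G.generate_imp_word[of \<gamma> I g]] that gen unfolding W_def by auto
  define \<phi> where "\<phi> g = word_val H f' (W g)" for g
  have \<phi>: "\<phi> (word_val G \<gamma> w) = word_val H f' w" if "fst ` set w \<subseteq> I" for w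
  proof -
    have "word_val G \<gamma> w \<in> carrier G" using that gen(1) by (intro G.word_val_closed) blast
    then show ?thesis unfolding \<phi>_def using W that by (intro ext) auto
  qed
  have "\<phi> \<in> hom G H"
  proof (rule homI)
    show "\<phi> g \<in> carrier H" for g unfolding \<phi>_def using f'_in by (intro H.word_val_closed)
    show "\<phi> (g \<otimes>\<^bsub>G\<^esub> h) = \<phi> g \<otimes>\<^bsub>H\<^esub> \<phi> h" if gh: "g \<in> carrier G" "h \<in> carrier G" for g h
    proof -
      have in_I: "fst ` set (W g @ W h) \<subseteq> I" using W gh by (auto simp: image_Un)
      have "word_val G \<gamma> (W g @ W h) = word_val G \<gamma> (W g) \<otimes>\<^bsub>G\<^esub> word_val G \<gamma> (W h)"
        by (rule G.word_val_append) (use in_I gen(1) in blast)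
      then have "g \<otimes>\<^bsub>G\<^esub> h = word_val G \<gamma> (W g @ W h)"
        unfolding W(2)[OF gh(1)] W(2)[OF gh(2)] ..
      then show ?thesis
        using \<phi>[OF in_I] f'_in by (simp add: H.word_val_append \<phi>_def)
    qed
  qed
  moreover have "\<phi> (\<gamma> i) = f i" if "i \<in> I" for i
  proof -
    have "\<gamma> i \<in> carrier G" using that gen(1) by blast
    then show ?thesis using \<phi>[of "[(i, True)]"] that f[OF that] by (simp add: f'_def)
  qed
  ultimately show ?thesis by blast
qed

text \<open>Every element is a power of \<open>c\<close> or such a power times \<open>a\<close>.
  Commuting with \<open>a\<close> makes the power equal to its inverse, hence trivial since
  \<open>M\<close> is odd. If \<open>a\<close> itself were central, then \<open>c\<close> would
  equal its inverse, so \<open>c\<close> = 1 and the group would be generated by \<open>a\<close>,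
  against non-cyclicity.\<close>

lemma (in group) dihedral_center_trivial:
  assumes abc: "a \<in> carrier G" "b \<in> carrier G" "c \<in> carrier G" "a \<otimes> b \<otimes> c = \<one>"
    and sq: "a \<otimes> a = \<one>" "b \<otimes> b = \<one>" and M: "c [^] (M::nat) = \<one>" "odd M"
    and gen: "generate G {a, b, c} = carrier G" and nc: "\<not> cyclic_group G"
    and z: "z \<in> carrier G" "\<And>g. g \<in> carrier G \<Longrightarrow> z \<otimes> g = g \<otimes> z"
  shows "z = \<one>"
proof -
  \<comment> \<open>The inverse of \<open>c\<close>, written with a natural exponent so that the
    normal forms need no integer powers.\<close>
  let ?d = "c [^] (M - 1)"
  have inv_a: "inv a = a" and inv_b: "inv b = b"
    using sq abc by (auto intro: inv_equality)
  have M0: "M \<noteq> 0" using M(2) by (cases M) auto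
  have d_c: "?d \<otimes> c = \<one>" using M(1) M0 abc(3) nat_pow_Suc[of c "M - 1"] by simp
  have inv_c: "inv c = ?d" using d_c abc by (intro inv_equality) auto
  have ab: "a \<otimes> b = ?d"
    using abc inv_c by (metis inv_equality inv_inv m_closed)
  have b: "b = c \<otimes> a"
  proof -
    have "c = inv (a \<otimes> b)" unfolding ab inv_c[symmetric] using abc by simp
    also have "\<dots> = b \<otimes> a" using abc inv_a inv_b by (simp add: inv_mult_group)
    finally have "c \<otimes> a = b \<otimes> (a \<otimes> a)" using abc by (simp add: m_assoc)
    then show ?thesis using sq abc by simp
  qed
  have a_c: "a \<otimes> c = ?d \<otimes> a"
  proof -
    have "a \<otimes> c = a \<otimes> (c \<otimes> a) \<otimes> a" using abc sq by (simp add: m_assoc)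
    then show ?thesis unfolding b[symmetric] ab .
  qed
  have a_ck: "a \<otimes> c [^] k = c [^] ((M - 1) * k) \<otimes> a" for k :: nat
  proof (induction k)
    case (Suc k)
    have "a \<otimes> c [^] Suc k = (a \<otimes> c [^] k) \<otimes> c" using abc by (simp add: m_assoc)
    also have "\<dots> = c [^] ((M - 1) * k) \<otimes> (a \<otimes> c)" using abc Suc by (simp add: m_assoc)
    also have "\<dots> = c [^] ((M - 1) * k) \<otimes> ?d \<otimes> a" using abc by (simp add: a_c m_assoc)
    also have "c [^] ((M - 1) * k) \<otimes> ?d = c [^] ((M - 1) * Suc k)"
      using abc by (simp add: nat_pow_mult add.commute)
    finally show ?case .
  qed (use abc in simp)
  define E where "E = {c [^] k | k :: nat. True} \<union> {c [^] k \<otimes> a | k :: nat. True}"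
  have E1: "c [^] k \<in> E" "c [^] k \<otimes> a \<in> E" for k :: nat by (auto simp: E_def)
  have E_carrier: "E \<subseteq> carrier G" using abc by (auto simp: E_def)
  have mult: "g \<otimes> h \<in> E" if g: "g \<in> E" and h: "h \<in> E" for g h
  proof -
    have 1: "c [^] k \<otimes> c [^] l = c [^] (k + l)" for k l :: nat using abc by (simp add: nat_pow_mult)
    have 2: "c [^] k \<otimes> (c [^] l \<otimes> a) = c [^] (k + l) \<otimes> a" for k l :: nat
      using abc by (simp add: 1 flip: m_assoc)
    have 3: "c [^] k \<otimes> a \<otimes> c [^] l = c [^] (k + (M - 1) * l) \<otimes> a" for k l :: nat
    proof -
      have "c [^] k \<otimes> a \<otimes> c [^] l = c [^] k \<otimes> (a \<otimes> c [^] l)" using abc by (simp add: m_assoc)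
      then show ?thesis by (simp only: a_ck 2)
    qed
    have 4: "c [^] k \<otimes> a \<otimes> (c [^] l \<otimes> a) = c [^] (k + (M - 1) * l)" for k l :: nat
    proof -
      have "c [^] k \<otimes> a \<otimes> (c [^] l \<otimes> a) = c [^] k \<otimes> a \<otimes> c [^] l \<otimes> a" using abc by (simp add: m_assoc)
      also have "\<dots> = c [^] (k + (M - 1) * l) \<otimes> (a \<otimes> a)" unfolding 3 using abc by (simp add: m_assoc)
      finally show ?thesis using sq abc by simp
    qed
    from g h show ?thesis unfolding E_def using E1
      by (auto simp: 1 2 3 4)
  qed
  have "carrier G \<subseteq> E"
  proof
    fix g assume "g \<in> carrier G"
    then have "g \<in> generate G {a, b, c}" using gen by simp
    moreover have "h \<in> E \<and> inv h \<in> E" if "h \<in> {a, b, c}" for h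
      using that inv_a inv_b inv_c b E1(1)[of "M - 1"] E1(2)[of 0] E1(1)[of 1] E1(2)[of 1] abc by auto
    moreover have "\<one> \<in> E" using E1(1)[of 0] by simp
    ultimately show "g \<in> E" by induction (use mult in auto)
  qed
  have odd_trivial: "x = \<one>" if "x \<in> carrier G" "x \<otimes> x = \<one>" "x [^] M = \<one>" for x
  proof -
    obtain r where r: "M = Suc (2 * r)" using M(2) by (elim oddE) simp
    have "x [^] (2 * r) = (x [^] (2::nat)) [^] r" using that(1) by (simp add: nat_pow_pow)
    also have "x [^] (2::nat) = \<one>" using that by (simp add: numeral_2_eq_2)
    finally have "x [^] M = x" using r that(1) by simp
    with that(3) show ?thesis by simp
  qed
  have ck_trivial: "c [^] k = \<one>" if "c [^] ((M - 1) * k) = c [^] k" for k :: nat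
  proof (rule odd_trivial)
    have "c [^] k \<otimes> c [^] k = c [^] ((M - 1) * k) \<otimes> c [^] k" using that by simp
    also have "\<dots> = c [^] (M * k)" using abc M0
      by (cases M) (auto simp: nat_pow_mult add.commute)
    also have "\<dots> = \<one>" using abc M(1) by (simp flip: nat_pow_pow)
    finally show "c [^] k \<otimes> c [^] k = \<one>" .
    show "(c [^] k) [^] M = \<one>" using abc M(1) by (simp add: nat_pow_pow mult.commute[of k] flip: nat_pow_pow[of c M k])
  qed (use abc in simp)
  from z(1) \<open>carrier G \<subseteq> E\<close> have "z \<in> E" by auto
  then consider k :: nat where "z = c [^] k" | k :: nat where "z = c [^] k \<otimes> a" unfolding E_def by auto
  then show ?thesis
  proof cases
    case 1
    have "c [^] ((M - 1) * k) \<otimes> a = c [^] k \<otimes> a" using z(2)[OF abc(1)] 1 a_ck by simp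
    then have "c [^] ((M - 1) * k) = c [^] k" using abc by simp
    from ck_trivial[OF this] 1 show ?thesis by simp
  next
    case 2
    have "c [^] k \<otimes> a \<otimes> a = a \<otimes> (c [^] k \<otimes> a)" using z(2)[OF abc(1)] 2 by simp
    also have "\<dots> = c [^] ((M - 1) * k) \<otimes> a \<otimes> a" using abc by (simp add: a_ck flip: m_assoc)
    finally have "c [^] ((M - 1) * k) = c [^] k" using abc by simp
    from ck_trivial[OF this] 2 have za: "z = a" using abc by simp
    have "c \<otimes> a = ?d \<otimes> a" using z(2)[OF abc(3)] za a_c by simp
    then have "c = ?d" using abc by simp
    then have "c \<otimes> c = \<one>" using d_c by simp
    then have c1: "c = \<one>" using odd_trivial[OF abc(3)] M(1) by simp
    have "E \<subseteq> range (\<lambda>n::int. a [^] n)"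
      using c1 abc int_pow_0[where x = a] int_pow_1[OF abc(1)] unfolding E_def by (auto intro: range_eqI[of _ _ 0] range_eqI[of _ _ 1])
    then have "carrier G = range (\<lambda>n::int. a [^] n)" using \<open>carrier G \<subseteq> E\<close> abc by auto
    then have "cyclic_group G" using cyclic_group abc(1) by blast
    with nc show ?thesis by simp
  qed
qed

subsection \<open>The reflection representation of an orbisphere group\<close>

lemma BijGroup_UNIV_simps:
  "carrier (BijGroup UNIV) = {f. bij f}" "\<one>\<^bsub>BijGroup UNIV\<^esub> = id"
  "bij f \<Longrightarrow> bij g \<Longrightarrow> f \<otimes>\<^bsub>BijGroup UNIV\<^esub> g = f \<circ> g"
  by (auto simp: BijGroup_def Bij_def compose_def fun_eq_iff)

lemma BijGroup_UNIV_pow: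
  assumes "bij f"
  shows "f [^]\<^bsub>BijGroup UNIV\<^esub> (k::nat) = f ^^ k"
proof -
  interpret group "BijGroup UNIV" by (rule group_BijGroup)
  show ?thesis
  proof (induction k)
    case (Suc k)
    have "f [^]\<^bsub>BijGroup UNIV\<^esub> Suc k = f \<otimes>\<^bsub>BijGroup UNIV\<^esub> f [^]\<^bsub>BijGroup UNIV\<^esub> k"
      using assms by (intro nat_pow_Suc2) (simp add: BijGroup_UNIV_simps)
    then show ?case using Suc assms by (simp add: BijGroup_UNIV_simps bij_fn)
  qed (simp add: BijGroup_UNIV_simps)
qed

lemma (in group) conjugate_pow:
  assumes "x \<in> carrier G" "g \<in> carrier G"
  shows "(x \<otimes> g \<otimes> inv x) [^] (k::nat) = x \<otimes> g [^] k \<otimes> inv x"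
proof (induction k)
  case (Suc k)
  have "(x \<otimes> g \<otimes> inv x) [^] Suc k = x \<otimes> g [^] k \<otimes> (inv x \<otimes> x) \<otimes> g \<otimes> inv x"
    unfolding nat_pow_Suc Suc using assms by (simp only: m_assoc m_closed inv_closed nat_pow_closed)
  also have "\<dots> = x \<otimes> (g [^] k \<otimes> g) \<otimes> inv x"
    using assms by (simp add: m_assoc)
  finally show ?case by simp
qed (use assms in simp)

context orbisphere_group
begin

lemma \<gamma>_closed: "i \<in> {1..n} \<Longrightarrow> \<gamma> i \<in> carrier G"
  using presentation unfolding presented_group_def by blast

lemma generate_\<gamma>: "generate G (\<gamma> ` {1..n}) = carrier G"
  using presentation unfolding presented_group_def by blast

lemma \<gamma>_pow_order:
  assumes "i \<in> {1..n}" "e i = enat k"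
  shows "\<gamma> i [^] k = \<one>"
proof -
  have "word_val G \<gamma> (replicate k (i, True)) = \<one>"
    by (rule presented_group_relator[OF presentation])
      (use assms in \<open>auto simp: orbisphere_relators_def\<close>)
  then show ?thesis using \<gamma>_closed[OF assms(1)] by (simp add: word_val_replicate)
qed

primrec partial_prod :: "nat \<Rightarrow> 'a" where
  "partial_prod 0 = \<one>"
| "partial_prod (Suc k) = partial_prod k \<otimes> \<gamma> (Suc k)"

lemma partial_prod_closed: "k \<le> n \<Longrightarrow> partial_prod k \<in> carrier G"
  by (induction k) (auto simp: \<gamma>_closed)

lemma word_val_partial_prod:
  "k \<le> n \<Longrightarrow> word_val G \<gamma> (map (\<lambda>i. (i, True)) [1..<Suc k]) = partial_prod k"
proof (induction k)
  case (Suc k)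
  have "word_val G \<gamma> (map (\<lambda>i. (i, True)) [1..<Suc k] @ [(Suc k, True)]) =
      word_val G \<gamma> (map (\<lambda>i. (i, True)) [1..<Suc k]) \<otimes> word_val G \<gamma> [(Suc k, True)]"
    by (rule word_val_append) (use Suc.prems \<gamma>_closed in auto)
  with Suc \<gamma>_closed[of "Suc k"] show ?case by simp
qed simp

lemma partial_prod_n: "partial_prod n = \<one>"
proof -
  have "word_val G \<gamma> (map (\<lambda>i. (i, True)) [1..<Suc n]) = \<one>"
    by (rule presented_group_relator[OF presentation]) (auto simp: orbisphere_relators_def)
  then show ?thesis unfolding word_val_partial_prod[OF order_refl] .
qed

lemma universal:
  assumes "group H" "\<And>i. i \<in> {1..n} \<Longrightarrow> f i \<in> carrier H"
    and "\<And>i k. i \<in> {1..n} \<Longrightarrow> e i = enat k \<Longrightarrow> f i [^]\<^bsub>H\<^esub> k = \<one>\<^bsub>H\<^esub>"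
    and "word_val H f (map (\<lambda>i. (i, True)) [1..<Suc n]) = \<one>\<^bsub>H\<^esub>"
  shows "\<exists>\<phi> \<in> hom G H. \<forall>i\<in>{1..n}. \<phi> (\<gamma> i) = f i"
proof (rule presented_group_universal[OF presentation assms(1,2)])
  interpret H: group H by fact
  fix r assume "r \<in> orbisphere_relators n e"
  then consider i k where "r = replicate k (i, True)" "i \<in> {1..n}" "e i = enat k"
    | "r = map (\<lambda>i. (i, True)) [1..<Suc n]"
    unfolding orbisphere_relators_def by blast
  then have "fst ` set r \<subseteq> {1..n} \<and> word_val H f r = \<one>\<^bsub>H\<^esub>"
  proof cases
    case 1
    then show ?thesis using assms(2,3) H.word_val_replicate[of f i k] by auto
  next
    case 2
    then show ?thesis using assms(4) by (auto simp: image_image)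
  qed
  then show "fst ` set r \<subseteq> {1..n}" "word_val H f r = \<one>\<^bsub>H\<^esub>" by simp_all
qed

text \<open>Used contrapositively: a non-cyclic group has at least three generators, enough for a
  polygon of mirrors.\<close>

lemma cyclic_if_le_2:
  assumes "n \<le> 2"
  shows "cyclic_group G"
proof -
  define x where "x = (if n = 0 then \<one> else \<gamma> 1)"
  have x: "x \<in> carrier G" using \<gamma>_closed by (simp add: x_def)
  have sub: "subgroup (generate G {x}) G" using x by (intro generate_is_subgroup) auto
  have "\<gamma> i \<in> generate G {x}" if i: "i \<in> {1..n}" for i
  proof -
    consider "i = 1" | "i = 2" "n = 2" using i assms by fastforce
    then show ?thesis
    proof cases
      case 1
      then show ?thesis using i by (auto simp: x_def intro: generate.incl)
    next
      case 2
      then have "\<gamma> 1 \<otimes> \<gamma> 2 = \<one>"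
        using partial_prod_n \<gamma>_closed[of 1] by (simp add: numeral_2_eq_2)
      then have "\<gamma> 2 = inv (\<gamma> 1)"
        using \<gamma>_closed[of 1] \<gamma>_closed[of 2] 2 inv_equality[of "\<gamma> 1" "\<gamma> 2"] inv_inv[of "\<gamma> 2"] by simp
      then show ?thesis using 2 by (auto simp: x_def intro: generate.inv)
    qed
  qed
  then have "generate G (\<gamma> ` {1..n}) \<subseteq> generate G {x}"
    by (intro generate_subgroup_incl[OF _ sub]) auto
  then have "carrier G = generate G {x}"
    using generate_\<gamma> generate_incl[of "{x}"] x by auto
  then show ?thesis
    using x cyclic_group generate_pow[OF x] by blast
qed

end

section \<open>The polygon of mirrors and its rotations\<close>

locale orbisphere_group_ge3 = orbisphere_group G n e \<gamma>
  for G :: "('a, 'c) monoid_scheme" (structure) and n e \<gamma> +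
  assumes n_ge_3: "3 \<le> n"
begin

definition nxt :: "nat \<Rightarrow> nat" where "nxt i = (if i = n then 1 else Suc i)"

text \<open>Sides \<open>i\<close> and \<open>nxt i\<close> of the polygon meet at a corner of order
  \<open>e i\<close>; sides without a common corner get no relation. With at least three sides the
  first two clauses cannot both apply.\<close>

definition cox :: "nat \<Rightarrow> nat \<Rightarrow> enat" where
  "cox i j = (if j = nxt i then e i else if i = nxt j then e j else \<infinity>)"

lemma nxt_in: "i \<in> {1..n} \<Longrightarrow> nxt i \<in> {1..n}"
  using n_ge_3 by (auto simp: nxt_def)

lemma nxt_neq: "nxt i \<noteq> i" "nxt (nxt i) \<noteq> i"
  using n_ge_3 by (auto simp: nxt_def)

lemma cox_nxt: "cox i (nxt i) = e i"
  by (simp add: cox_def)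

end

sublocale orbisphere_group_ge3 \<subseteq> coxeter_matrix n cox
proof
  show "cox i j = cox j i" for i j
    using nxt_neq(2)[of i] nxt_neq(2)[of j] by (auto simp: cox_def)
  show "2 \<le> cox i j" if "i \<in> {1..n}" "j \<in> {1..n}" "i \<noteq> j" for i j
    using that orders by (auto simp: cox_def)
qed

context orbisphere_group_ge3
begin

lemma bij_reflection: "bij (reflection i)"
  by (rule o_bij[of "reflection i"]) auto

definition rot :: "nat \<Rightarrow> (nat \<Rightarrow> real) \<Rightarrow> nat \<Rightarrow> real" where
  "rot i = reflection i \<circ> reflection (nxt i)"

lemma bij_rot: "bij (rot i)"
  unfolding rot_def by (intro bij_comp bij_reflection)

text \<open>Neighbouring reflections cancel in the product. The bound k < n stops before the last
  rotation, whose second mirror is side 1 again and which closes the product to the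
  identity.\<close>

lemma rot_product:
  "k < n \<Longrightarrow> word_val (BijGroup UNIV) rot (map (\<lambda>i. (i, True)) [1..<Suc k]) =
     reflection 1 \<circ> reflection (Suc k)"
proof (induction k)
  case 0
  then show ?case by (simp add: BijGroup_UNIV_simps id_def)
next
  case (Suc k)
  interpret B: group "BijGroup UNIV" by (rule group_BijGroup)
  have "word_val (BijGroup UNIV) rot (map (\<lambda>i. (i, True)) [1..<Suc k] @ [(Suc k, True)]) =
      word_val (BijGroup UNIV) rot (map (\<lambda>i. (i, True)) [1..<Suc k]) \<otimes>\<^bsub>BijGroup UNIV\<^esub>
      word_val (BijGroup UNIV) rot [(Suc k, True)]"
    by (rule B.word_val_append) (simp add: BijGroup_UNIV_simps bij_rot)
  also have "word_val (BijGroup UNIV) rot [(Suc k, True)] = rot (Suc k)"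
    by (simp add: BijGroup_UNIV_simps bij_rot)
  also have "word_val (BijGroup UNIV) rot (map (\<lambda>i. (i, True)) [1..<Suc k]) =
      reflection 1 \<circ> reflection (Suc k)" using Suc by (simp add: comp_def)
  also have "(reflection 1 \<circ> reflection (Suc k)) \<otimes>\<^bsub>BijGroup UNIV\<^esub> rot (Suc k) =
      reflection 1 \<circ> reflection (Suc k) \<circ> rot (Suc k)"
    by (intro BijGroup_UNIV_simps bij_rot bij_comp bij_reflection)
  also have "\<dots> = reflection 1 \<circ> reflection (Suc (Suc k))"
    using Suc.prems by (simp add: rot_def nxt_def fun_eq_iff)
  finally show ?case by (simp add: comp_def)
qed

lemma representation:
  "\<exists>\<rho> \<in> hom G (BijGroup UNIV). \<forall>i\<in>{1..n}. \<rho> (\<gamma> i) = rot i"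
proof (rule universal[OF group_BijGroup])
  interpret B: group "BijGroup UNIV" by (rule group_BijGroup)
  show "rot i \<in> carrier (BijGroup UNIV)" for i
    by (simp add: BijGroup_UNIV_simps bij_rot)
  show "rot i [^]\<^bsub>BijGroup UNIV\<^esub> k = \<one>\<^bsub>BijGroup UNIV\<^esub>" if "i \<in> {1..n}" "e i = enat k" for i k
    using rotation_order[of i "nxt i" k] that nxt_in nxt_neq(1)[of i] cox_nxt[of i]
    by (simp add: BijGroup_UNIV_simps BijGroup_UNIV_pow bij_rot rot_def bij_comp bij_reflection)
  obtain k where k: "n = Suc k" using n_ge_3 by (cases n) auto
  have "word_val (BijGroup UNIV) rot (map (\<lambda>i. (i, True)) [1..<Suc k] @ [(n, True)]) =
      word_val (BijGroup UNIV) rot (map (\<lambda>i. (i, True)) [1..<Suc k]) \<otimes>\<^bsub>BijGroup UNIV\<^esub>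
      word_val (BijGroup UNIV) rot [(n, True)]"
    by (rule B.word_val_append) (simp add: BijGroup_UNIV_simps bij_rot)
  also have "word_val (BijGroup UNIV) rot [(n, True)] = rot n"
    by (simp add: BijGroup_UNIV_simps bij_rot)
  also have "word_val (BijGroup UNIV) rot (map (\<lambda>i. (i, True)) [1..<Suc k]) =
      reflection 1 \<circ> reflection n" using rot_product[of k] k by simp
  also have "(reflection 1 \<circ> reflection n) \<otimes>\<^bsub>BijGroup UNIV\<^esub> rot n =
      reflection 1 \<circ> reflection n \<circ> rot n"
    by (intro BijGroup_UNIV_simps bij_rot bij_comp bij_reflection)
  also have "\<dots> = id" by (simp add: rot_def nxt_def fun_eq_iff)
  finally show "word_val (BijGroup UNIV) rot (map (\<lambda>i. (i, True)) [1..<Suc n]) = \<one>\<^bsub>BijGroup UNIV\<^esub>"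
    by (simp add: BijGroup_UNIV_simps k)
qed

definition \<rho> :: "'a \<Rightarrow> (nat \<Rightarrow> real) \<Rightarrow> nat \<Rightarrow> real" where
  "\<rho> = (SOME \<rho>. \<rho> \<in> hom G (BijGroup UNIV) \<and> (\<forall>i\<in>{1..n}. \<rho> (\<gamma> i) = rot i))"

lemma \<rho>_hom: "\<rho> \<in> hom G (BijGroup UNIV)" and \<rho>_\<gamma>: "i \<in> {1..n} \<Longrightarrow> \<rho> (\<gamma> i) = rot i"
proof -
  have "\<exists>\<rho>. \<rho> \<in> hom G (BijGroup UNIV) \<and> (\<forall>i\<in>{1..n}. \<rho> (\<gamma> i) = rot i)"
    using representation by blast
  from someI_ex[OF this, folded \<rho>_def]
  show "\<rho> \<in> hom G (BijGroup UNIV)" "i \<in> {1..n} \<Longrightarrow> \<rho> (\<gamma> i) = rot i" by auto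
qed

lemma group_hom_\<rho>: "group_hom G (BijGroup UNIV) \<rho>"
  by (rule group_hom.intro[OF is_group group_BijGroup group_hom_axioms.intro[OF \<rho>_hom]])

lemma bij_\<rho>: "g \<in> carrier G \<Longrightarrow> bij (\<rho> g)"
  using hom_in_carrier[OF \<rho>_hom] unfolding BijGroup_UNIV_simps(1) by blast

lemma \<rho>_mult: "g \<in> carrier G \<Longrightarrow> h \<in> carrier G \<Longrightarrow> \<rho> (g \<otimes> h) = \<rho> g \<circ> \<rho> h"
  unfolding BijGroup_UNIV_simps(3)[OF bij_\<rho> bij_\<rho>, symmetric] by (rule hom_mult[OF \<rho>_hom])

lemma \<rho>_one: "\<rho> \<one> = id"
  unfolding BijGroup_UNIV_simps(2)[symmetric] by (rule group_hom.hom_one[OF group_hom_\<rho>])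

lemma \<rho>_inv_eq:
  assumes "g \<in> carrier G" "\<rho> g \<circ> A = id"
  shows "\<rho> (inv g) = A"
proof -
  have "\<rho> (inv g) \<circ> \<rho> g = id"
    unfolding \<rho>_mult[OF inv_closed[OF assms(1)] assms(1), symmetric] l_inv[OF assms(1)] by (rule \<rho>_one)
  then have "\<rho> (inv g) \<circ> (\<rho> g \<circ> A) = A" unfolding comp_assoc[symmetric] by simp
  then show ?thesis by (simp add: assms(2))
qed

lemma lin_\<rho>:
  assumes "g \<in> carrier G"
  shows "lin (\<rho> g)"
proof -
  have g: "g \<in> generate G (\<gamma> ` {1..n})" using assms generate_\<gamma> by simp
  have carr: "\<gamma> ` {1..n} \<subseteq> carrier G" using \<gamma>_closed by auto
  from g show ?thesis
  proof induction
    case one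
    then show ?case using \<rho>_one lin_id by metis
  next
    case (incl h)
    then obtain i where i: "i \<in> {1..n}" "h = \<gamma> i" by auto
    show ?case unfolding i(2) \<rho>_\<gamma>[OF i(1)] rot_def by (rule lin_comp[OF lin_reflection lin_reflection])
  next
    case (inv h)
    then obtain i where i: "i \<in> {1..n}" "h = \<gamma> i" by auto
    have "\<rho> (inv (\<gamma> i)) = reflection (nxt i) \<circ> reflection i"
      by (rule \<rho>_inv_eq[OF \<gamma>_closed[OF i(1)]]) (simp add: \<rho>_\<gamma>[OF i(1)] rot_def fun_eq_iff)
    then show ?case using lin_comp[OF lin_reflection lin_reflection] i(2) by metis
  next
    case (eng h1 h2)
    have "\<rho> (h1 \<otimes> h2) = \<rho> h1 \<circ> \<rho> h2"
      by (intro \<rho>_mult generate_in_carrier[OF carr]) (fact eng.hyps)+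
    then show ?case using lin_comp[OF eng.IH] by metis
  qed
qed

definition prefix_elt :: "nat \<Rightarrow> 'a" where "prefix_elt i = partial_prod (i - 1)"

lemma prefix_elt_closed: "i \<in> {1..n} \<Longrightarrow> prefix_elt i \<in> carrier G"
  unfolding prefix_elt_def by (rule partial_prod_closed) auto

text \<open>At \<open>i = n\<close> this is the relation that the product of all generators is
  1.\<close>

lemma prefix_elt_nxt:
  assumes "i \<in> {1..n}"
  shows "prefix_elt (nxt i) = prefix_elt i \<otimes> \<gamma> i"
proof -
  have "prefix_elt i \<otimes> \<gamma> i = partial_prod i" using assms by (cases i) (auto simp: prefix_elt_def)
  then show ?thesis using partial_prod_n by (auto simp: nxt_def prefix_elt_def)
qed

lemma inv_pfx_pfx_nxt: "i \<in> {1..n} \<Longrightarrow> inv (prefix_elt i) \<otimes> prefix_elt (nxt i) = \<gamma> i"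
  using prefix_elt_closed[of i] \<gamma>_closed[of i] by (simp add: prefix_elt_nxt flip: m_assoc)

lemma \<rho>_pfx: "i \<in> {1..n} \<Longrightarrow> \<rho> (prefix_elt i) = reflection 1 \<circ> reflection i"
proof (induction i)
  case (Suc i)
  show ?case
  proof (cases "i = 0")
    case True
    then show ?thesis using \<rho>_one unfolding prefix_elt_def by (simp add: comp_def id_def)
  next
    case False
    then have i: "i \<in> {1..n}" and nx: "nxt i = Suc i" using Suc.prems by (auto simp: nxt_def)
    have "\<rho> (prefix_elt (Suc i)) = \<rho> (prefix_elt i) \<circ> \<rho> (\<gamma> i)"
      using prefix_elt_nxt[OF i] \<rho>_mult[OF prefix_elt_closed[OF i] \<gamma>_closed[OF i]] by (simp add: nx)
    also have "\<dots> = reflection 1 \<circ> reflection (Suc i)"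
      using Suc.IH[OF i] by (simp add: \<rho>_\<gamma>[OF i] rot_def nx fun_eq_iff)
    finally show ?thesis by (simp add: comp_def)
  qed
qed simp

lemma \<rho>_inv_pfx: "i \<in> {1..n} \<Longrightarrow> \<rho> (inv (prefix_elt i)) = reflection i \<circ> reflection 1"
  by (rule \<rho>_inv_eq) (auto simp: prefix_elt_closed \<rho>_pfx fun_eq_iff)

text \<open>The chambers are the elements of the reflection group, written as \<open>g\<close> (for \<open>(g, False)\<close>) or as
  \<open>g r\<^sub>1\<close> (for \<open>(g, True)\<close>), where \<open>r\<^sub>1 r\<^sub>i\<close> is the element \<open>prefix_elt i\<close> of \<open>G\<close>. Right multiplication by
  \<open>r\<^sub>i\<close> can thus be described inside \<open>G\<close>, without constructing the reflection group.\<close>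

definition chamber_act :: "'a \<times> bool \<Rightarrow> nat \<Rightarrow> 'a \<times> bool" where
  "chamber_act x i = (if snd x then (fst x \<otimes> prefix_elt i, False) else (fst x \<otimes> inv (prefix_elt i), True))"

definition chamber_map :: "'a \<times> bool \<Rightarrow> (nat \<Rightarrow> real) \<Rightarrow> nat \<Rightarrow> real" where
  "chamber_map x = (if snd x then \<rho> (fst x) \<circ> reflection 1 else \<rho> (fst x))"

lemma chamber_act_simps: "chamber_act (g, False) i = (g \<otimes> inv (prefix_elt i), True)" "chamber_act (g, True) i = (g \<otimes> prefix_elt i, False)"
  by (simp_all add: chamber_act_def)

lemma inv_pfx_pfx_pow:
  assumes "i \<in> {1..n}" "j \<in> {1..n}" "cox i j = enat k"
  shows "(inv (prefix_elt i) \<otimes> prefix_elt j) [^] k = \<one>"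
proof (cases "j = nxt i")
  case True
  then show ?thesis using assms inv_pfx_pfx_nxt[of i] \<gamma>_pow_order[of i k] by (simp add: cox_def)
next
  case False
  then have i: "i = nxt j" and ej: "e j = enat k" using assms(3) by (auto simp: cox_def split: if_splits)
  have "inv (prefix_elt i) \<otimes> prefix_elt j = inv (\<gamma> j)"
    unfolding i inv_pfx_pfx_nxt[OF assms(2), symmetric]
    using prefix_elt_closed[OF assms(2)] prefix_elt_closed[OF nxt_in[OF assms(2)]] by (simp add: inv_mult_group)
  then show ?thesis using \<gamma>_pow_order[OF assms(2) ej] \<gamma>_closed[OF assms(2)] by (simp add: nat_pow_inv)
qed

text \<open>Two crossings multiply \<open>g\<close> on the right by a fixed \<open>u\<close>. On
  unreflected chambers it stands for the rotation \<open>r\<^sub>i r\<^sub>j\<close>, on reflected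
  ones for its conjugate by \<open>r\<^sub>1\<close>, and both have order dividing
  \<open>k\<close>.\<close>

lemma chamber_act_dihedral:
  assumes x: "g \<in> carrier G" and ij: "i \<in> {1..n}" "j \<in> {1..n}" and m: "cox i j = enat k"
  shows "((\<lambda>y. chamber_act (chamber_act y i) j) ^^ k) (g, s) = (g, s)"
proof -
  have ai: "prefix_elt i \<in> carrier G" and aj: "prefix_elt j \<in> carrier G" using ij prefix_elt_closed by auto
  define u where "u = (if s then prefix_elt i \<otimes> inv (prefix_elt j) else inv (prefix_elt i) \<otimes> prefix_elt j)"
  have u: "u \<in> carrier G" using ai aj by (simp add: u_def)
  have "((\<lambda>y. chamber_act (chamber_act y i) j) ^^ l) (g, s) = (g \<otimes> u [^] l, s)" for l
  proof (induction l)
    case (Suc l)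
    then show ?case using x u ai aj by (cases s) (simp_all add: chamber_act_simps u_def m_assoc)
  qed (use x in simp)
  moreover have "u [^] k = \<one>"
  proof (cases s)
    case True
    have "u = prefix_elt i \<otimes> (inv (prefix_elt j) \<otimes> prefix_elt i) \<otimes> inv (prefix_elt i)"
      using True ai aj by (simp add: u_def m_assoc)
    moreover have "(inv (prefix_elt j) \<otimes> prefix_elt i) [^] k = \<one>"
      by (rule inv_pfx_pfx_pow) (use ij m m_sym in auto)
    ultimately show ?thesis using ai aj by (simp add: conjugate_pow)
  next
    case False
    then show ?thesis using inv_pfx_pfx_pow[OF ij m] by (simp add: u_def)
  qed
  ultimately show ?thesis using x by simp
qed

text \<open>Crossing \<open>i\<close> and then \<open>nxt i\<close> multiplies by
  \<open>\<gamma> i\<close>, and the opposite order by its inverse. Quantifying over the starting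
  point \<open>h\<close> lets the words be concatenated.\<close>

lemma chamber_act_reach:
  assumes "g \<in> carrier G"
  shows "\<forall>h\<in>carrier G. \<exists>w. set w \<subseteq> {1..n} \<and> foldl chamber_act (h, False) w = (h \<otimes> g, False)"
proof -
  have g: "g \<in> generate G (\<gamma> ` {1..n})" using assms generate_\<gamma> by simp
  have carr: "\<gamma> ` {1..n} \<subseteq> carrier G" using \<gamma>_closed by auto
  from g show ?thesis
  proof induction
    case one
    show ?case by (auto intro!: exI[of _ "[]"])
  next
    case (incl g)
    then obtain i where i: "i \<in> {1..n}" "g = \<gamma> i" by auto
    show ?case
    proof
      fix h assume h: "h \<in> carrier G"
      have "foldl chamber_act (h, False) [i, nxt i] = (h \<otimes> g, False)"
        using h i prefix_elt_closed[of i] prefix_elt_closed[of "nxt i"] nxt_in[of i] inv_pfx_pfx_nxt[of i]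
        by (simp add: chamber_act_simps m_assoc)
      then show "\<exists>w. set w \<subseteq> {1..n} \<and> foldl chamber_act (h, False) w = (h \<otimes> g, False)"
        using i nxt_in[of i] by (intro exI[of _ "[i, nxt i]"]) auto
    qed
  next
    case (inv g)
    then obtain i where i: "i \<in> {1..n}" "g = \<gamma> i" by auto
    have inv_\<gamma>: "inv (prefix_elt (nxt i)) \<otimes> prefix_elt i = inv (\<gamma> i)"
      unfolding inv_pfx_pfx_nxt[OF i(1), symmetric]
      using prefix_elt_closed[OF i(1)] prefix_elt_closed[OF nxt_in[OF i(1)]] by (simp add: inv_mult_group)
    show ?case
    proof
      fix h assume h: "h \<in> carrier G"
      have "foldl chamber_act (h, False) [nxt i, i] = (h \<otimes> inv g, False)"
        using h i prefix_elt_closed[of i] prefix_elt_closed[of "nxt i"] nxt_in[of i] inv_\<gamma>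
        by (simp add: chamber_act_simps m_assoc)
      then show "\<exists>w. set w \<subseteq> {1..n} \<and> foldl chamber_act (h, False) w = (h \<otimes> inv g, False)"
        using i nxt_in[of i] by (intro exI[of _ "[nxt i, i]"]) auto
    qed
  next
    case (eng g1 g2)
    show ?case
    proof
      fix h assume h: "h \<in> carrier G"
      have g12: "g1 \<in> carrier G" "g2 \<in> carrier G" using eng.hyps generate_in_carrier[OF carr] by auto
      obtain w1 where w1: "set w1 \<subseteq> {1..n}" "foldl chamber_act (h, False) w1 = (h \<otimes> g1, False)"
        using eng.IH(1) h by blast
      obtain w2 where w2: "set w2 \<subseteq> {1..n}" "foldl chamber_act (h \<otimes> g1, False) w2 = (h \<otimes> g1 \<otimes> g2, False)"
        using eng.IH(2) h g12 by blast
      show "\<exists>w. set w \<subseteq> {1..n} \<and> foldl chamber_act (h, False) w = (h \<otimes> (g1 \<otimes> g2), False)"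
        using w1 w2 h g12 by (intro exI[of _ "w1 @ w2"]) (simp add: m_assoc)
    qed
  qed
qed

sublocale chamber_system n cox "carrier G \<times> UNIV" "(\<one>, False)" chamber_act snd chamber_map
proof
  have one_in: "1 \<in> {1..n}" using n_ge_3 by simp
  fix x i assume x: "x \<in> carrier G \<times> (UNIV::bool set)"
  obtain g s where gs: "x = (g, s)" "g \<in> carrier G" using x by auto
  show "\<exists>w. set w \<subseteq> {1..n} \<and> foldl chamber_act (\<one>, False) w = x"
  proof -
    obtain w where w: "set w \<subseteq> {1..n}" "foldl chamber_act (\<one>, False) w = (g, False)"
      using bspec[OF chamber_act_reach[OF gs(2)] one_closed] unfolding l_one[OF gs(2)] by blast
    have "chamber_act (g, False) 1 = (g, True)" using gs(2) by (simp add: chamber_act_simps prefix_elt_def)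
    then have "foldl chamber_act (\<one>, False) (w @ [1]) = (g, True)" "set (w @ [1]) \<subseteq> {1..n}"
      using w one_in by auto
    then show ?thesis using w unfolding gs(1) by (cases s) (simp_all only:, blast+)
  qed
  show "lin (chamber_map x)"
    using lin_\<rho>[OF gs(2)] lin_comp[OF lin_\<rho>[OF gs(2)] lin_reflection]
    unfolding chamber_map_def gs(1) by (cases s) (simp_all only: fst_conv snd_conv if_True if_False)
  assume i: "i \<in> {1..n}"
  show "chamber_act x i \<in> carrier G \<times> (UNIV::bool set)" "snd (chamber_act x i) = (\<not> snd x)"
    "chamber_act (chamber_act x i) i = x"
    using gs(2) prefix_elt_closed[OF i] unfolding gs(1) by (cases s; simp add: chamber_act_simps m_assoc)+
  show "chamber_map (chamber_act x i) = chamber_map x \<circ> reflection i"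
    using gs(2) prefix_elt_closed[OF i] unfolding gs(1)
    by (cases s) (simp_all add: chamber_act_simps chamber_map_def \<rho>_mult \<rho>_pfx[OF i] \<rho>_inv_pfx[OF i] fun_eq_iff)
next
  show "((\<lambda>y. chamber_act (chamber_act y i) j) ^^ k) x = x"
    if "x \<in> carrier G \<times> (UNIV::bool set)" "i \<in> {1..n}" "j \<in> {1..n}" "i \<noteq> j" "cox i j = enat k" for x i j k
    using that(1) chamber_act_dihedral[of "fst x" i j k "snd x", OF _ that(2,3,5)]
    by (simp add: mem_Times_iff)
qed (auto simp: chamber_map_def \<rho>_one)

text \<open>The relators give one direction; for the other, the rotation \<open>rot i\<close>
  already has order \<open>e i\<close> on the single vector \<open>axis i\<close>.\<close>

theorem \<gamma>_pow_eq_one_iff: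
  assumes "i \<in> {1..n}"
  shows "\<gamma> i [^] (k::nat) = \<one> \<longleftrightarrow> (if e i = \<infinity> then k = 0 else the_enat (e i) dvd k)"
proof
  assume "\<gamma> i [^] k = \<one>"
  then have "rot i [^]\<^bsub>BijGroup UNIV\<^esub> k = id"
    using group_hom.hom_nat_pow[OF group_hom_\<rho> \<gamma>_closed[OF assms], of k]
    by (simp add: \<rho>_\<gamma>[OF assms] \<rho>_one)
  then have "(rot i ^^ k) (axis i) = axis i" by (simp add: BijGroup_UNIV_pow bij_rot)
  then show "if e i = \<infinity> then k = 0 else the_enat (e i) dvd k"
    using rotation_fixes_axis_imp_dvd[OF nxt_neq(1)[symmetric] assms nxt_in[OF assms], of k]
    unfolding rot_def cox_nxt by blast
next
  assume dvd: "if e i = \<infinity> then k = 0 else the_enat (e i) dvd k"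
  show "\<gamma> i [^] k = \<one>"
  proof (cases "e i")
    case (enat l)
    then obtain r where "k = l * r" using dvd by auto
    then show ?thesis
      using \<gamma>_pow_order[OF assms enat] nat_pow_pow[OF \<gamma>_closed[OF assms], of l r] by simp
  qed (use dvd in simp)
qed

lemma \<gamma>_neq_one: "i \<in> {1..n} \<Longrightarrow> \<gamma> i \<noteq> \<one>"
  using \<gamma>_pow_eq_one_iff[of i 1] orders[of i] \<gamma>_closed[of i]
  by (cases "e i") (auto simp: numeral_eq_enat)

end

subsection \<open>The centre of an orbisphere group\<close>

context chamber_system
begin

lemma P_act_axis_self:
  assumes "x \<in> C" "i \<in> {1..n}"
  shows "P (act x i) (axis i) = (\<lambda>t. - P x (axis i) t)"
  unfolding P_act[OF assms] using lin_scale[OF lin_P[OF assms(1)], of "-1" "axis i"]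
  by (simp add: reflection_axis_self)

lemma P_act_axis:
  assumes "x \<in> C" "i \<in> {1..n}" "j \<in> {1..n}" "i \<noteq> j"
  shows "P (act x i) (axis j) = (\<lambda>t. P x (axis j) t + 2 * c i j * P x (axis i) t)"
  unfolding P_act[OF assms(1,2)]
  using linD[OF lin_P[OF assms(1)], of 1 "axis j" "2 * c i j" "axis i"]
  by (simp add: reflection_axis[OF assms(4,3)])

text \<open>The determinant of \<open>P x\<close> on the coordinates 1, 2, 3, whose columns are the
  images of the three simple roots.\<close>

definition det3 :: "'x \<Rightarrow> real" where
  "det3 x =
     P x (axis 1) 1 * (P x (axis 2) 2 * P x (axis 3) 3 - P x (axis 2) 3 * P x (axis 3) 2) -
     P x (axis 2) 1 * (P x (axis 1) 2 * P x (axis 3) 3 - P x (axis 1) 3 * P x (axis 3) 2) +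
     P x (axis 3) 1 * (P x (axis 1) 2 * P x (axis 2) 3 - P x (axis 1) 3 * P x (axis 2) 2)"

text \<open>Crossing wall \<open>i\<close> negates column \<open>i\<close> and adds multiples of it
  to the other two.\<close>

lemma det3_act:
  assumes "n = 3" "x \<in> C" "i \<in> {1..n}"
  shows "det3 (act x i) = - det3 x"
proof -
  have self: "P (act x i) (axis i) t = - P x (axis i) t" for t
    by (simp add: P_act_axis_self[OF assms(2,3)])
  have other: "P (act x i) (axis j) t = P x (axis j) t + 2 * c i j * P x (axis i) t"
    if "j \<in> {1..n}" "i \<noteq> j" for j t
    by (simp add: P_act_axis[OF assms(2,3) that])
  consider "i = 1" | "i = 2" | "i = 3" using assms(1,3) by fastforce
  then show ?thesis
  proof cases
    case 1
    show ?thesis unfolding det3_def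
      using self other[of 2] other[of 3] assms(1) by (simp add: 1 algebra_simps)
  next
    case 2
    show ?thesis unfolding det3_def
      using self other[of 1] other[of 3] assms(1) by (simp add: 2 algebra_simps)
  next
    case 3
    show ?thesis unfolding det3_def
      using self other[of 1] other[of 2] assms(1) by (simp add: 3 algebra_simps)
  qed
qed

lemma det3_eq:
  assumes "n = 3" "x \<in> C"
  shows "det3 x = (if par x = par x\<^sub>0 then 1 else -1)"
proof -
  have "set w \<subseteq> {1..n} \<Longrightarrow>
      det3 (foldl act x\<^sub>0 w) = (if par (foldl act x\<^sub>0 w) = par x\<^sub>0 then 1 else -1)" for w
  proof (induction w rule: rev_induct)
    case Nil
    show ?case by (simp add: det3_def P_base axis_def)
  next
    case (snoc i w)
    then have "foldl act x\<^sub>0 w \<in> C" by (intro foldl_act_in) auto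
    then show ?case using snoc det3_act[OF assms(1)] par_act by auto
  qed
  then show ?thesis using connected[OF assms(2)] by blast
qed

end

context orbisphere_group_ge3
begin

lemma \<rho>_rotation:
  assumes "i \<in> {1..n}" "j \<in> {1..n}"
  shows "\<rho> (inv (prefix_elt i) \<otimes> prefix_elt j) = reflection i \<circ> reflection j"
  unfolding \<rho>_mult[OF inv_closed[OF prefix_elt_closed[OF assms(1)]] prefix_elt_closed[OF assms(2)]]
    \<rho>_pfx[OF assms(2)] \<rho>_inv_pfx[OF assms(1)] by (simp add: fun_eq_iff)

context
  fixes z :: 'a
  assumes z: "z \<in> carrier G" and central: "\<And>g. g \<in> carrier G \<Longrightarrow> z \<otimes> g = g \<otimes> z"
begin

lemma \<rho>_central_commute:
  assumes "i \<in> {1..n}" "j \<in> {1..n}"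
  shows "\<rho> z (reflection i (reflection j v)) = reflection i (reflection j (\<rho> z v))"
proof -
  let ?g = "inv (prefix_elt i) \<otimes> prefix_elt j"
  have g: "?g \<in> carrier G" by (intro m_closed inv_closed prefix_elt_closed assms)
  have "\<rho> z \<circ> \<rho> ?g = \<rho> ?g \<circ> \<rho> z"
    unfolding \<rho>_mult[OF z g, symmetric] \<rho>_mult[OF g z, symmetric] central[OF g] ..
  then show ?thesis unfolding \<rho>_rotation[OF assms] by (auto simp: fun_eq_iff)
qed

definition eigenvalue :: "nat \<Rightarrow> real" where "eigenvalue i = \<rho> z (axis i) i"

text \<open>Centrality gives commutation with products of two reflections only, not with one
  reflection. To isolate wall \<open>i\<close>, take \<open>j\<close> different from
  \<open>i\<close> and \<open>t\<close>, and \<open>v\<close> fixed by the reflection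
  \<open>j\<close> with \<open>coform i v = 1\<close>. The product then subtracts twice
  \<open>axis i\<close> from \<open>v\<close> and never alters coordinate \<open>t\<close>.\<close>

lemma \<rho>_central_axis:
  assumes i: "i \<in> {1..n}"
  shows "\<rho> z (axis i) = (\<lambda>t. eigenvalue i * axis i t)"
proof
  fix t
  show "\<rho> z (axis i) t = eigenvalue i * axis i t"
  proof (cases "t = i")
    case True
    then show ?thesis by (simp add: eigenvalue_def axis_def)
  next
    case False
    have "card {1..n} \<ge> 3" using n_ge_3 by simp
    then have "\<not> {1..n} \<subseteq> {i, t}"
      using card_mono[of "{i, t}" "{1..n}"] card_insert_le_m1[of 2 "{t}" i] by auto
    then obtain j where j: "j \<in> {1..n}" "j \<noteq> i" "j \<noteq> t" by blast
    obtain v where v: "coform i v = 1" "coform j v = 0"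
      by (rule coform_dual_vector[OF j(2)[symmetric] i j(1)])
    have "reflection j v = v" using v(2) by (simp add: reflection_def)
    then have "reflection i (reflection j v) = (\<lambda>k. 1 * v k + (-2) * axis i k)"
      using v(1) by (simp add: reflection_def[of i])
    then have "\<rho> z (reflection i (reflection j v)) t = \<rho> z v t - 2 * \<rho> z (axis i) t"
      using linD[OF lin_\<rho>[OF z], of 1 v "-2" "axis i"] by simp
    moreover have "reflection i (reflection j (\<rho> z v)) t = \<rho> z v t"
      using False j(3) by (simp add: reflection_def axis_def)
    ultimately have "\<rho> z (axis i) t = 0" using \<rho>_central_commute[OF i j(1), of v] by simp
    then show ?thesis using False by (simp add: axis_def)
  qed
qed

text \<open>The rotation sends \<open>axis j\<close> to minus itself minus 2 \<open>c i j\<close>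
  times \<open>axis i\<close>; comparing coordinate \<open>i\<close> on both sides of the
  commutation relation gives the equality.\<close>

lemma eigenvalue_eq:
  assumes i: "i \<in> {1..n}" and j: "j \<in> {1..n}" and ij: "i \<noteq> j" and c: "c i j \<noteq> 0"
  shows "eigenvalue i = eigenvalue j"
proof -
  have 1: "reflection i (reflection j (axis j)) = (\<lambda>k. (-1) * axis j k + (- 2 * c i j) * axis i k)"
    using lin_scale[OF lin_reflection, of i "-1" "axis j"]
    by (simp add: reflection_axis_self reflection_axis[OF ij j])
  have "\<rho> z (reflection i (reflection j (axis j))) i = - 2 * c i j * eigenvalue i"
    unfolding 1 linD[OF lin_\<rho>[OF z]] \<rho>_central_axis[OF i] \<rho>_central_axis[OF j]
    using ij by (simp add: axis_def)
  moreover have "reflection i (reflection j (\<rho> z (axis j))) i = eigenvalue j * (- 2 * c i j)"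
    unfolding \<rho>_central_axis[OF j] lin_scale[OF lin_reflection] 1 using ij by (simp add: axis_def)
  ultimately show ?thesis using \<rho>_central_commute[OF i j, of "axis j"] c by simp
qed

lemma eigenvalue_neq_0:
  assumes i: "i \<in> {1..n}"
  shows "eigenvalue i \<noteq> 0"
proof
  assume "eigenvalue i = 0"
  then have "\<rho> z (axis i) = \<rho> z (\<lambda>t. 0 * axis i t)"
    unfolding lin_scale[OF lin_\<rho>[OF z]] \<rho>_central_axis[OF i] by simp
  then have "axis i = (\<lambda>t. 0 * axis i t)"
    using injD[OF bij_is_inj[OF bij_\<rho>[OF z]], of "axis i" "\<lambda>t. 0 * axis i t"] by blast
  then have "axis i i = 0 * axis i i" by (rule fun_cong)
  then show False by (simp add: axis_def)
qed

lemma chamber_map_central: "chamber_map (z, False) (axis i) i = eigenvalue i"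
  by (simp add: chamber_map_def eigenvalue_def)

lemma z_chamber: "(z, False) \<in> carrier G \<times> (UNIV :: bool set)"
  using z by simp

text \<open>The weight 2 is nonzero, so a negative eigenvalue at \<open>i\<close> is also one at
  \<open>j\<close>. Then \<open>j\<close> is a descent, which makes the root for \<open>i\<close>
  nonnegative.\<close>

lemma eigenvalue_pos_if_infinite:
  assumes i: "i \<in> {1..n}" and j: "j \<in> {1..n}" and ij: "i \<noteq> j" and m: "cox i j = \<infinity>"
  shows "0 < eigenvalue i"
proof (rule ccontr)
  assume "\<not> 0 < eigenvalue i"
  then have neg: "eigenvalue i < 0" using eigenvalue_neq_0[OF i] by simp
  have "eigenvalue i = eigenvalue j"
    by (rule eigenvalue_eq[OF i j ij]) (simp add: m edge_weight_def)
  then have negj: "eigenvalue j < 0" using neg by simp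
  have "\<not> len (z, False) < len (chamber_act (z, False) j)"
    using ascent_nonneg[OF z_chamber j, of j] negj unfolding chamber_map_central by linarith
  then have "len (chamber_act (z, False) j) < len (z, False)"
    using len_act_neq[OF z_chamber j] by simp
  from ascent_nonneg_infinite[OF z_chamber i j ij m this, of i] neg
  show False unfolding chamber_map_central by linarith
qed

lemma central_eq_one_if_eigenvalues_pos:
  assumes "\<And>i. i \<in> {1..n} \<Longrightarrow> 0 < eigenvalue i"
  shows "z = \<one>"
proof -
  have "(z, False) = (\<one>, False)"
  proof (rule eq_base_if_positive[OF z_chamber])
    show "\<exists>t. 0 < chamber_map (z, False) (axis i) t" if "i \<in> {1..n}" for i
      using assms[OF that] unfolding chamber_map_central[symmetric] by (rule exI)
  qed
  then show ?thesis by simp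
qed

lemma central_trivial_ge4:
  assumes "4 \<le> n"
  shows "z = \<one>"
proof (rule central_eq_one_if_eigenvalues_pos)
  fix i assume i: "i \<in> {1..n}"
  \<comment> \<open>With four or more sides, the side two steps away is not adjacent to
    \<open>i\<close>.\<close>
  define j where "j = (if i + 2 \<le> n then i + 2 else i - 2)"
  have "j \<in> {1..n}" "i \<noteq> j" "cox i j = \<infinity>"
    using i assms by (auto simp: j_def cox_def nxt_def)
  then show "0 < eigenvalue i" by (rule eigenvalue_pos_if_infinite[OF i])
qed

text \<open>An element of \<open>G\<close> is a product of an even number of reflections, so its
  determinant is 1, and a central one acts diagonally.\<close>

lemma eigenvalue_prod:
  assumes "n = 3"
  shows "eigenvalue 1 * eigenvalue 2 * eigenvalue 3 = 1"
proof -
  have "det3 (z, False) = 1" using det3_eq[OF assms z_chamber] by simp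
  moreover have "chamber_map (z, False) (axis i) = (\<lambda>t. eigenvalue i * axis i t)" if "i \<in> {1..n}" for i
    unfolding \<rho>_central_axis[OF that, symmetric] by (simp add: chamber_map_def)
  moreover have "1 \<in> {1..n}" "2 \<in> {1..n}" "3 \<in> {1..n}" using assms by auto
  ultimately show ?thesis
    unfolding det3_def by (simp only:) (simp add: axis_def)
qed

text \<open>Product 1 without all signs positive leaves exactly two negative eigenvalues. Corners
  between opposite signs have weight 0, hence order 2, and the corner between the two negative walls
  has finite order. This is a dihedral group, and the hypothesis on the orders makes that finite
  order odd.\<close>

lemma central_trivial_3:
  assumes n: "n = 3" and nc: "\<not> cyclic_group G" and nd: "\<not> even_dihedral_orders n e"
  shows "z = \<one>"
proof (rule ccontr)
  assume "z \<noteq> \<one>"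
  have I: "1 \<in> {1..n}" "2 \<in> {1..n}" "3 \<in> {1..n}" using n by auto
  have neq0: "eigenvalue 1 \<noteq> 0" "eigenvalue 2 \<noteq> 0" "eigenvalue 3 \<noteq> 0"
    using eigenvalue_neq_0 I by auto
  have cox3: "cox 1 2 = e 1" "cox 2 3 = e 2" "cox 3 1 = e 3"
    unfolding cox_def nxt_def using n by simp_all
  have "\<not> (0 < eigenvalue 1 \<and> 0 < eigenvalue 2 \<and> 0 < eigenvalue 3)"
  proof
    assume pos: "0 < eigenvalue 1 \<and> 0 < eigenvalue 2 \<and> 0 < eigenvalue 3"
    have "0 < eigenvalue i" if "i \<in> {1..n}" for i
    proof -
      have "i = 1 \<or> i = 2 \<or> i = 3" using that n by auto
      with pos show ?thesis by blast
    qed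
    with central_eq_one_if_eigenvalues_pos \<open>z \<noteq> \<one>\<close> show False by blast
  qed
  moreover have "0 < eigenvalue 1 * eigenvalue 2 * eigenvalue 3" using eigenvalue_prod[OF n] by simp
  ultimately have signs: "(eigenvalue 1 < 0 \<and> eigenvalue 2 < 0 \<and> 0 < eigenvalue 3) \<or>
     (eigenvalue 2 < 0 \<and> eigenvalue 3 < 0 \<and> 0 < eigenvalue 1) \<or>
     (eigenvalue 3 < 0 \<and> eigenvalue 1 < 0 \<and> 0 < eigenvalue 2)"
    using neq0 unfolding zero_less_mult_iff mult_less_0_iff by linarith
  have two: "cox i j = 2" if "i \<in> {1..n}" "j \<in> {1..n}" "i \<noteq> j" "eigenvalue i < 0" "0 < eigenvalue j" for i j
    using eigenvalue_eq[OF that(1,2,3)] that(4,5) edge_weight_eq_0[OF m_ge_2[OF that(1,2,3)]] by fastforce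
  have fin: "cox i j \<noteq> \<infinity>" if "i \<in> {1..n}" "j \<in> {1..n}" "i \<noteq> j" "eigenvalue i < 0" for i j
    using eigenvalue_pos_if_infinite[OF that(1,2,3)] that(4) by auto
  have sq: "\<gamma> i \<otimes> \<gamma> i = \<one>" if "i \<in> {1..n}" "e i = 2" for i
    using \<gamma>_pow_order[of i 2] that \<gamma>_closed[of i] by (simp add: numeral_eq_enat numeral_2_eq_2)
  have key: False if cyc: "a \<in> {1..n}" "b \<in> {1..n}" "k \<in> {1..n}" "{a, b, k} = {1..3}"
    and prod: "\<gamma> a \<otimes> \<gamma> b \<otimes> \<gamma> k = \<one>" and e: "e a = 2" "e b = 2" "e k \<noteq> \<infinity>" for a b k
  proof -
    obtain M where M: "e k = enat M" using e(3) by auto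
    have "odd M"
    proof
      assume "even M"
      then have "e k = enat (2 * (M div 2))" using M by simp
      then show False using nd cyc(4) e n unfolding even_dihedral_orders_def by blast
    qed
    have "generate G {\<gamma> a, \<gamma> b, \<gamma> k} = carrier G"
      using generate_\<gamma> n cyc(4) by (metis image_empty image_insert)
    from dihedral_center_trivial[OF \<gamma>_closed[OF cyc(1)] \<gamma>_closed[OF cyc(2)] \<gamma>_closed[OF cyc(3)] prod
        sq[OF cyc(1) e(1)] sq[OF cyc(2) e(2)] \<gamma>_pow_order[OF cyc(3) M] \<open>odd M\<close> this nc z central]
    show False using \<open>z \<noteq> \<one>\<close> by blast
  qed
  have \<gamma>_in: "\<gamma> 1 \<in> carrier G" "\<gamma> 2 \<in> carrier G" "\<gamma> 3 \<in> carrier G" using \<gamma>_closed I by auto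
  have "partial_prod 3 = \<one>" using partial_prod_n n by simp
  then have p1: "\<gamma> 1 \<otimes> \<gamma> 2 \<otimes> \<gamma> 3 = \<one>"
    using \<gamma>_in by (simp add: numeral_3_eq_3 numeral_2_eq_2)
  have p2: "\<gamma> 2 \<otimes> \<gamma> 3 \<otimes> \<gamma> 1 = \<one>"
    by (rule inv_comm[OF _ \<gamma>_in(1) m_closed[OF \<gamma>_in(2,3)]]) (use p1 \<gamma>_in in \<open>simp add: m_assoc\<close>)
  have p3: "\<gamma> 3 \<otimes> \<gamma> 1 \<otimes> \<gamma> 2 = \<one>"
    by (rule inv_comm[OF _ \<gamma>_in(2) m_closed[OF \<gamma>_in(3,1)]]) (use p2 \<gamma>_in in \<open>simp add: m_assoc\<close>)
  have neq: "(1::nat) \<noteq> 2" "(2::nat) \<noteq> 1" "(1::nat) \<noteq> 3" "(3::nat) \<noteq> 1" "(2::nat) \<noteq> 3" "(3::nat) \<noteq> 2"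
    by simp_all
  from signs show False
  proof (elim disjE conjE)
    assume ev: "eigenvalue 1 < 0" "eigenvalue 2 < 0" "0 < eigenvalue 3"
    have "cox 3 1 = 2" "cox 2 3 = 2" "cox 1 2 \<noteq> \<infinity>"
      using two[OF I(1,3) neq(3) ev(1,3)] two[OF I(2,3) neq(5) ev(2,3)] fin[OF I(1,2) neq(1) ev(1)]
      unfolding m_sym[of 3 1] .
    then show False unfolding cox3 by (intro key[OF I(2,3,1) _ p2]) auto
  next
    assume ev: "eigenvalue 2 < 0" "eigenvalue 3 < 0" "0 < eigenvalue 1"
    have "cox 1 2 = 2" "cox 3 1 = 2" "cox 2 3 \<noteq> \<infinity>"
      using two[OF I(2,1) neq(2) ev(1,3)] two[OF I(3,1) neq(4) ev(2,3)] fin[OF I(2,3) neq(5) ev(1)]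
      unfolding m_sym[of 1 2] .
    then show False unfolding cox3 by (intro key[OF I(3,1,2) _ p3]) auto
  next
    assume ev: "eigenvalue 3 < 0" "eigenvalue 1 < 0" "0 < eigenvalue 2"
    have "cox 2 3 = 2" "cox 1 2 = 2" "cox 3 1 \<noteq> \<infinity>"
      using two[OF I(3,2) neq(6) ev(1,3)] two[OF I(1,2) neq(1) ev(2,3)] fin[OF I(3,1) neq(4) ev(1)]
      unfolding m_sym[of 2 3] .
    then show False unfolding cox3 by (intro key[OF I(1,2,3) _ p1]) auto
  qed
qed

theorem center_trivial:
  assumes "\<not> cyclic_group G" "\<not> even_dihedral_orders n e"
  shows "z = \<one>"
proof (cases "n = 3")
  case True
  then show ?thesis using assms by (rule central_trivial_3)
next
  case False
  then have "4 \<le> n" using n_ge_3 by linarith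
  then show ?thesis by (rule central_trivial_ge4)
qed

end

end

subsection \<open>Conjugate generators\<close>

lemma word_val_integer_mod_group:
  assumes "\<And>i. i \<in> set js \<Longrightarrow> f i \<in> carrier (integer_mod_group N)"
  shows "word_val (integer_mod_group N) f (map (\<lambda>i. (i, True)) js) = (\<Sum>i\<leftarrow>js. f i) mod int N"
  using assms by (induction js) (simp_all add: mod_add_right_eq)

context orbisphere_group
begin

text \<open>A test map killing all generators but two. The divisibility assumptions are the images
  of the relators in the integers modulo \<open>N\<close>, where \<open>N = 0\<close> stands for the
  integers themselves.\<close>

lemma hom_to_cyclic:
  assumes ij: "i \<in> {1..n}" "j \<in> {1..n}" "i \<noteq> j" and uv: "int N dvd u + v"
    and i: "\<And>k. e i = enat k \<Longrightarrow> int N dvd int k * u"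
    and j: "\<And>k. e j = enat k \<Longrightarrow> int N dvd int k * v"
  shows "\<exists>\<phi> \<in> hom G (integer_mod_group N). \<forall>l\<in>{1..n}. \<phi> (\<gamma> l) =
     (if l = i then u else if l = j then v else 0) mod int N"
proof (rule universal[OF group_integer_mod_group])
  let ?f = "\<lambda>l. (if l = i then u else if l = j then v else 0) mod int N"
  show f: "?f l \<in> carrier (integer_mod_group N)" for l
    by (simp add: carrier_integer_mod_group)
  show "?f l [^]\<^bsub>integer_mod_group N\<^esub> k = \<one>\<^bsub>integer_mod_group N\<^esub>" if "e l = enat k" for l k
  proof -
    have "int N dvd int k * (if l = i then u else if l = j then v else 0)"
      using i j that by auto
    then show ?thesis by (simp add: mod_mult_right_eq)
  qed
  have "(\<Sum>l\<leftarrow>[1..<Suc n]. ?f l) = (\<Sum>l\<in>{1..n}. ?f l)"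
    by (subst sum_list_distinct_conv_sum_set) (auto intro: sum.cong)
  also have "\<dots> = (\<Sum>l\<in>{i, j}. ?f l)"
    by (rule sum.mono_neutral_right) (use ij in auto)
  also have "\<dots> = u mod int N + v mod int N" using ij(3) by simp
  finally have "(\<Sum>l\<leftarrow>[1..<Suc n]. ?f l) mod int N = (u + v) mod int N"
    by (simp only: mod_add_eq)
  then show "word_val (integer_mod_group N) ?f (map (\<lambda>i. (i, True)) [1..<Suc n]) = \<one>\<^bsub>integer_mod_group N\<^esub>"
    unfolding word_val_integer_mod_group[OF f] using uv by simp
qed

lemma hom_to_cyclic_conjugate:
  assumes \<phi>: "\<phi> \<in> hom G (integer_mod_group N)" and g: "g \<in> carrier G" and x: "x \<in> carrier G"
  shows "\<phi> (x \<otimes> g \<otimes> inv x) = \<phi> g"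
proof -
  let ?h = "x \<otimes> g \<otimes> inv x"
  have h: "?h \<in> carrier G" using g x by simp
  have "?h \<otimes> x = x \<otimes> g" using g x by (simp add: m_assoc)
  then have "\<phi> (?h \<otimes> x) = \<phi> (x \<otimes> g)" by (rule arg_cong)
  then have "(\<phi> ?h + \<phi> x) mod int N = (\<phi> x + \<phi> g) mod int N"
    unfolding hom_mult[OF \<phi> h x] hom_mult[OF \<phi> x g] by simp
  then have "(\<phi> ?h + \<phi> x - \<phi> x) mod int N = (\<phi> x + \<phi> g - \<phi> x) mod int N"
    by (rule mod_diff_cong) simp
  then have "\<phi> ?h mod int N = \<phi> g mod int N" by simp
  moreover have "\<phi> ?h \<in> carrier (integer_mod_group N)" "\<phi> g \<in> carrier (integer_mod_group N)"
    using hom_in_carrier[OF \<phi>] h g by blast+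
  ultimately show ?thesis by (auto simp: carrier_integer_mod_group split: if_splits)
qed

end

context orbisphere_group_ge3
begin

lemma conjugate_orders_eq:
  assumes ij: "i \<in> {1..n}" "j \<in> {1..n}" and x: "x \<in> carrier G" "\<gamma> j = x \<otimes> \<gamma> i \<otimes> inv x"
  shows "e i = e j"
proof -
  have iff: "\<gamma> j [^] k = \<one> \<longleftrightarrow> \<gamma> i [^] k = \<one>" for k :: nat
  proof -
    have gk: "\<gamma> i [^] k \<in> carrier G" using \<gamma>_closed[OF ij(1)] by simp
    have "\<gamma> j [^] k = x \<otimes> \<gamma> i [^] k \<otimes> inv x"
      unfolding x(2) by (rule conjugate_pow[OF x(1) \<gamma>_closed[OF ij(1)]])
    moreover have "x \<otimes> \<gamma> i [^] k \<otimes> inv x = \<one> \<longleftrightarrow> \<gamma> i [^] k = \<one>"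
    proof
      assume "x \<otimes> \<gamma> i [^] k \<otimes> inv x = \<one>"
      then have "x \<otimes> \<gamma> i [^] k = x"
        using inv_solve_right'[OF m_closed[OF x(1) gk] one_closed x(1)] x(1) by (metis inv_equality inv_inv gk m_closed inv_closed)
      then show "\<gamma> i [^] k = \<one>" using x(1) gk by simp
    qed (use x in simp)
    ultimately show ?thesis by simp
  qed
  have "(if e i = \<infinity> then k = 0 else the_enat (e i) dvd k) = (if e j = \<infinity> then k = 0 else the_enat (e j) dvd k)" for k
    using iff[of k] unfolding \<gamma>_pow_eq_one_iff[OF ij(1)] \<gamma>_pow_eq_one_iff[OF ij(2)] by blast
  note eq = this
  show ?thesis
  proof (cases "e i"; cases "e j")
    fix k l assume kl: "e i = enat k" "e j = enat l"
    have "k dvd l" "l dvd k" using eq[of k] eq[of l] kl by simp_all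
    then show ?thesis using kl by (simp add: dvd_antisym)
  next
    fix k assume k: "e i = enat k" "e j = \<infinity>"
    then have "k = 0" using eq[of k] by simp
    then show ?thesis using k orders[OF ij(1)] by (simp add: numeral_eq_enat)
  next
    fix k assume k: "e i = \<infinity>" "e j = enat k"
    then have "k = 0" using eq[of k] by simp
    then show ?thesis using k orders[OF ij(2)] by (simp add: numeral_eq_enat)
  qed simp
qed

text \<open>Conjugate elements agree in every abelian quotient. Each conclusion comes from a cyclic
  quotient that would otherwise tell \<open>\<gamma> i\<close> and \<open>\<gamma> j\<close>
  apart.\<close>

theorem conjugate_generators:
  assumes ij: "i \<in> {1..n}" "j \<in> {1..n}" "i \<noteq> j"
    and x: "x \<in> carrier G" "\<gamma> j = x \<otimes> \<gamma> i \<otimes> inv x"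
  shows "e i = 2" "e j = 2" "\<And>l. l \<in> {1..n} \<Longrightarrow> l \<noteq> i \<Longrightarrow> l \<noteq> j \<Longrightarrow> \<exists>k. e l = enat k \<and> odd k"
proof -
  have ee: "e i = e j" by (rule conjugate_orders_eq[OF ij(1,2) x])
  \<comment> \<open>For infinite order the value 0 makes the target the infinite cyclic group. The
    images 1 and -1 then coincide only if \<open>N\<close> divides 2.\<close>
  define N where "N = (case e i of enat k \<Rightarrow> k | \<infinity> \<Rightarrow> 0)"
  have "\<exists>\<phi> \<in> hom G (integer_mod_group N). \<forall>l\<in>{1..n}. \<phi> (\<gamma> l) =
     (if l = i then 1 else if l = j then -1 else 0) mod int N"
    by (rule hom_to_cyclic[OF ij]) (auto simp: N_def ee)
  then obtain \<phi> where \<phi>: "\<phi> \<in> hom G (integer_mod_group N)"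
    "\<And>l. l \<in> {1..n} \<Longrightarrow> \<phi> (\<gamma> l) = (if l = i then 1 else if l = j then -1 else 0) mod int N" by blast
  have "\<phi> (\<gamma> j) = \<phi> (\<gamma> i)"
    unfolding x(2) by (rule hom_to_cyclic_conjugate[OF \<phi>(1) \<gamma>_closed[OF ij(1)] x(1)])
  then have "(-1) mod int N = 1 mod int N"
    using \<phi>(2)[OF ij(1)] \<phi>(2)[OF ij(2)] ij(3) by simp
  then have "int N dvd 1 - (-1)" by (metis mod_eq_dvd_iff)
  then have "N dvd 2" using int_dvd_int_iff[of N 2] by simp
  then have N: "N = 1 \<or> N = 2" using dvd_imp_le[of N 2] by (cases "N = 0") auto
  show ei: "e i = 2"
  proof (cases "e i")
    case (enat k)
    then have "k = 1 \<or> k = 2" using N by (simp add: N_def)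
    then show ?thesis using enat orders[OF ij(1)] by (auto simp: numeral_eq_enat)
  qed (use N in \<open>simp add: N_def\<close>)
  then show "e j = 2" using ee by simp
  fix l assume l: "l \<in> {1..n}" "l \<noteq> i" "l \<noteq> j"
  show "\<exists>k. e l = enat k \<and> odd k"
  proof (rule ccontr)
    assume nodd: "\<not> (\<exists>k. e l = enat k \<and> odd k)"
    \<comment> \<open>If \<open>e l\<close> is even or infinite, counting \<open>\<gamma> i\<close>
      and \<open>\<gamma> l\<close> modulo 2 is well defined and separates \<open>\<gamma> i\<close>
      from \<open>\<gamma> j\<close>.\<close>
    have "\<exists>\<phi> \<in> hom G (integer_mod_group 2). \<forall>l'\<in>{1..n}. \<phi> (\<gamma> l') =
       (if l' = i then 1 else if l' = l then 1 else 0) mod int 2"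
      by (rule hom_to_cyclic[OF ij(1) l(1) l(2)[symmetric]]) (use ei nodd in \<open>auto simp: numeral_eq_enat\<close>)
    then obtain \<psi> where \<psi>: "\<psi> \<in> hom G (integer_mod_group 2)"
      "\<And>l'. l' \<in> {1..n} \<Longrightarrow> \<psi> (\<gamma> l') = (if l' = i then 1 else if l' = l then 1 else 0) mod int 2" by blast
    have "\<psi> (\<gamma> j) = \<psi> (\<gamma> i)"
      unfolding x(2) by (rule hom_to_cyclic_conjugate[OF \<psi>(1) \<gamma>_closed[OF ij(1)] x(1)])
    then show False using \<psi>(2)[OF ij(1)] \<psi>(2)[OF ij(2)] ij(3) l by simp
  qed
qed

end

subsection \<open>Cycles and lifts in a biset\<close>

lemma card_orbit_eq_funpow_dist1:
  assumes "x \<in> orbit f x"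
  shows "card (orbit f x) = funpow_dist1 f x x"
proof -
  let ?d = "funpow_dist1 f x x"
  have "orbit f x = (\<lambda>k. (f ^^ k) x) ` {0..<?d}"
    using orbit_altdef_bounded[OF funpow_dist1_prop[OF assms]] by auto
  moreover have "inj_on (\<lambda>k. (f ^^ k) x) {0..<?d}"
    using funpow_neq_less_funpow_dist1[OF assms] by (intro inj_onI) (auto simp del: funpow.simps)
  ultimately show ?thesis by (simp only: card_image card_atLeastLessThan diff_zero)
qed

lemma funpow_card_orbit: "x \<in> orbit f x \<Longrightarrow> (f ^^ card (orbit f x)) x = x"
  unfolding card_orbit_eq_funpow_dist1 by (rule funpow_dist1_prop)

lemma card_orbit_dvd:
  assumes "x \<in> orbit f x" "(f ^^ k) x = x"
  shows "card (orbit f x) dvd k"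
proof -
  let ?d = "funpow_dist1 f x x"
  have per: "(f ^^ (?d * q)) x = x" for q
  proof (induction q)
    case (Suc q)
    have "(f ^^ (?d * Suc q)) x = (f ^^ (?d * q)) ((f ^^ ?d) x)"
      by (simp only: mult_Suc_right add.commute[of ?d] funpow_add comp_apply)
    then show ?case by (simp only: funpow_dist1_prop[OF assms(1)] Suc)
  qed simp
  have "k = k mod ?d + ?d * (k div ?d)" by (simp only: mod_mult_div_eq)
  then have "(f ^^ k) x = (f ^^ (k mod ?d)) ((f ^^ (?d * (k div ?d))) x)"
    by (metis comp_apply funpow_add)
  then have "(f ^^ (k mod ?d)) x = x" using assms(2) per by simp
  moreover have "k mod ?d < ?d" by (rule mod_less_divisor) simp
  ultimately have "k mod ?d = 0" using funpow_dist1_least[of "k mod ?d" f x x] by blast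
  then show ?thesis unfolding card_orbit_eq_funpow_dist1[OF assms(1)] by (rule mod_0_imp_dvd)
qed

lemma sum_card_orbits:
  assumes "finite A" "f permutes A"
  shows "(\<Sum>c\<in>orbit f ` A. card c) = card A"
proof -
  have p: "permutation f" using assms by (auto simp: permutation_permutes)
  have "card (\<Union> (orbit f ` A)) = (\<Sum>c\<in>orbit f ` A. card c)"
  proof (rule card_Union_disjoint)
    show "pairwise disjnt (orbit f ` A)"
      unfolding pairwise_def disjnt_def
      using orbit_cyclic_eq3[OF cyclic_on_orbit'[OF p]] by (metis (no_types, lifting) disjoint_iff imageE)
    show "finite c" if "c \<in> orbit f ` A" for c
      using that finite_orbit[OF permutation_self_in_orbit[OF p]] by blast
  qed
  moreover have "\<Union> (orbit f ` A) = A"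
    using permutes_orbit_subset[OF assms(2)] permutation_self_in_orbit[OF p] by blast
  ultimately show ?thesis by simp
qed

lemma card_vimage_eq_sum:
  assumes "finite S" "finite Y"
  shows "card {x \<in> S. f x \<in> Y} = (\<Sum>y\<in>Y. card {x \<in> S. f x = y})"
proof -
  have "{x \<in> S. f x \<in> Y} = (\<Union>y\<in>Y. {x \<in> S. f x = y})" by blast
  then show ?thesis using assms by (simp only:) (rule card_UN_disjoint, auto)
qed

context group
begin

lemma conj_class_self: "g \<in> carrier G \<Longrightarrow> g \<in> conj_class G g"
  unfolding conj_class_def by (force intro: exI[of _ \<one>])

lemma conj_class_one: "conj_class G \<one> = {\<one>}"
  unfolding conj_class_def by (auto intro: exI[of _ \<one>])

lemma conj_class_conjugate:
  assumes u: "u \<in> carrier G" and h: "h \<in> carrier G"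
  shows "conj_class G (u \<otimes> h \<otimes> inv u) = conj_class G h"
proof
  show "conj_class G (u \<otimes> h \<otimes> inv u) \<subseteq> conj_class G h"
  proof
    fix y assume "y \<in> conj_class G (u \<otimes> h \<otimes> inv u)"
    then obtain x where x: "x \<in> carrier G" "y = x \<otimes> (u \<otimes> h \<otimes> inv u) \<otimes> inv x"
      unfolding conj_class_def by blast
    then have "y = (x \<otimes> u) \<otimes> h \<otimes> inv (x \<otimes> u)" using u h by (simp add: inv_mult_group m_assoc)
    then show "y \<in> conj_class G h" unfolding conj_class_def using x(1) u by blast
  qed
  show "conj_class G h \<subseteq> conj_class G (u \<otimes> h \<otimes> inv u)"
  proof
    fix y assume "y \<in> conj_class G h"
    then obtain x where x: "x \<in> carrier G" "y = x \<otimes> h \<otimes> inv x"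
      unfolding conj_class_def by blast
    have c: "inv u \<otimes> (u \<otimes> w) = w" if "w \<in> carrier G" for w
      using u that by (simp flip: m_assoc)
    have "y = (x \<otimes> inv u) \<otimes> (u \<otimes> h \<otimes> inv u) \<otimes> inv (x \<otimes> inv u)"
      using u h x by (simp add: inv_mult_group m_assoc c)
    then show "y \<in> conj_class G (u \<otimes> h \<otimes> inv u)" unfolding conj_class_def using x(1) u by blast
  qed
qed

end

section \<open>Left orbits and their permutations\<close>

context biset
begin

definition orb :: "'b \<Rightarrow> 'b set" where "orb b = (\<lambda>h. h \<rhd> b) ` carrier G"

lemma left_orbits_eq: "left_orbits = orb ` B"
  by (simp add: left_orbits_def orb_def[abs_def])

lemma orb_self: "b \<in> B \<Longrightarrow> b \<in> orb b"
  unfolding orb_def using lact_one[of b] by (metis image_eqI one_closed)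

lemma orb_subset: "b \<in> B \<Longrightarrow> orb b \<subseteq> B"
  unfolding orb_def using lact_closed by blast

lemma orbE:
  assumes "b' \<in> orb b"
  obtains u where "u \<in> carrier G" "b' = u \<rhd> b"
  using assms unfolding orb_def by blast

lemma orb_lact:
  assumes b: "b \<in> B" and u: "u \<in> carrier G"
  shows "orb (u \<rhd> b) = orb b"
proof
  show "orb (u \<rhd> b) \<subseteq> orb b"
  proof
    fix y assume "y \<in> orb (u \<rhd> b)"
    then obtain v where v: "v \<in> carrier G" "y = v \<rhd> (u \<rhd> b)" by (rule orbE)
    then have "y = (v \<otimes> u) \<rhd> b" using lact_mult[OF v(1) u b] by simp
    then show "y \<in> orb b" unfolding orb_def using v(1) u by blast
  qed
  show "orb b \<subseteq> orb (u \<rhd> b)"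
  proof
    fix y assume "y \<in> orb b"
    then obtain v where v: "v \<in> carrier G" "y = v \<rhd> b" by (rule orbE)
    have "(v \<otimes> inv u) \<rhd> (u \<rhd> b) = (v \<otimes> inv u \<otimes> u) \<rhd> b"
      by (rule lact_mult[symmetric]) (use v u b in auto)
    also have "v \<otimes> inv u \<otimes> u = v" using v u by (simp add: m_assoc)
    finally have "y = (v \<otimes> inv u) \<rhd> (u \<rhd> b)" using v by simp
    then show "y \<in> orb (u \<rhd> b)" unfolding orb_def using v(1) u by blast
  qed
qed

lemma orb_eq: "b \<in> B \<Longrightarrow> b' \<in> orb b \<Longrightarrow> orb b' = orb b"
  using orb_lact by (metis orbE)

lemma left_orbit_eq_orb: "X \<in> left_orbits \<Longrightarrow> b \<in> X \<Longrightarrow> b \<in> B \<and> X = orb b"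
  unfolding left_orbits_eq using orb_eq orb_subset by blast

lemma rperm_orb:
  assumes "b \<in> B" "g \<in> carrier G"
  shows "rperm g (orb b) = orb (b \<lhd>\<^sub>r g)"
proof -
  have "(\<lambda>x. x \<lhd>\<^sub>r g) ` orb b = orb (b \<lhd>\<^sub>r g)"
    unfolding orb_def image_image by (intro image_cong HOL.refl act_commute) (use assms in auto)
  then show ?thesis using assms by (simp add: rperm_def left_orbits_eq)
qed

text \<open>\<open>rperm\<close> is undefined off the left orbits; this version is the identity
  there, as \<open>permutes\<close> requires, and agrees with it on them.\<close>

definition \<sigma> :: "'a \<Rightarrow> 'b set \<Rightarrow> 'b set" where
  "\<sigma> g = perm_restrict (rperm g) left_orbits"

lemma \<sigma>_orb: "b \<in> B \<Longrightarrow> g \<in> carrier G \<Longrightarrow> \<sigma> g (orb b) = orb (b \<lhd>\<^sub>r g)"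
  by (simp add: \<sigma>_def perm_restrict_def left_orbits_eq rperm_orb)

lemma \<sigma>_permutes:
  assumes "g \<in> carrier G"
  shows "\<sigma> g permutes left_orbits"
proof (rule bij_imp_permutes)
  have closed: "\<sigma> h X \<in> left_orbits" if "X \<in> left_orbits" "h \<in> carrier G" for h X
    using that \<sigma>_orb ract_closed unfolding left_orbits_eq by auto
  have inverse: "\<sigma> k (\<sigma> h X) = X"
    if "X \<in> left_orbits" "h \<in> carrier G" "k \<in> carrier G" "h \<otimes> k = \<one>" for h k X
  proof -
    obtain b where b: "b \<in> B" "X = orb b" using \<open>X \<in> left_orbits\<close> unfolding left_orbits_eq by auto
    have "\<sigma> k (\<sigma> h X) = orb (b \<lhd>\<^sub>r h \<lhd>\<^sub>r k)"
      using b that ract_closed \<sigma>_orb by simp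
    also have "b \<lhd>\<^sub>r h \<lhd>\<^sub>r k = b" using ract_mult[of h k b] that b ract_one by simp
    finally show ?thesis using b by simp
  qed
  show "bij_betw (\<sigma> g) left_orbits left_orbits"
    by (rule bij_betw_byWitness[where f' = "\<sigma> (inv g)"])
      (use closed inverse[OF _ assms inv_closed[OF assms]] inverse[OF _ inv_closed[OF assms] assms] assms in auto)
qed (simp add: \<sigma>_def perm_restrict_def)

lemma \<sigma>_funpow_orb:
  assumes "b \<in> B" "g \<in> carrier G"
  shows "(\<sigma> g ^^ k) (orb b) = orb (b \<lhd>\<^sub>r (g [^] k))"
proof (induction k)
  case (Suc k)
  have "b \<lhd>\<^sub>r (g [^] Suc k) = b \<lhd>\<^sub>r (g [^] k) \<lhd>\<^sub>r g"
    using ract_mult[of "g [^] k" g b] assms by simp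
  then show ?case using Suc \<sigma>_orb[of "b \<lhd>\<^sub>r (g [^] k)" g] ract_closed assms by simp
qed (use assms ract_one in simp)

lemma cycles_eq:
  assumes "g \<in> carrier G"
  shows "cycles g = orbit (\<sigma> g) ` left_orbits"
  unfolding cycles_def
proof (rule image_cong[OF HOL.refl])
  fix X assume X: "X \<in> left_orbits"
  show "orbit (rperm g) X = orbit (\<sigma> g) X"
  proof (rule orbit_cong0[OF X])
    show "rperm g \<in> left_orbits \<rightarrow> left_orbits"
    proof
      fix Y assume "Y \<in> left_orbits"
      then obtain b where "b \<in> B" "Y = orb b" unfolding left_orbits_eq by auto
      then show "rperm g Y \<in> left_orbits"
        using rperm_orb assms ract_closed unfolding left_orbits_eq by simp
    qed
  qed (simp add: \<sigma>_def perm_restrict_def)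
qed

end

section \<open>Lifted classes in a left-free biset\<close>

context orbisphere_biset
begin

lemma left_free_unique:
  assumes "h \<in> carrier G" "k \<in> carrier G" "b \<in> B" "h \<rhd> b = k \<rhd> b"
  shows "h = k"
proof -
  have "(inv k \<otimes> h) \<rhd> b = inv k \<rhd> (h \<rhd> b)" by (rule lact_mult) (use assms in auto)
  also have "\<dots> = (inv k \<otimes> k) \<rhd> b" unfolding assms(4) by (rule lact_mult[symmetric]) (use assms in auto)
  also have "\<dots> = b" using assms lact_one by simp
  finally have "inv k \<otimes> h = \<one>"
    using left_free assms(1-3) unfolding left_free_def by blast
  then show ?thesis using assms(1,2) by (metis inv_closed inv_equality inv_inv)
qed

lemma \<sigma>_permutation: "g \<in> carrier G \<Longrightarrow> permutation (\<sigma> g)"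
  using \<sigma>_permutes finite_left_orbits by (auto simp: permutation_permutes)

lemma cycle_of_member:
  assumes g: "g \<in> carrier G" and c: "c \<in> cycles g" and s: "s \<in> \<Union>c"
  shows "s \<in> B" "c = orbit (\<sigma> g) (orb s)"
proof -
  obtain X where X: "X \<in> left_orbits" "c = orbit (\<sigma> g) X" using c unfolding cycles_eq[OF g] by auto
  obtain Y where Y: "Y \<in> c" "s \<in> Y" using s by auto
  have "Y \<in> left_orbits" using permutes_orbit_subset[OF \<sigma>_permutes[OF g] X(1)] Y X(2) by auto
  from left_orbit_eq_orb[OF this Y(2)] have sB: "s \<in> B" and Ys: "Y = orb s" by auto
  show "s \<in> B" by fact
  show "c = orbit (\<sigma> g) (orb s)"
    using orbit_cyclic_eq3[OF cyclic_on_orbit'[OF \<sigma>_permutation[OF g]], of "orb s" X] Y X Ys by simp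
qed

lemma lift_element_exists:
  assumes g: "g \<in> carrier G" and c: "c \<in> cycles g" and s: "s \<in> \<Union>c"
  shows "\<exists>h\<in>carrier G. h \<rhd> s = s \<lhd>\<^sub>r (g [^] card c)"
proof -
  note sB = cycle_of_member[OF assms]
  have "(\<sigma> g ^^ card c) (orb s) = orb s"
    unfolding sB(2) by (rule funpow_card_orbit[OF permutation_self_in_orbit[OF \<sigma>_permutation[OF g]]])
  then have "orb (s \<lhd>\<^sub>r (g [^] card c)) = orb s" by (simp add: \<sigma>_funpow_orb[OF sB(1) g])
  moreover have "s \<lhd>\<^sub>r (g [^] card c) \<in> B" by (rule ract_closed) (use g sB in auto)
  ultimately have "s \<lhd>\<^sub>r (g [^] card c) \<in> orb s" using orb_self by blast
  then show ?thesis by (metis orbE)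
qed

text \<open>Frees the lift from the chosen representative \<open>t\<close>: another one has the form
  \<open>s = u \<rhd> (t \<lhd>\<^sub>r (g [^] i))\<close>, and comparing the defining equations
  gives \<open>h\<close> as the conjugate of \<open>k\<close> by \<open>u\<close>.\<close>

lemma lift_class_eq:
  assumes g: "g \<in> carrier G" and c: "c \<in> cycles g" and s: "s \<in> \<Union>c"
    and h: "h \<in> carrier G" "h \<rhd> s = s \<lhd>\<^sub>r (g [^] card c)"
  shows "lift_class g c = conj_class G h"
proof -
  define t where "t = (SOME s. s \<in> \<Union>c)"
  have t: "t \<in> \<Union>c" unfolding t_def by (rule someI[of _ s]) (rule s)
  define L where "L = card c"
  note sB = cycle_of_member[OF g c s] and tB = cycle_of_member[OF g c t]
  obtain k where k: "k \<in> carrier G" "k \<rhd> t = t \<lhd>\<^sub>r (g [^] L)"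
    using lift_element_exists[OF g c t] unfolding L_def by blast
  have "(THE h. h \<in> carrier G \<and> h \<rhd> t = t \<lhd>\<^sub>r (g [^] card c)) = k"
  proof (rule the_equality)
    show "k \<in> carrier G \<and> k \<rhd> t = t \<lhd>\<^sub>r (g [^] card c)" using k unfolding L_def by blast
    show "h = k" if "h \<in> carrier G \<and> h \<rhd> t = t \<lhd>\<^sub>r (g [^] card c)" for h
      using that k(2) left_free_unique[OF _ k(1) tB(1), of h] unfolding L_def by metis
  qed
  then have lc: "lift_class g c = conj_class G k"
    unfolding lift_class_def Let_def t_def[symmetric] by simp
  have "orb s \<in> orbit (\<sigma> g) (orb t)"
    using permutation_self_in_orbit[OF \<sigma>_permutation[OF g], of "orb s"] sB(2) tB(2) by simp
  then obtain i where "orb s = (\<sigma> g ^^ i) (orb t)" by (auto simp: orbit_altdef)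
  then have "orb s = orb (t \<lhd>\<^sub>r (g [^] i))" by (simp add: \<sigma>_funpow_orb[OF tB(1) g])
  then have "s \<in> orb (t \<lhd>\<^sub>r (g [^] i))" using orb_self[OF sB(1)] by simp
  then obtain u where u: "u \<in> carrier G" "s = u \<rhd> (t \<lhd>\<^sub>r (g [^] i))" by (rule orbE)
  have gi: "g [^] i \<in> carrier G" "g [^] L \<in> carrier G" using g by auto
  let ?r = "t \<lhd>\<^sub>r (g [^] i)"
  have r: "?r \<in> B" by (rule ract_closed[OF gi(1) tB(1)])
  have comm: "?r \<lhd>\<^sub>r (g [^] L) = t \<lhd>\<^sub>r (g [^] L) \<lhd>\<^sub>r (g [^] i)"
    using ract_mult[OF gi(1,2) tB(1)] ract_mult[OF gi(2,1) tB(1)] g by (simp add: nat_pow_mult add.commute)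
  have "h \<rhd> s = s \<lhd>\<^sub>r (g [^] L)" using h(2) by (simp add: L_def)
  also have "\<dots> = u \<rhd> (?r \<lhd>\<^sub>r (g [^] L))" unfolding u(2) by (rule act_commute[OF u(1) gi(2) r])
  also have "\<dots> = u \<rhd> ((k \<rhd> t) \<lhd>\<^sub>r (g [^] i))" unfolding comm k(2) ..
  also have "\<dots> = u \<rhd> (k \<rhd> ?r)" unfolding act_commute[OF k(1) gi(1) tB(1)] ..
  also have "?r = inv u \<rhd> s"
  proof -
    have "inv u \<rhd> (u \<rhd> ?r) = (inv u \<otimes> u) \<rhd> ?r" by (rule lact_mult[symmetric]) (use u r in auto)
    then show ?thesis using u r lact_one by simp
  qed
  also have "u \<rhd> (k \<rhd> (inv u \<rhd> s)) = (u \<otimes> k \<otimes> inv u) \<rhd> s"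
    using u(1) k(1) sB(1) by (simp add: lact_mult lact_closed)
  finally have "h = u \<otimes> k \<otimes> inv u"
    using u(1) k(1) h(1) sB(1) by (intro left_free_unique) auto
  then show ?thesis using lc conj_class_conjugate[OF u(1) k(1)] by simp
qed

lemma cycle_nonempty: "g \<in> carrier G \<Longrightarrow> c \<in> cycles g \<Longrightarrow> \<exists>s. s \<in> \<Union>c"
  unfolding cycles_eq left_orbits_eq
  using permutation_self_in_orbit[OF \<sigma>_permutation] orb_self by blast

lemma lift_class_trivial:
  assumes g: "g \<in> carrier G" and c: "c \<in> cycles g" and "g [^] card c = \<one>"
  shows "lift_class g c = {\<one>}"
proof -
  obtain s where s: "s \<in> \<Union>c" using cycle_nonempty[OF g c] by blast
  have sB: "s \<in> B" by (rule cycle_of_member[OF g c s])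
  have "\<one> \<rhd> s = s \<lhd>\<^sub>r (g [^] card c)" using assms(3) sB lact_one ract_one by simp
  from lift_class_eq[OF g c s one_closed this] show ?thesis by (simp add: conj_class_one)
qed

lemma card_cycle_dvd:
  assumes g: "g \<in> carrier G" and c: "c \<in> cycles g" and k: "g [^] (k::nat) = \<one>"
  shows "card c dvd k"
proof -
  obtain s where s: "s \<in> \<Union>c" using cycle_nonempty[OF g c] by blast
  note sB = cycle_of_member[OF g c s]
  have "(\<sigma> g ^^ k) (orb s) = orb s" using \<sigma>_funpow_orb[OF sB(1) g] k ract_one[OF sB(1)] by simp
  then show ?thesis unfolding sB(2)
    by (rule card_orbit_dvd[OF permutation_self_in_orbit[OF \<sigma>_permutation[OF g]]])
qed

lemma finite_cycles: "g \<in> carrier G \<Longrightarrow> finite (cycles g)"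
  using finite_left_orbits by (simp add: cycles_eq)

text \<open>Away from the trivial class the padding of the multiset equation disappears, so each
  class is lifted as often as it occurs among the generators.\<close>

lemma card_lifts:
  assumes "K \<noteq> {\<one>}"
  shows "card {(i, c) \<in> Sigma {1..n} (\<lambda>i. cycles (\<gamma> i)). lift_class (\<gamma> i) c = K} =
     card {j \<in> {1..n}. conj_class G (\<gamma> j) = K}"
proof -
  have count_img: "count (image_mset f (mset_set A)) x = card {a \<in> A. f a = x}"
    if "finite A" for f :: "'z \<Rightarrow> 'a set" and A x
    using that by (simp add: count_image_mset vimage_def Int_def conj_commute)
  obtain k where k: "(\<Sum>i = 1..n. image_mset snd (lift (\<gamma> i))) =
         image_mset (\<lambda>i. conj_class G (\<gamma> i)) (mset_set {1..n}) + replicate_mset k {\<one>}"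
    using peripheral_lifts by blast
  have "{(i, c) \<in> Sigma {1..n} (\<lambda>i. cycles (\<gamma> i)). lift_class (\<gamma> i) c = K} =
      Sigma {1..n} (\<lambda>i. {c \<in> cycles (\<gamma> i). lift_class (\<gamma> i) c = K})" by auto
  then have "card {(i, c) \<in> Sigma {1..n} (\<lambda>i. cycles (\<gamma> i)). lift_class (\<gamma> i) c = K} =
      (\<Sum>i = 1..n. card {c \<in> cycles (\<gamma> i). lift_class (\<gamma> i) c = K})"
    using finite_cycles[OF \<gamma>_closed] by simp
  also have "\<dots> = (\<Sum>i = 1..n. count (image_mset snd (lift (\<gamma> i))) K)"
  proof (rule sum.cong[OF HOL.refl])
    fix i assume "i \<in> {1..n}"
    from count_img[OF finite_cycles[OF \<gamma>_closed[OF this]]]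
    show "card {c \<in> cycles (\<gamma> i). lift_class (\<gamma> i) c = K} = count (image_mset snd (lift (\<gamma> i))) K"
      by (simp add: lift_def multiset.map_comp comp_def)
  qed
  also have "\<dots> = count (\<Sum>i = 1..n. image_mset snd (lift (\<gamma> i))) K" by (simp add: count_sum)
  also have "\<dots> = card {j \<in> {1..n}. conj_class G (\<gamma> j) = K}"
    unfolding k using assms by (simp add: count_img)
  finally show ?thesis .
qed

end

subsection \<open>Automorphisms\<close>

context orbisphere_biset
begin

context
  fixes \<beta> :: "'b \<Rightarrow> 'b"
  assumes \<beta>: "\<beta> \<in> biset_automorphisms"
begin

lemma \<beta>_bij: "bij_betw \<beta> B B" and \<beta>_ext: "\<beta> \<in> extensional B"
  using \<beta> unfolding biset_automorphisms_def Bij_def by blast+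

lemma \<beta>_closed: "b \<in> B \<Longrightarrow> \<beta> b \<in> B"
  by (rule bij_betw_apply[OF \<beta>_bij])

lemma \<beta>_equivariant:
  "h \<in> carrier G \<Longrightarrow> g \<in> carrier G \<Longrightarrow> b \<in> B \<Longrightarrow> \<beta> (h \<rhd> b \<lhd>\<^sub>r g) = h \<rhd> \<beta> b \<lhd>\<^sub>r g"
  using \<beta> unfolding biset_automorphisms_def by blast

lemma \<beta>_lact:
  assumes "h \<in> carrier G" "b \<in> B"
  shows "\<beta> (h \<rhd> b) = h \<rhd> \<beta> b"
  using \<beta>_equivariant[OF assms(1) one_closed assms(2)]
  unfolding ract_one[OF assms(2)] ract_one[OF \<beta>_closed[OF assms(2)]] .

lemma \<beta>_ract:
  assumes "g \<in> carrier G" "b \<in> B"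
  shows "\<beta> (b \<lhd>\<^sub>r g) = \<beta> b \<lhd>\<^sub>r g"
  using \<beta>_equivariant[OF one_closed assms]
  unfolding lact_one[OF ract_closed[OF assms]] lact_one[OF ract_closed[OF assms(1) \<beta>_closed[OF assms(2)]]] .

lemma \<beta>_orb: "b \<in> B \<Longrightarrow> \<beta> ` orb b = orb (\<beta> b)"
  unfolding orb_def image_image by (intro image_cong HOL.refl \<beta>_lact)

text \<open>If \<open>\<beta>\<close> fixes a left orbit, it acts there as a left translation; right transitivity makes the
  translating element central.\<close>

lemma automorphism_trivial_if_fixed_orbit:
  assumes b: "b \<in> B" "\<beta> ` orb b = orb b"
    and center: "\<And>z. z \<in> carrier G \<Longrightarrow> (\<And>g. g \<in> carrier G \<Longrightarrow> z \<otimes> g = g \<otimes> z) \<Longrightarrow> z = \<one>"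
  shows "\<beta> = (\<lambda>b\<in>B. b)"
proof -
  have "\<beta> b \<in> orb b" using b orb_self by blast
  then obtain z where z: "z \<in> carrier G" "\<beta> b = z \<rhd> b" by (rule orbE)
  have trans: "\<exists>g\<in>carrier G. b' = b \<lhd>\<^sub>r g" if "b' \<in> B" for b'
    using right_transitive b(1) that unfolding right_transitive_def by blast
  have "z \<otimes> h = h \<otimes> z" if h: "h \<in> carrier G" for h
  proof -
    obtain g where g: "g \<in> carrier G" "h \<rhd> b = b \<lhd>\<^sub>r g" using trans[OF lact_closed[OF h b(1)]] by blast
    have "(h \<otimes> z) \<rhd> b = h \<rhd> (z \<rhd> b)" by (rule lact_mult[OF h z(1) b(1)])
    also have "\<dots> = \<beta> (h \<rhd> b)" unfolding \<beta>_lact[OF h b(1)] z(2) ..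
    also have "\<dots> = (z \<rhd> b) \<lhd>\<^sub>r g" unfolding g(2) \<beta>_ract[OF g(1) b(1)] z(2) ..
    also have "\<dots> = z \<rhd> (h \<rhd> b)" unfolding g(2) by (rule act_commute[OF z(1) g(1) b(1)])
    also have "\<dots> = (z \<otimes> h) \<rhd> b" by (rule lact_mult[OF z(1) h b(1), symmetric])
    finally show ?thesis
      by (intro left_free_unique[OF m_closed[OF z(1) h] m_closed[OF h z(1)] b(1)]) (rule HOL.sym)
  qed
  then have "z = \<one>" by (rule center[OF z(1)])
  then have bb: "\<beta> b = b" using z(2) lact_one[OF b(1)] by simp
  have "\<beta> b' = b'" if b': "b' \<in> B" for b'
  proof -
    obtain g where g: "g \<in> carrier G" "b' = b \<lhd>\<^sub>r g" using trans[OF b'] by blast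
    show ?thesis unfolding g(2) \<beta>_ract[OF g(1) b(1)] bb ..
  qed
  then show ?thesis by (intro extensionalityI[OF \<beta>_ext restrict_extensional]) simp
qed

definition \<tau> :: "'b set \<Rightarrow> 'b set" where "\<tau> = perm_restrict ((`) \<beta>) left_orbits"

lemma \<tau>_orb: "b \<in> B \<Longrightarrow> \<tau> (orb b) = orb (\<beta> b)"
  unfolding \<tau>_def by (subst perm_restrict_simps(1)) (auto simp only: left_orbits_eq \<beta>_orb)

lemma \<tau>_permutes: "\<tau> permutes left_orbits"
proof (rule bij_imp_permutes)
  have "\<tau> ` left_orbits = (\<lambda>b. orb (\<beta> b)) ` B"
    unfolding left_orbits_eq image_image by (rule image_cong[OF HOL.refl \<tau>_orb])
  also have "\<dots> = orb ` \<beta> ` B" by (simp add: image_image)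
  also have "\<beta> ` B = B" using \<beta>_bij by (rule bij_betw_imp_surj_on)
  finally have surj: "\<tau> ` left_orbits = left_orbits" by (simp add: left_orbits_eq)
  then have "inj_on \<tau> left_orbits" by (intro eq_card_imp_inj_on finite_left_orbits) simp
  with surj show "bij_betw \<tau> left_orbits left_orbits" by (simp add: bij_betw_def)
qed (simp add: \<tau>_def perm_restrict_def)

lemma left_orbits_nonempty: "left_orbits \<noteq> {}"
  using right_transitive unfolding right_transitive_def left_orbits_eq by blast

text \<open>Right transitivity joins two orbits by some element of \<open>G\<close>; writing it as a
  word in the generators gives a path.\<close>

lemma \<sigma>_transitive: "left_orbits \<times> left_orbits \<subseteq> eqcl (\<Union>i\<in>{1..n}. graph_on left_orbits (\<sigma> (\<gamma> i)))"
    (is "_ \<subseteq> eqcl ?R")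
proof -
  have edge: "(orb b, orb (b \<lhd>\<^sub>r \<gamma> i)) \<in> eqcl ?R" if "i \<in> {1..n}" "b \<in> B" for i b
  proof -
    have "(orb b, orb (b \<lhd>\<^sub>r \<gamma> i)) \<in> graph_on left_orbits (\<sigma> (\<gamma> i))"
      unfolding graph_on_def \<sigma>_orb[OF that(2) \<gamma>_closed[OF that(1)], symmetric] left_orbits_eq
      using that(2) by blast
    then show ?thesis using eqcl_incl[of ?R] that(1) by blast
  qed
  have carr: "\<gamma> ` {1..n} \<subseteq> carrier G" using \<gamma>_closed by blast
  have path: "\<forall>b\<in>B. (orb b, orb (b \<lhd>\<^sub>r g)) \<in> eqcl ?R" if "g \<in> generate G (\<gamma> ` {1..n})" for g
    using that
  proof induction
    case one
    then show ?case by (simp add: ract_one eqcl_refl)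
  next
    case (incl h)
    then show ?case using edge by blast
  next
    case (inv h)
    then obtain i where i: "i \<in> {1..n}" "h = \<gamma> i" by blast
    have g: "\<gamma> i \<in> carrier G" by (rule \<gamma>_closed[OF i(1)])
    show ?case
    proof
      fix b assume b: "b \<in> B"
      have b': "b \<lhd>\<^sub>r inv (\<gamma> i) \<in> B" by (rule ract_closed[OF inv_closed[OF g] b])
      have "b \<lhd>\<^sub>r inv (\<gamma> i) \<lhd>\<^sub>r \<gamma> i = b"
        using ract_mult[OF inv_closed[OF g] g b] g ract_one[OF b] by simp
      then show "(orb b, orb (b \<lhd>\<^sub>r inv h)) \<in> eqcl ?R"
        unfolding i(2) using eqcl_sym[OF edge[OF i(1) b']] by simp
    qed
  next
    case (eng g h)
    have gh: "g \<in> carrier G" "h \<in> carrier G" using eng.hyps generate_in_carrier[OF carr] by blast+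
    show ?case
    proof
      fix b assume b: "b \<in> B"
      show "(orb b, orb (b \<lhd>\<^sub>r (g \<otimes> h))) \<in> eqcl ?R"
        unfolding ract_mult[OF gh b]
        using eqcl_trans[OF bspec[OF eng.IH(1) b] bspec[OF eng.IH(2) ract_closed[OF gh(1) b]]] .
    qed
  qed
  show ?thesis
  proof (rule subsetI)
    fix p assume "p \<in> left_orbits \<times> left_orbits"
    then obtain b b' where bb: "b \<in> B" "b' \<in> B" "p = (orb b, orb b')" unfolding left_orbits_eq by blast
    then obtain g where "g \<in> carrier G" "b' = b \<lhd>\<^sub>r g"
      using right_transitive unfolding right_transitive_def by blast
    then show "p \<in> eqcl ?R" using path[of g] bb generate_\<gamma> by simp
  qed
qed

lemma \<sigma>_product:
  assumes X: "X \<in> left_orbits"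
  shows "fold (\<lambda>i. \<sigma> (\<gamma> i)) [1..<Suc n] X = X"
proof -
  have "set js \<subseteq> {1..n} \<Longrightarrow> foldl (\<lambda>Y i. rperm (\<gamma> i) Y) X js = fold (\<lambda>i. \<sigma> (\<gamma> i)) js X \<and>
      fold (\<lambda>i. \<sigma> (\<gamma> i)) js X \<in> left_orbits" for js
  proof (induction js rule: rev_induct)
    case Nil
    show ?case using X by simp
  next
    case (snoc i js)
    have i: "\<gamma> i \<in> carrier G" using \<gamma>_closed[of i] snoc.prems by simp
    let ?Y = "fold (\<lambda>i. \<sigma> (\<gamma> i)) js X"
    have IH: "foldl (\<lambda>Y i. rperm (\<gamma> i) Y) X js = ?Y" "?Y \<in> left_orbits" using snoc by simp_all
    have "rperm (\<gamma> i) ?Y = \<sigma> (\<gamma> i) ?Y" using IH(2) by (simp add: \<sigma>_def perm_restrict_def)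
    moreover have "\<sigma> (\<gamma> i) ?Y \<in> left_orbits"
      using permutes_in_image[OF \<sigma>_permutes[OF i]] IH(2) by blast
    ultimately show ?case using IH(1) by simp
  qed
  then have "foldl (\<lambda>Y i. rperm (\<gamma> i) Y) X [1..<Suc n] = fold (\<lambda>i. \<sigma> (\<gamma> i)) [1..<Suc n] X"
    by (rule conjunct1) (simp only: set_upt atLeastLessThanSuc_atLeastAtMost order_refl)
  then show ?thesis unfolding trivial_product[OF X] by (rule HOL.sym)
qed

section \<open>The automorphism as a deck permutation\<close>

interpretation D: deck_permutation left_orbits n "\<lambda>i. \<sigma> (\<gamma> i)" \<tau>
proof
  show "\<sigma> (\<gamma> i) permutes left_orbits" if "i \<in> {1..n}" for i
    by (rule \<sigma>_permutes[OF \<gamma>_closed[OF that]])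
  show "\<tau> (\<sigma> (\<gamma> i) X) = \<sigma> (\<gamma> i) (\<tau> X)" if i: "i \<in> {1..n}" and X: "X \<in> left_orbits" for i X
  proof -
    obtain b where b: "b \<in> B" "X = orb b" using X unfolding left_orbits_eq by blast
    have g: "\<gamma> i \<in> carrier G" by (rule \<gamma>_closed[OF i])
    show ?thesis
      unfolding b(2) \<sigma>_orb[OF b(1) g] \<tau>_orb[OF ract_closed[OF g b(1)]] \<tau>_orb[OF b(1)]
        \<sigma>_orb[OF \<beta>_closed[OF b(1)] g] \<beta>_ract[OF g b(1)] ..
  qed
  show "fold (\<lambda>i. \<sigma> (\<gamma> i)) [1..<Suc n] X = X" if "X \<in> left_orbits" for X
    using that by (rule \<sigma>_product)
qed (rule finite_left_orbits left_orbits_nonempty \<tau>_permutes \<sigma>_transitive)+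

lemma cycle_subset:
  assumes i: "i \<in> {1..n}" and c: "c \<in> cycles (\<gamma> i)"
  shows "c \<subseteq> left_orbits"
proof -
  obtain X where "X \<in> left_orbits" "c = orbit (\<sigma> (\<gamma> i)) X"
    using c unfolding cycles_eq[OF \<gamma>_closed[OF i]] by blast
  then show ?thesis using D.\<sigma>_orbit_subset[OF i] by simp
qed

lemma riemann_hurwitz_orbits:
  "(\<Sum>i = 1..n. int (card left_orbits) - int (card (orbit (\<sigma> (\<gamma> i)) ` left_orbits))) =
     2 * int (card left_orbits) - 2"
proof -
  have "(\<Sum>c\<in>cycles (\<gamma> i). int (card c) - 1) =
      int (card left_orbits) - int (card (orbit (\<sigma> (\<gamma> i)) ` left_orbits))" if i: "i \<in> {1..n}" for i
  proof -
    have g: "\<gamma> i \<in> carrier G" by (rule \<gamma>_closed[OF i])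
    have "(\<Sum>c\<in>cycles (\<gamma> i). int (card c)) = int (card left_orbits)"
      unfolding cycles_eq[OF g] of_nat_sum[symmetric] sum_card_orbits[OF finite_left_orbits \<sigma>_permutes[OF g]] ..
    then show ?thesis by (simp add: sum_subtractf cycles_eq[OF g])
  qed
  then have "(\<Sum>i = 1..n. \<Sum>c\<in>cycles (\<gamma> i). int (card c) - 1) =
      (\<Sum>i = 1..n. int (card left_orbits) - int (card (orbit (\<sigma> (\<gamma> i)) ` left_orbits)))"
    by (intro sum.cong HOL.refl)
  then show ?thesis using riemann_hurwitz by simp
qed

text \<open>Applying \<beta> to the equation that defines \<open>h\<close> at \<open>s\<close> gives
  the same equation at \<open>\<beta> s\<close>, so one element \<open>h\<close> computes the lifts
  of both cycles.\<close>

lemma \<tau>_cycle: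
  assumes i: "i \<in> {1..n}" and c: "c \<in> cycles (\<gamma> i)"
  shows "\<tau> ` c \<in> cycles (\<gamma> i)" "lift_class (\<gamma> i) (\<tau> ` c) = lift_class (\<gamma> i) c"
proof -
  have g: "\<gamma> i \<in> carrier G" by (rule \<gamma>_closed[OF i])
  obtain X where X: "X \<in> left_orbits" "c = orbit (\<sigma> (\<gamma> i)) X" using c unfolding cycles_eq[OF g] by blast
  have "\<tau> ` c = orbit (\<sigma> (\<gamma> i)) (\<tau> X)" unfolding X(2) by (rule D.image_\<tau>_\<sigma>_orbit[OF i X(1)])
  moreover have "\<tau> X \<in> left_orbits" using permutes_in_image[OF \<tau>_permutes] X(1) by blast
  ultimately show tc: "\<tau> ` c \<in> cycles (\<gamma> i)" unfolding cycles_eq[OF g] by blast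
  obtain s where s: "s \<in> \<Union>c" using cycle_nonempty[OF g c] by blast
  then obtain Y where Y: "Y \<in> c" "s \<in> Y" by blast
  have YL: "Y \<in> left_orbits" using cycle_subset[OF i c] Y(1) by blast
  have "\<tau> Y = \<beta> ` Y" using YL by (simp add: \<tau>_def perm_restrict_def)
  then have "\<beta> s \<in> \<tau> Y" using Y(2) by blast
  then have \<beta>s: "\<beta> s \<in> \<Union>(\<tau> ` c)" using Y(1) by blast
  have sB: "s \<in> B" by (rule cycle_of_member(1)[OF g c s])
  have cc: "card (\<tau> ` c) = card c"
    by (rule card_image[OF inj_on_subset[OF permutes_inj[OF \<tau>_permutes] subset_UNIV]])
  obtain h where h: "h \<in> carrier G" "h \<rhd> s = s \<lhd>\<^sub>r (\<gamma> i [^] card c)"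
    using lift_element_exists[OF g c s] by blast
  have "h \<rhd> \<beta> s = \<beta> s \<lhd>\<^sub>r (\<gamma> i [^] card (\<tau> ` c))"
    unfolding cc \<beta>_lact[OF h(1) sB, symmetric] h(2) by (rule \<beta>_ract[OF nat_pow_closed[OF g] sB])
  from lift_class_eq[OF g tc \<beta>s h(1) this] lift_class_eq[OF g c s h]
  show "lift_class (\<gamma> i) (\<tau> ` c) = lift_class (\<gamma> i) c" by simp
qed

lemma no_moved_orbit:
  assumes n: "3 \<le> n" and X: "X \<in> left_orbits"
  shows "\<tau> X = X"
proof (rule ccontr)
  assume moved: "\<tau> X \<noteq> X"
  interpret O: orbisphere_group_ge3 G n e \<gamma>
    by (intro orbisphere_group_ge3.intro orbisphere_group_ge3_axioms.intro orbisphere_group_axioms n)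
  define T where "T = Sigma {1..n} (\<lambda>i. cycles (\<gamma> i))"
  define cls where "cls = (\<lambda>(i, c). lift_class (\<gamma> i) c)"
  define kls where "kls = (\<lambda>j. conj_class G (\<gamma> j))"
  have finT: "finite T" unfolding T_def using finite_cycles[OF \<gamma>_closed] by (intro finite_SigmaI) auto
  have fibre: "card {t \<in> T. cls t = K} = card {j \<in> {1..n}. kls j = K}" if "K \<noteq> {\<one>}" for K
  proof -
    have "{t \<in> T. cls t = K} = {(i, c) \<in> Sigma {1..n} (\<lambda>i. cycles (\<gamma> i)). lift_class (\<gamma> i) c = K}"
      by (auto simp: T_def cls_def)
    then show ?thesis unfolding kls_def using card_lifts[OF that] by simp
  qed
  have kls_neq: "kls j \<noteq> {\<one>}" if "j \<in> {1..n}" for j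
    using conj_class_self[OF \<gamma>_closed[OF that]] O.\<gamma>_neq_one[OF that] unfolding kls_def by blast
  have conj: "\<exists>x\<in>carrier G. \<gamma> k = x \<otimes> \<gamma> j \<otimes> inv x" if "j \<in> {1..n}" "k \<in> {1..n}" "kls j = kls k" for j k
  proof -
    have "\<gamma> k \<in> conj_class G (\<gamma> j)"
      using conj_class_self[OF \<gamma>_closed[OF that(2)]] that(3) unfolding kls_def by simp
    then show ?thesis unfolding conj_class_def by blast
  qed
  have \<tau>T: "(i, \<tau> ` c) \<in> T \<and> cls (i, \<tau> ` c) = cls (i, c)" if "(i, c) \<in> T" for i c
    using \<tau>_cycle[of i c] that by (simp add: T_def cls_def)
  \<comment> \<open>Exactly \<open>n\<close> cycles carry a peripheral class. Were all of them
    invariant, there would be at least three invariant cycles, against the bound 2.\<close>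
  have "\<exists>i c. (i, c) \<in> T \<and> cls (i, c) \<in> kls ` {1..n} \<and> \<tau> ` c \<noteq> c"
  proof (rule ccontr)
    assume "\<not> ?thesis"
    then have sub: "{t \<in> T. cls t \<in> kls ` {1..n}} \<subseteq> Sigma {1..n} D.fixed_cycles"
      by (auto simp: T_def D.fixed_cycles_def cycles_eq[OF \<gamma>_closed])
    have finF: "finite (D.fixed_cycles i)" for i
      unfolding D.fixed_cycles_def using finite_left_orbits by simp
    have "{j \<in> {1..n}. kls j \<in> kls ` {1..n}} = {1..n}" by blast
    then have "n = card {j \<in> {1..n}. kls j \<in> kls ` {1..n}}" by (simp only: card_atLeastAtMost)
    also have "\<dots> = (\<Sum>K\<in>kls ` {1..n}. card {j \<in> {1..n}. kls j = K})"
      by (rule card_vimage_eq_sum[OF finite_atLeastAtMost finite_imageI[OF finite_atLeastAtMost]])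
    also have "\<dots> = (\<Sum>K\<in>kls ` {1..n}. card {t \<in> T. cls t = K})"
    proof (rule sum.cong[OF HOL.refl])
      fix K assume "K \<in> kls ` {1..n}"
      then have "K \<noteq> {\<one>}" using kls_neq by blast
      then show "card {j \<in> {1..n}. kls j = K} = card {t \<in> T. cls t = K}" by (rule fibre[symmetric])
    qed
    also have "\<dots> = card {t \<in> T. cls t \<in> kls ` {1..n}}"
      by (rule card_vimage_eq_sum[OF finT, symmetric]) simp
    also have "\<dots> \<le> card (Sigma {1..n} D.fixed_cycles)"
      by (rule card_mono[OF _ sub]) (use finF in simp)
    also have "\<dots> = (\<Sum>i = 1..n. card (D.fixed_cycles i))" by (rule card_SigmaI) (simp_all add: finF)
    also have "\<dots> \<le> 2" by (rule D.card_fixed_cycles_le_2[OF riemann_hurwitz_orbits X moved])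
    finally show False using n by simp
  qed
  then obtain i c where ic: "(i, c) \<in> T" "cls (i, c) \<in> kls ` {1..n}" "\<tau> ` c \<noteq> c" by blast
  have iI: "i \<in> {1..n}" and cI: "c \<in> cycles (\<gamma> i)" using ic(1) by (auto simp: T_def)
  define K where "K = cls (i, c)"
  have K: "K \<noteq> {\<one>}" using ic(2) kls_neq unfolding K_def by blast
  define J where "J = {j \<in> {1..n}. kls j = K}"
  have finJ: "finite J" by (simp add: J_def)
  \<comment> \<open>A class lifted twice belongs to two indices, that is, to two conjugate
    generators.\<close>
  have "{(i, c), (i, \<tau> ` c)} \<subseteq> {t \<in> T. cls t = K}" using \<tau>T[OF ic(1)] ic(1) by (auto simp: K_def)
  then have "card {(i, c), (i, \<tau> ` c)} \<le> card {t \<in> T. cls t = K}" using finT by (intro card_mono) auto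
  then have "2 \<le> card J" using fibre[OF K] ic(3) by (simp add: J_def)
  then obtain j k where jk: "j \<in> J" "k \<in> J" "j \<noteq> k"
    by (metis card_le_Suc0_iff_eq[OF finJ] not_less_eq_eq numeral_2_eq_2)
  have jI: "j \<in> {1..n}" and kI: "k \<in> {1..n}" and kls_jk: "kls j = K" "kls k = K" using jk by (auto simp: J_def)
  obtain x where x: "x \<in> carrier G" "\<gamma> k = x \<otimes> \<gamma> j \<otimes> inv x" using conj[OF jI kI] kls_jk by auto
  have e2: "e j = 2" "e k = 2" and odd: "\<And>l. l \<in> {1..n} \<Longrightarrow> l \<noteq> j \<Longrightarrow> l \<noteq> k \<Longrightarrow> \<exists>q. e l = enat q \<and> odd q"
    using O.conjugate_generators[OF jI kI jk(3) x] by blast+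
  \<comment> \<open>A generator other than \<open>j\<close> and \<open>k\<close> has odd order, so
    it is conjugate to no other generator.\<close>
  have unique: "l = l'" if l: "l \<in> {1..n}" "l \<noteq> j" "l \<noteq> k" "l' \<in> {1..n}" "kls l = kls l'" for l l'
  proof (rule ccontr)
    assume "l \<noteq> l'"
    obtain y where y: "y \<in> carrier G" "\<gamma> l' = y \<otimes> \<gamma> l \<otimes> inv y" using conj[OF l(1,4,5)] by blast
    have "e l = 2" by (rule O.conjugate_generators(1)[OF l(1,4) \<open>l \<noteq> l'\<close> y])
    with odd[OF l(1-3)] show False by (auto simp: numeral_eq_enat)
  qed
  have "J \<subseteq> {j, k}"
  proof
    fix l assume "l \<in> J"
    then show "l \<in> {j, k}" using unique[of l j] jI kls_jk jk(3) by (auto simp: J_def)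
  qed
  then have "card J \<le> 2" using card_mono[of "{j, k}" J] card_2_iff[of "{j, k}"] jk(3) by auto
  \<comment> \<open>Only two cycles carry the class \<open>K\<close>, and \<tau> permutes them
    without fixing \<open>c\<close>, so it exchanges them.\<close>
  then have TK: "{t \<in> T. cls t = K} = {(i, c), (i, \<tau> ` c)}"
    using \<open>{(i, c), (i, \<tau> ` c)} \<subseteq> {t \<in> T. cls t = K}\<close> fibre[OF K] ic(3) finT
    by (intro card_seteq[symmetric]) (auto simp: J_def)
  have "(i, \<tau> ` \<tau> ` c) \<in> {t \<in> T. cls t = K}" using \<tau>T \<tau>T[OF ic(1)] by (simp add: K_def)
  then have "\<tau> ` \<tau> ` c = c \<or> \<tau> ` \<tau> ` c = \<tau> ` c" unfolding TK by blast
  then have \<tau>\<tau>: "\<tau> ` \<tau> ` c = c"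
    using inj_image_eq_iff[OF permutes_inj[OF \<tau>_permutes], of "\<tau> ` c" c] ic(3) by blast
  \<comment> \<open>The class of a third generator \<open>l\<close> is lifted by one cycle only.
    That cycle is invariant, hence of even length by \<open>fixed_cycle_even\<close>.\<close>
  have "\<not> {1..n} \<subseteq> {j, k}" using card_mono[of "{j, k}" "{1..n}"] n jk(3) by auto
  then obtain l where l: "l \<in> {1..n}" "l \<noteq> j" "l \<noteq> k" by blast
  have "{j' \<in> {1..n}. kls j' = kls l} = {l}"
    using unique[OF l] l(1) by blast
  then have "card {t \<in> T. cls t = kls l} = 1" using fibre[OF kls_neq[OF l(1)]] by simp
  then obtain i' c' where ic': "{t \<in> T. cls t = kls l} = {(i', c')}"
    by (auto simp: card_1_singleton_iff)
  then have icT: "(i', c') \<in> T" "cls (i', c') = kls l" by blast+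
  have iI': "i' \<in> {1..n}" and cI': "c' \<in> cycles (\<gamma> i')" using icT(1) by (auto simp: T_def)
  have "(i', \<tau> ` c') \<in> {t \<in> T. cls t = kls l}" using \<tau>T[OF icT(1)] icT(2) by simp
  then have fixed: "\<tau> ` c' = c'" unfolding ic' by blast
  have "even (card c')"
    by (rule D.fixed_cycle_even[OF iI _ ic(3) \<tau>\<tau> cycle_subset[OF iI' cI'] fixed])
      (use cI in \<open>simp add: cycles_eq[OF \<gamma>_closed[OF iI]]\<close>)
  have g': "\<gamma> i' \<in> carrier G" by (rule \<gamma>_closed[OF iI'])
  \<comment> \<open>The length divides the order of the generator, which rules out odd orders. What
    remains is order 2 and length 2, but then the lift is the trivial class, which cannot be that of
    \<open>\<gamma> l\<close>.\<close>
  have "i' = j \<or> i' = k"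
  proof (rule ccontr)
    assume "\<not> (i' = j \<or> i' = k)"
    then obtain q where q: "e i' = enat q" "odd q" using odd[OF iI'] by blast
    have "card c' dvd q" by (rule card_cycle_dvd[OF g' cI' \<gamma>_pow_order[OF iI' q(1)]])
    with \<open>even (card c')\<close> q(2) show False using dvd_trans by blast
  qed
  then have "e i' = enat 2" using e2 by (auto simp: numeral_eq_enat)
  then have sq: "\<gamma> i' [^] (2::nat) = \<one>" by (rule \<gamma>_pow_order[OF iI'])
  have "card c' dvd 2" by (rule card_cycle_dvd[OF g' cI' sq])
  then have "card c' = 2" using \<open>even (card c')\<close> by (simp add: dvd_antisym)
  then have "lift_class (\<gamma> i') c' = {\<one>}" using lift_class_trivial[OF g' cI'] sq by simp
  with icT(2) kls_neq[OF l(1)] show False by (simp add: cls_def)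
qed

theorem automorphism_trivial:
  assumes "\<not> cyclic_group G" "\<not> even_dihedral_orders n e"
  shows "\<beta> = (\<lambda>b\<in>B. b)"
proof -
  have n: "3 \<le> n" using cyclic_if_le_2 assms(1) by (cases "n \<le> 2") auto
  interpret O: orbisphere_group_ge3 G n e \<gamma>
    by (intro orbisphere_group_ge3.intro orbisphere_group_ge3_axioms.intro orbisphere_group_axioms n)
  obtain b where b: "b \<in> B" using right_transitive unfolding right_transitive_def by blast
  have "orb b \<in> left_orbits" using b unfolding left_orbits_eq by blast
  then have "\<tau> (orb b) = orb b" by (rule no_moved_orbit[OF n])
  then have "\<beta> ` orb b = orb b" using \<tau>_orb[OF b] \<beta>_orb[OF b] by simp
  then show ?thesis
    by (rule automorphism_trivial_if_fixed_orbit[OF b]) (rule O.center_trivial[OF _ _ assms])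
qed

end

end

theorem mainTheorem10:
  fixes G :: "('a, 'c) monoid_scheme" and n :: nat and e :: "nat \<Rightarrow> enat" and \<gamma> :: "nat \<Rightarrow> 'a"
    and B :: "'b set" and lact :: "'a \<Rightarrow> 'b \<Rightarrow> 'b" and ract :: "'b \<Rightarrow> 'a \<Rightarrow> 'b"
  assumes "orbisphere_biset G n e \<gamma> B lact ract"
    and "\<not> cyclic_group G"
    and "\<not> even_dihedral_orders n e"
  shows "biset.biset_automorphisms G B lact ract = {\<lambda>b\<in>B. b}"
proof -
  interpret orbisphere_biset G n e \<gamma> B lact ract by fact
  have "(\<lambda>b\<in>B. b) \<in> biset_automorphisms"
    unfolding biset_automorphisms_def using id_Bij[of B] lact_closed ract_closed by simp
  then show ?thesis using automorphism_trivial[OF _ assms(2,3)] by blast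
qed

end
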